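(* Let $\mathcal{C}$ be a lextensive category with dependent $\mathcal{W}$-types and dependent $\mathcal{M}$-types, and let $F : \mathrm{Cont}(\mathcal{C}) \to \mathrm{Cont}(\mathcal{C})$ be a fibred polynomial functor with base functor $F_0 : \mathcal{C} \to \mathcal{C}$. Then: (1) $F$ has an initial algebra $(\mu F, a_{\mu F})$; (2) $F$ has a terminal coalgebra $(\nu F, c_{\nu F})$; (3) $F$ has an algebra $(\zeta F, b)$, $b : F(\zeta F) \to \zeta F$, with the following properties: writing $\zeta F : D \to N$ and $b = (\beta, \beta')$ with forward part $\beta : F_0(N) \to N$, the morphism $\beta$ is invertible and $(N, c)$ with $c = \beta^{-1} : N \to F_0(N)$ is a terminal $F_0$-coalgebra; and $\zeta F$, regarded as an object of $\mathcal{C}/N$, together with the map induced by the backward part $\beta'$, is a terminal coalgebra for the endofunctor $c^* \circ F_N$ of $\mathcal{C}/N$ (where $F_N : \mathcal{C}/N \to \mathcal{C}/F_0(N)$ is the functor induced by $F$ on fibres and $c^*$ is pullback along $c$).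
   Context: $\mathcal{C}$ is assumed extensive with finite limits, and (as needed to speak of polynomial functors) locally cartesian closed. A polynomial functor $\mathcal{C}/T \to \mathcal{C}/U$ is one isomorphic to $\Sigma_u \circ \Pi_P \circ t^*$ for some diagram $T \xleftarrow{t} A \xrightarrow{P} I \xrightarrow{u} U$ in $\mathcal{C}$ ($t^*$ pullback, $\Pi_P$ its right adjoint along $P$, $\Sigma_u$ postcomposition). $\mathcal{C}$ has dependent $\mathcal{W}$-types (resp. $\mathcal{M}$-types) if for every object $I$ every polynomial functor $\mathcal{C}/I \to \mathcal{C}/I$ has an initial algebra (resp. terminal coalgebra). $\mathrm{Cont}(\mathcal{C})$ is the category whose objects (containers) are morphisms $P : A \to I$ of $\mathcal{C}$ ($I$ is the shape, $A$ the directions); a morphism $(\varphi,\psi) : (P : A \to I) \to (Q : B \to J)$ consists of $\varphi : I \to J$ (forward part) and a morphism $\psi : \varphi^*(B) = I \times_J B \to A$ over $I$ (backward part); composition uses pullbacks. The functor $\mathrm{shape} : \mathrm{Cont}(\mathcal{C}) \to \mathcal{C}$, $P \mapsto I$, $(\varphi,\psi) \mapsto \varphi$, is a fibration; a morphism is cartesian if $\psi$ is an isomorphism and vertical if $\varphi = \mathrm{id}$. The vertical morphisms over $I$ form $(\mathcal{C}/I)^{op}$. A functor $F : \mathrm{Cont}(\mathcal{C})^k \to \mathrm{Cont}(\mathcal{C})$ is a fibred polynomial functor if (1) there is $F_0 : \mathcal{C}^k \to \mathcal{C}$ with $\mathrm{shape} \circ F = F_0 \circ \mathrm{shape}^k$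 and $F$ sends cartesian morphisms to cartesian morphisms, (2) $F_0$ is a polynomial functor, and (3) for every $I = (I_1,\dots,I_k)$, the functor $F_I : \mathcal{C}/(I_1+\dots+I_k) \to \mathcal{C}/F_0(I)$ induced by $F$ on fibres (via $\mathcal{C}/(I_1+\dots+I_k) \cong \prod_j \mathcal{C}/I_j$) is polynomial. *)

theory Defs
  imports Main
begin

section \<open>Categories, functors, natural transformations\<close>

record ('o, 'a) cat =
  Obj :: "'o set"
  Arr :: "'a set"
  Dom :: "'a \<Rightarrow> 'o"
  Cod :: "'a \<Rightarrow> 'o"
  Ident :: "'o \<Rightarrow> 'a"
  Comp :: "'a \<Rightarrow> 'a \<Rightarrow> 'a" (infixl "\<cdot>\<index>" 70)

definition hom :: "('o, 'a) cat \<Rightarrow> 'o \<Rightarrow> 'o \<Rightarrow> 'a set" where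
  "hom C x y = {f \<in> Arr C. Dom C f = x \<and> Cod C f = y}"

text \<open>\<open>g \<cdot>\<^bsub>C\<^esub> f\<close> is ``\<open>g\<close> after \<open>f\<close>''.\<close>

locale category =
  fixes C :: "('o, 'a) cat" (structure)
  assumes Dom_in: "f \<in> Arr C \<Longrightarrow> Dom C f \<in> Obj C"
    and Cod_in: "f \<in> Arr C \<Longrightarrow> Cod C f \<in> Obj C"
    and Ident_in: "x \<in> Obj C \<Longrightarrow> Ident C x \<in> hom C x x"
    and Comp_in: "f \<in> hom C x y \<Longrightarrow> g \<in> hom C y z \<Longrightarrow> g \<cdot> f \<in> hom C x z"
    and Ident_left: "f \<in> hom C x y \<Longrightarrow> Ident C y \<cdot> f = f"
    and Ident_right: "f \<in> hom C x y \<Longrightarrow> f \<cdot> Ident C x = f"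
    and Comp_assoc: "f \<in> hom C w x \<Longrightarrow> g \<in> hom C x y \<Longrightarrow> h \<in> hom C y z \<Longrightarrow>
      (h \<cdot> g) \<cdot> f = h \<cdot> (g \<cdot> f)"

definition inverse_arr :: "('o, 'a) cat \<Rightarrow> 'a \<Rightarrow> 'a \<Rightarrow> bool" where
  "inverse_arr C f g \<longleftrightarrow> f \<in> Arr C \<and> g \<in> hom C (Cod C f) (Dom C f) \<and>
     g \<cdot>\<^bsub>C\<^esub> f = Ident C (Dom C f) \<and> f \<cdot>\<^bsub>C\<^esub> g = Ident C (Cod C f)"

definition iso_arr :: "('o, 'a) cat \<Rightarrow> 'a \<Rightarrow> bool" where
  "iso_arr C f \<longleftrightarrow> (\<exists>g. inverse_arr C f g)"

definition inv_arr :: "('o, 'a) cat \<Rightarrow> 'a \<Rightarrow> 'a" where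
  "inv_arr C f = (THE g. inverse_arr C f g)"

record ('o, 'a, 'p, 'b) func =
  fob :: "'o \<Rightarrow> 'p"
  far :: "'a \<Rightarrow> 'b"

definition is_functor :: "('o, 'a) cat \<Rightarrow> ('p, 'b) cat \<Rightarrow> ('o, 'a, 'p, 'b) func \<Rightarrow> bool" where
  "is_functor C D F \<longleftrightarrow>
     (\<forall>x\<in>Obj C. fob F x \<in> Obj D) \<and>
     (\<forall>f\<in>Arr C. far F f \<in> hom D (fob F (Dom C f)) (fob F (Cod C f))) \<and>
     (\<forall>x\<in>Obj C. far F (Ident C x) = Ident D (fob F x)) \<and>
     (\<forall>f\<in>Arr C. \<forall>g\<in>Arr C. Cod C f = Dom C g \<longrightarrow>
        far F (g \<cdot>\<^bsub>C\<^esub> f) = far F g \<cdot>\<^bsub>D\<^esub> far F f)"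

definition id_func :: "('o, 'a, 'o, 'a) func" where
  "id_func = \<lparr>fob = \<lambda>x. x, far = \<lambda>f. f\<rparr>"

definition comp_func ::
  "('p, 'b, 'q, 'c) func \<Rightarrow> ('o, 'a, 'p, 'b) func \<Rightarrow> ('o, 'a, 'q, 'c) func"
  (infixr "\<circ>\<^sub>F" 55) where
  "G \<circ>\<^sub>F F = \<lparr>fob = \<lambda>x. fob G (fob F x), far = \<lambda>f. far G (far F f)\<rparr>"

text \<open>Equality of functors with domain \<open>C\<close>; the values outside of \<open>C\<close> are irrelevant.\<close>

definition eq_func ::
  "('o, 'a) cat \<Rightarrow> ('o, 'a, 'p, 'b) func \<Rightarrow> ('o, 'a, 'p, 'b) func \<Rightarrow> bool" where
  "eq_func C F G \<longleftrightarrow> (\<forall>x\<in>Obj C. fob F x = fob G x) \<and> (\<forall>f\<in>Arr C. far F f = far G f)"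

definition nat_trans :: "('o, 'a) cat \<Rightarrow> ('p, 'b) cat \<Rightarrow>
    ('o, 'a, 'p, 'b) func \<Rightarrow> ('o, 'a, 'p, 'b) func \<Rightarrow> ('o \<Rightarrow> 'b) \<Rightarrow> bool" where
  "nat_trans C D F G \<eta> \<longleftrightarrow>
     (\<forall>x\<in>Obj C. \<eta> x \<in> hom D (fob F x) (fob G x)) \<and>
     (\<forall>f\<in>Arr C. \<eta> (Cod C f) \<cdot>\<^bsub>D\<^esub> far F f = far G f \<cdot>\<^bsub>D\<^esub> \<eta> (Dom C f))"

definition nat_isomorphic :: "('o, 'a) cat \<Rightarrow> ('p, 'b) cat \<Rightarrow>
    ('o, 'a, 'p, 'b) func \<Rightarrow> ('o, 'a, 'p, 'b) func \<Rightarrow> bool" where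
  "nat_isomorphic C D F G \<longleftrightarrow>
     (\<exists>\<eta>. nat_trans C D F G \<eta> \<and> (\<forall>x\<in>Obj C. iso_arr D (\<eta> x)))"

definition equivalence :: "('o, 'a) cat \<Rightarrow> ('p, 'b) cat \<Rightarrow> ('o, 'a, 'p, 'b) func \<Rightarrow> bool" where
  "equivalence C D F \<longleftrightarrow> is_functor C D F \<and>
     (\<exists>G. is_functor D C G \<and> nat_isomorphic C C (G \<circ>\<^sub>F F) id_func \<and>
          nat_isomorphic D D (F \<circ>\<^sub>F G) id_func)"

definition right_adjoint :: "('o, 'a) cat \<Rightarrow> ('p, 'b) cat \<Rightarrow>
    ('o, 'a, 'p, 'b) func \<Rightarrow> ('p, 'b, 'o, 'a) func \<Rightarrow> bool" where
  "right_adjoint C D L R \<longleftrightarrow> is_functor C D L \<and> is_functor D C R \<and>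
     (\<exists>\<eta> \<epsilon>. nat_trans C C id_func (R \<circ>\<^sub>F L) \<eta> \<and> nat_trans D D (L \<circ>\<^sub>F R) id_func \<epsilon> \<and>
        (\<forall>x\<in>Obj C. \<epsilon> (fob L x) \<cdot>\<^bsub>D\<^esub> far L (\<eta> x) = Ident D (fob L x)) \<and>
        (\<forall>y\<in>Obj D. far R (\<epsilon> y) \<cdot>\<^bsub>C\<^esub> \<eta> (fob R y) = Ident C (fob R y)))"

definition prod_cat :: "('o, 'a) cat \<Rightarrow> ('p, 'b) cat \<Rightarrow> ('o \<times> 'p, 'a \<times> 'b) cat" where
  "prod_cat C D = \<lparr>
     Obj = Obj C \<times> Obj D,
     Arr = Arr C \<times> Arr D,
     Dom = \<lambda>(f, g). (Dom C f, Dom D g),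
     Cod = \<lambda>(f, g). (Cod C f, Cod D g),
     Ident = \<lambda>(x, y). (Ident C x, Ident D y),
     Comp = \<lambda>(f', g') (f, g). (f' \<cdot>\<^bsub>C\<^esub> f, g' \<cdot>\<^bsub>D\<^esub> g)\<rparr>"


section \<open>Algebras and coalgebras\<close>

definition algebra :: "('o, 'a) cat \<Rightarrow> ('o, 'a, 'o, 'a) func \<Rightarrow> 'o \<Rightarrow> 'a \<Rightarrow> bool" where
  "algebra C F x a \<longleftrightarrow> x \<in> Obj C \<and> a \<in> hom C (fob F x) x"

definition coalgebra :: "('o, 'a) cat \<Rightarrow> ('o, 'a, 'o, 'a) func \<Rightarrow> 'o \<Rightarrow> 'a \<Rightarrow> bool" where
  "coalgebra C F x c \<longleftrightarrow> x \<in> Obj C \<and> c \<in> hom C x (fob F x)"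

definition initial_algebra :: "('o, 'a) cat \<Rightarrow> ('o, 'a, 'o, 'a) func \<Rightarrow> 'o \<Rightarrow> 'a \<Rightarrow> bool" where
  "initial_algebra C F x a \<longleftrightarrow> algebra C F x a \<and>
     (\<forall>y b. algebra C F y b \<longrightarrow>
        (\<exists>!h. h \<in> hom C x y \<and> h \<cdot>\<^bsub>C\<^esub> a = b \<cdot>\<^bsub>C\<^esub> far F h))"

definition terminal_coalgebra ::
  "('o, 'a) cat \<Rightarrow> ('o, 'a, 'o, 'a) func \<Rightarrow> 'o \<Rightarrow> 'a \<Rightarrow> bool" where
  "terminal_coalgebra C F x c \<longleftrightarrow> coalgebra C F x c \<and>
     (\<forall>y d. coalgebra C F y d \<longrightarrow>
        (\<exists>!h. h \<in> hom C y x \<and> c \<cdot>\<^bsub>C\<^esub> h = far F h \<cdot>\<^bsub>C\<^esub> d))"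


section \<open>Finite limits and finite coproducts\<close>

definition is_cone :: "('i, 'u) cat \<Rightarrow> ('o, 'a) cat \<Rightarrow> ('i, 'u, 'o, 'a) func \<Rightarrow>
    'o \<Rightarrow> ('i \<Rightarrow> 'a) \<Rightarrow> bool" where
  "is_cone J C D x \<kappa> \<longleftrightarrow> x \<in> Obj C \<and> (\<forall>j\<in>Obj J. \<kappa> j \<in> hom C x (fob D j)) \<and>
     (\<forall>u\<in>Arr J. far D u \<cdot>\<^bsub>C\<^esub> \<kappa> (Dom J u) = \<kappa> (Cod J u))"

definition is_limit :: "('i, 'u) cat \<Rightarrow> ('o, 'a) cat \<Rightarrow> ('i, 'u, 'o, 'a) func \<Rightarrow>
    'o \<Rightarrow> ('i \<Rightarrow> 'a) \<Rightarrow> bool" where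
  "is_limit J C D l \<pi> \<longleftrightarrow> is_cone J C D l \<pi> \<and>
     (\<forall>x \<kappa>. is_cone J C D x \<kappa> \<longrightarrow>
        (\<exists>!h. h \<in> hom C x l \<and> (\<forall>j\<in>Obj J. \<pi> j \<cdot>\<^bsub>C\<^esub> h = \<kappa> j)))"

text \<open>Every finite category is isomorphic to one whose objects and arrows are natural numbers.\<close>

definition has_finite_limits :: "('o, 'a) cat \<Rightarrow> bool" where
  "has_finite_limits C \<longleftrightarrow>
     (\<forall>(J :: (nat, nat) cat) D. category J \<and> finite (Obj J) \<and> finite (Arr J) \<and>
        is_functor J C D \<longrightarrow> (\<exists>l \<pi>. is_limit J C D l \<pi>))"

definition is_terminal :: "('o, 'a) cat \<Rightarrow> 'o \<Rightarrow> bool" where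
  "is_terminal C t \<longleftrightarrow> t \<in> Obj C \<and> (\<forall>x\<in>Obj C. \<exists>!f. f \<in> hom C x t)"

definition is_initial :: "('o, 'a) cat \<Rightarrow> 'o \<Rightarrow> bool" where
  "is_initial C i \<longleftrightarrow> i \<in> Obj C \<and> (\<forall>x\<in>Obj C. \<exists>!f. f \<in> hom C i x)"

definition is_pullback :: "('o, 'a) cat \<Rightarrow> 'a \<Rightarrow> 'a \<Rightarrow> 'a \<Rightarrow> 'a \<Rightarrow> bool" where
  "is_pullback C f g p q \<longleftrightarrow>
     f \<in> Arr C \<and> g \<in> Arr C \<and> p \<in> Arr C \<and> q \<in> Arr C \<and>
     Cod C f = Cod C g \<and> Dom C p = Dom C q \<and> Cod C p = Dom C f \<and> Cod C q = Dom C g \<and>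
     f \<cdot>\<^bsub>C\<^esub> p = g \<cdot>\<^bsub>C\<^esub> q \<and>
     (\<forall>x u v. u \<in> hom C x (Dom C f) \<and> v \<in> hom C x (Dom C g) \<and> f \<cdot>\<^bsub>C\<^esub> u = g \<cdot>\<^bsub>C\<^esub> v \<longrightarrow>
        (\<exists>!h. h \<in> hom C x (Dom C p) \<and> p \<cdot>\<^bsub>C\<^esub> h = u \<and> q \<cdot>\<^bsub>C\<^esub> h = v))"

text \<open>
  A fixed choice of pullbacks: for \<open>f : I \<rightarrow> J\<close> and \<open>q : B \<rightarrow> J\<close> the chosen pullback
  \<open>f\<^sup>*(B) = I \<times>\<^sub>J B\<close> is the object \<open>pb_obj C f q\<close> with projections
  \<open>pb_fst C f q\<close> to \<open>I\<close> and \<open>pb_snd C f q\<close> to \<open>B\<close>.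
\<close>

definition pb :: "('o, 'a) cat \<Rightarrow> 'a \<Rightarrow> 'a \<Rightarrow> 'a \<times> 'a" where
  "pb C f q = (SOME (p, r). is_pullback C f q p r)"

definition pb_fst :: "('o, 'a) cat \<Rightarrow> 'a \<Rightarrow> 'a \<Rightarrow> 'a" where
  "pb_fst C f q = fst (pb C f q)"

definition pb_snd :: "('o, 'a) cat \<Rightarrow> 'a \<Rightarrow> 'a \<Rightarrow> 'a" where
  "pb_snd C f q = snd (pb C f q)"

definition pb_obj :: "('o, 'a) cat \<Rightarrow> 'a \<Rightarrow> 'a \<Rightarrow> 'o" where
  "pb_obj C f q = Dom C (pb_fst C f q)"

definition pb_pair :: "('o, 'a) cat \<Rightarrow> 'a \<Rightarrow> 'a \<Rightarrow> 'a \<Rightarrow> 'a \<Rightarrow> 'a" where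
  "pb_pair C f q u v = (THE h. h \<in> hom C (Dom C u) (pb_obj C f q) \<and>
     pb_fst C f q \<cdot>\<^bsub>C\<^esub> h = u \<and> pb_snd C f q \<cdot>\<^bsub>C\<^esub> h = v)"

definition is_coproduct :: "('o, 'a) cat \<Rightarrow> 'o \<Rightarrow> 'o \<Rightarrow> 'a \<Rightarrow> 'a \<Rightarrow> bool" where
  "is_coproduct C x y i j \<longleftrightarrow>
     i \<in> Arr C \<and> j \<in> Arr C \<and> Dom C i = x \<and> Dom C j = y \<and> Cod C i = Cod C j \<and>
     (\<forall>z u v. u \<in> hom C x z \<and> v \<in> hom C y z \<longrightarrow>
        (\<exists>!h. h \<in> hom C (Cod C i) z \<and> h \<cdot>\<^bsub>C\<^esub> i = u \<and> h \<cdot>\<^bsub>C\<^esub> j = v))"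

definition has_finite_coproducts :: "('o, 'a) cat \<Rightarrow> bool" where
  "has_finite_coproducts C \<longleftrightarrow> (\<exists>i. is_initial C i) \<and>
     (\<forall>x\<in>Obj C. \<forall>y\<in>Obj C. \<exists>i j. is_coproduct C x y i j)"

definition coprod :: "('o, 'a) cat \<Rightarrow> 'o \<Rightarrow> 'o \<Rightarrow> 'a \<times> 'a" where
  "coprod C x y = (SOME (i, j). is_coproduct C x y i j)"

definition inl :: "('o, 'a) cat \<Rightarrow> 'o \<Rightarrow> 'o \<Rightarrow> 'a" where
  "inl C x y = fst (coprod C x y)"

definition inr :: "('o, 'a) cat \<Rightarrow> 'o \<Rightarrow> 'o \<Rightarrow> 'a" where
  "inr C x y = snd (coprod C x y)"

definition coprod_obj :: "('o, 'a) cat \<Rightarrow> 'o \<Rightarrow> 'o \<Rightarrow> 'o" where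
  "coprod_obj C x y = Cod C (inl C x y)"

definition coprod_arr :: "('o, 'a) cat \<Rightarrow> 'a \<Rightarrow> 'a \<Rightarrow> 'a" where
  "coprod_arr C f g = (THE h.
     h \<in> hom C (coprod_obj C (Dom C f) (Dom C g)) (coprod_obj C (Cod C f) (Cod C g)) \<and>
     h \<cdot>\<^bsub>C\<^esub> inl C (Dom C f) (Dom C g) = inl C (Cod C f) (Cod C g) \<cdot>\<^bsub>C\<^esub> f \<and>
     h \<cdot>\<^bsub>C\<^esub> inr C (Dom C f) (Dom C g) = inr C (Cod C f) (Cod C g) \<cdot>\<^bsub>C\<^esub> g)"


section \<open>Slices, extensivity, local cartesian closure\<close>

text \<open>
  An arrow of \<open>C/I\<close> from \<open>p\<close> to \<open>q\<close> is recorded as a triple \<open>(p, h, q)\<close>, so that it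
  determines its domain and codomain.
\<close>

definition slice :: "('o, 'a) cat \<Rightarrow> 'o \<Rightarrow> ('a, 'a \<times> 'a \<times> 'a) cat" where
  "slice C I = \<lparr>
     Obj = {p \<in> Arr C. Cod C p = I},
     Arr = {(p, h, q). p \<in> Arr C \<and> Cod C p = I \<and> q \<in> Arr C \<and> Cod C q = I \<and>
                       h \<in> hom C (Dom C p) (Dom C q) \<and> q \<cdot>\<^bsub>C\<^esub> h = p},
     Dom = \<lambda>(p, h, q). p,
     Cod = \<lambda>(p, h, q). q,
     Ident = \<lambda>p. (p, Ident C (Dom C p), p),
     Comp = \<lambda>(_, k, r) (p, h, _). (p, k \<cdot>\<^bsub>C\<^esub> h, r)\<rparr>"

definition sum_func :: "('o, 'a) cat \<Rightarrow>
    ('a \<times> 'a, ('a \<times> 'a \<times> 'a) \<times> ('a \<times> 'a \<times> 'a), 'a, 'a \<times> 'a \<times> 'a) func" where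
  "sum_func C = \<lparr>
     fob = \<lambda>(f, g). coprod_arr C f g,
     far = \<lambda>((f, h, f'), (g, k, g')).
             (coprod_arr C f g, coprod_arr C h k, coprod_arr C f' g')\<rparr>"

definition extensive :: "('o, 'a) cat \<Rightarrow> bool" where
  "extensive C \<longleftrightarrow> has_finite_coproducts C \<and>
     (\<forall>x\<in>Obj C. \<forall>y\<in>Obj C.
        equivalence (prod_cat (slice C x) (slice C y)) (slice C (coprod_obj C x y)) (sum_func C))"

definition lextensive :: "('o, 'a) cat \<Rightarrow> bool" where
  "lextensive C \<longleftrightarrow> extensive C \<and> has_finite_limits C"

text \<open>The pullback functor \<open>f\<^sup>* : C/J \<rightarrow> C/I\<close> along \<open>f : I \<rightarrow> J\<close>.\<close>

definition pb_func ::
  "('o, 'a) cat \<Rightarrow> 'a \<Rightarrow> ('a, 'a \<times> 'a \<times> 'a, 'a, 'a \<times> 'a \<times> 'a) func" where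
  "pb_func C f = \<lparr>
     fob = \<lambda>q. pb_fst C f q,
     far = \<lambda>(p, h, q).
       (pb_fst C f p, pb_pair C f q (pb_fst C f p) (h \<cdot>\<^bsub>C\<^esub> pb_snd C f p), pb_fst C f q)\<rparr>"

text \<open>Postcomposition \<open>\<Sigma>\<^sub>u : C/I \<rightarrow> C/U\<close> with \<open>u : I \<rightarrow> U\<close>.\<close>

definition Sigma_func ::
  "('o, 'a) cat \<Rightarrow> 'a \<Rightarrow> ('a, 'a \<times> 'a \<times> 'a, 'a, 'a \<times> 'a \<times> 'a) func" where
  "Sigma_func C u = \<lparr>
     fob = \<lambda>p. u \<cdot>\<^bsub>C\<^esub> p,
     far = \<lambda>(p, h, q). (u \<cdot>\<^bsub>C\<^esub> p, h, u \<cdot>\<^bsub>C\<^esub> q)\<rparr>"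

definition is_Pi_func ::
  "('o, 'a) cat \<Rightarrow> 'a \<Rightarrow> ('a, 'a \<times> 'a \<times> 'a, 'a, 'a \<times> 'a \<times> 'a) func \<Rightarrow> bool" where
  "is_Pi_func C P G \<longleftrightarrow> right_adjoint (slice C (Cod C P)) (slice C (Dom C P)) (pb_func C P) G"

text \<open>Local cartesian closure, in the form that all pullback functors have right adjoints.\<close>

definition locally_cartesian_closed :: "('o, 'a) cat \<Rightarrow> bool" where
  "locally_cartesian_closed C \<longleftrightarrow> has_finite_limits C \<and> (\<forall>P\<in>Arr C. \<exists>G. is_Pi_func C P G)"


section \<open>Polynomial functors, W-types and M-types\<close>

text \<open>
  A right adjoint is determined up to isomorphism, so it does not matter which
  \<open>\<Pi>\<^sub>P\<close> is taken below.
\<close>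

definition polynomial_func :: "('o, 'a) cat \<Rightarrow> 'o \<Rightarrow> 'o \<Rightarrow>
    ('a, 'a \<times> 'a \<times> 'a, 'a, 'a \<times> 'a \<times> 'a) func \<Rightarrow> bool" where
  "polynomial_func C T U G \<longleftrightarrow>
     is_functor (slice C T) (slice C U) G \<and>
     (\<exists>t P u \<Pi>. t \<in> Arr C \<and> P \<in> Arr C \<and> u \<in> Arr C \<and>
        Cod C t = T \<and> Dom C t = Dom C P \<and> Cod C P = Dom C u \<and> Cod C u = U \<and>
        is_Pi_func C P \<Pi> \<and>
        nat_isomorphic (slice C T) (slice C U) G (Sigma_func C u \<circ>\<^sub>F \<Pi> \<circ>\<^sub>F pb_func C t))"

text \<open>The two halves of the isomorphism \<open>C/1 \<cong> C\<close>, for a terminal object \<open>1\<close>.\<close>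

definition slice_dom :: "('o, 'a) cat \<Rightarrow> ('a, 'a \<times> 'a \<times> 'a, 'o, 'a) func" where
  "slice_dom C = \<lparr>fob = \<lambda>p. Dom C p, far = \<lambda>(p, h, q). h\<rparr>"

definition to_terminal :: "('o, 'a) cat \<Rightarrow> 'o \<Rightarrow> 'o \<Rightarrow> 'a" where
  "to_terminal C t x = (THE f. f \<in> hom C x t)"

definition slice_terminal :: "('o, 'a) cat \<Rightarrow> 'o \<Rightarrow> ('o, 'a, 'a, 'a \<times> 'a \<times> 'a) func" where
  "slice_terminal C t = \<lparr>
     fob = \<lambda>x. to_terminal C t x,
     far = \<lambda>h. (to_terminal C t (Dom C h), h, to_terminal C t (Cod C h))\<rparr>"

text \<open>An endofunctor of \<open>C\<close> is polynomial if it is so when regarded as an endofunctor of \<open>C/1\<close>.\<close>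

definition polynomial_endofunc :: "('o, 'a) cat \<Rightarrow> ('o, 'a, 'o, 'a) func \<Rightarrow> bool" where
  "polynomial_endofunc C G \<longleftrightarrow> is_functor C C G \<and>
     (\<exists>t. is_terminal C t \<and>
        polynomial_func C t t (slice_terminal C t \<circ>\<^sub>F G \<circ>\<^sub>F slice_dom C))"

definition has_dependent_W_types :: "('o, 'a) cat \<Rightarrow> bool" where
  "has_dependent_W_types C \<longleftrightarrow>
     (\<forall>I\<in>Obj C. \<forall>G. polynomial_func C I I G \<longrightarrow> (\<exists>x a. initial_algebra (slice C I) G x a))"

definition has_dependent_M_types :: "('o, 'a) cat \<Rightarrow> bool" where
  "has_dependent_M_types C \<longleftrightarrow>
     (\<forall>I\<in>Obj C. \<forall>G. polynomial_func C I I G \<longrightarrow> (\<exists>x c. terminal_coalgebra (slice C I) G x c))"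


section \<open>Containers\<close>

text \<open>
  A morphism \<open>(\<phi>, \<psi>)\<close> from \<open>P : A \<rightarrow> I\<close> to \<open>Q : B \<rightarrow> J\<close> is recorded as \<open>(P, \<phi>, \<psi>, Q)\<close>;
  \<open>P \<cdot> \<psi> = pb_fst C \<phi> Q\<close> says that \<open>\<psi> : \<phi>\<^sup>*(B) \<rightarrow> A\<close> is a map over \<open>I\<close>.

  The backward part of the composite of \<open>(\<phi>, \<psi>)\<close> with \<open>(\<phi>', \<psi>')\<close>, ending in \<open>R : D \<rightarrow> K\<close>, is
  \<open>(\<phi>'\<phi>)\<^sup>*(D) \<cong> \<phi>\<^sup>*(\<phi>'\<^sup>*(D)) \<rightarrow> \<phi>\<^sup>*(B) \<rightarrow> A\<close>, the middle map being \<open>\<phi>\<^sup>*(\<psi>')\<close>. The first two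
  maps together are written as a single map into the pullback \<open>\<phi>\<^sup>*(B)\<close>.
\<close>

type_synonym 'a cont_arr = "'a \<times> 'a \<times> 'a \<times> 'a"

fun forward :: "'a cont_arr \<Rightarrow> 'a" where
  "forward (P, \<phi>, \<psi>, Q) = \<phi>"

fun backward :: "'a cont_arr \<Rightarrow> 'a" where
  "backward (P, \<phi>, \<psi>, Q) = \<psi>"

fun cont_comp :: "('o, 'a) cat \<Rightarrow> 'a cont_arr \<Rightarrow> 'a cont_arr \<Rightarrow> 'a cont_arr" where
  "cont_comp C (Q', \<phi>', \<psi>', R) (P, \<phi>, \<psi>, Q) =
     (let \<chi> = \<phi>' \<cdot>\<^bsub>C\<^esub> \<phi>;
          w = pb_pair C \<phi>' R (\<phi> \<cdot>\<^bsub>C\<^esub> pb_fst C \<chi> R) (pb_snd C \<chi> R)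
      in (P, \<chi>, \<psi> \<cdot>\<^bsub>C\<^esub> pb_pair C \<phi> Q (pb_fst C \<chi> R) (\<psi>' \<cdot>\<^bsub>C\<^esub> w), R))"

definition Cont :: "('o, 'a) cat \<Rightarrow> ('a, 'a cont_arr) cat" where
  "Cont C = \<lparr>
     Obj = Arr C,
     Arr = {(P, \<phi>, \<psi>, Q). P \<in> Arr C \<and> Q \<in> Arr C \<and> \<phi> \<in> hom C (Cod C P) (Cod C Q) \<and>
              \<psi> \<in> hom C (pb_obj C \<phi> Q) (Dom C P) \<and> P \<cdot>\<^bsub>C\<^esub> \<psi> = pb_fst C \<phi> Q},
     Dom = \<lambda>(P, \<phi>, \<psi>, Q). P,
     Cod = \<lambda>(P, \<phi>, \<psi>, Q). Q,
     Ident = \<lambda>P. (P, Ident C (Cod C P), pb_snd C (Ident C (Cod C P)) P, P),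
     Comp = cont_comp C\<rparr>"

definition shape :: "('o, 'a) cat \<Rightarrow> ('a, 'a cont_arr, 'o, 'a) func" where
  "shape C = \<lparr>fob = \<lambda>P. Cod C P, far = forward\<rparr>"

definition cartesian :: "('o, 'a) cat \<Rightarrow> 'a cont_arr \<Rightarrow> bool" where
  "cartesian C m \<longleftrightarrow> m \<in> Arr (Cont C) \<and> iso_arr C (backward m)"

text \<open>
  The identification of \<open>(C/I)\<^sup>o\<^sup>p\<close> with the vertical morphisms over \<open>I\<close>. An arrow \<open>h : p \<rightarrow> q\<close> of
  \<open>C/I\<close> becomes the vertical container morphism \<open>q \<rightarrow> p\<close> with backward part
  \<open>id\<^sup>*(Dom p) \<cong> Dom p \<rightarrow> Dom q\<close>; since \<open>id\<^sup>*\<close> is only isomorphic to the identity functor, the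
  isomorphism \<open>pb_snd C (Ident C I) p\<close> has to be inserted, and removed in the other direction.
\<close>

fun to_vertical :: "('o, 'a) cat \<Rightarrow> 'o \<Rightarrow> 'a \<times> 'a \<times> 'a \<Rightarrow> 'a cont_arr" where
  "to_vertical C I (p, h, q) = (q, Ident C I, h \<cdot>\<^bsub>C\<^esub> pb_snd C (Ident C I) p, p)"

fun from_vertical :: "('o, 'a) cat \<Rightarrow> 'a cont_arr \<Rightarrow> 'a \<times> 'a \<times> 'a" where
  "from_vertical C (q, \<phi>, \<psi>, p) = (p, \<psi> \<cdot>\<^bsub>C\<^esub> inv_arr C (pb_snd C \<phi> p), q)"

text \<open>The functor \<open>F\<^sub>I : C/I \<rightarrow> C/F\<^sub>0(I)\<close> induced on fibres by an endofunctor \<open>F\<close> of \<open>Cont C\<close>.\<close>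

definition fibre_func :: "('o, 'a) cat \<Rightarrow> ('a, 'a cont_arr, 'a, 'a cont_arr) func \<Rightarrow> 'o \<Rightarrow>
    ('a, 'a \<times> 'a \<times> 'a, 'a, 'a \<times> 'a \<times> 'a) func" where
  "fibre_func C F I = \<lparr>
     fob = \<lambda>p. fob F p,
     far = \<lambda>m. from_vertical C (far F (to_vertical C I m))\<rparr>"

text \<open>Fibred polynomial endofunctors of \<open>Cont C\<close>, i.e. the unary case, with base functor \<open>F\<^sub>0\<close>.\<close>

definition fibred_polynomial_func :: "('o, 'a) cat \<Rightarrow>
    ('a, 'a cont_arr, 'a, 'a cont_arr) func \<Rightarrow> ('o, 'a, 'o, 'a) func \<Rightarrow> bool" where
  "fibred_polynomial_func C F F\<^sub>0 \<longleftrightarrow>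
     is_functor (Cont C) (Cont C) F \<and>
     is_functor C C F\<^sub>0 \<and>
     eq_func (Cont C) (shape C \<circ>\<^sub>F F) (F\<^sub>0 \<circ>\<^sub>F shape C) \<and>
     (\<forall>m. cartesian C m \<longrightarrow> cartesian C (far F m)) \<and>
     polynomial_endofunc C F\<^sub>0 \<and>
     (\<forall>I\<in>Obj C. polynomial_func C I (fob F\<^sub>0 I) (fibre_func C F I))"

text \<open>
  Let \<open>b = (\<beta>, \<beta>') : F(Z) \<rightarrow> Z\<close> be an algebra on \<open>Z : D \<rightarrow> N\<close> whose forward part \<open>\<beta>\<close> has inverse \<open>c\<close>,
  and write \<open>F(Z) : E \<rightarrow> F\<^sub>0(N)\<close>, so that \<open>\<beta>' : \<beta>\<^sup>*(D) \<rightarrow> E\<close>. As \<open>\<beta>\<close> is invertible, so is the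
  projection \<open>\<beta>\<^sup>*(D) \<rightarrow> D\<close>, and \<open>\<beta>'\<close> amounts to the map \<open>D \<rightarrow> c\<^sup>*(E)\<close> over \<open>N\<close> with components
  \<open>Z : D \<rightarrow> N\<close> and \<open>D \<cong> \<beta>\<^sup>*(D) \<rightarrow> E\<close>.
\<close>

definition induced_coalgebra_map :: "('o, 'a) cat \<Rightarrow> ('a, 'a cont_arr, 'a, 'a cont_arr) func \<Rightarrow>
    'a \<Rightarrow> 'a cont_arr \<Rightarrow> 'a \<Rightarrow> 'a \<times> 'a \<times> 'a" where
  "induced_coalgebra_map C F Z b c =
     (Z,
      pb_pair C c (fob F Z) Z (backward b \<cdot>\<^bsub>C\<^esub> inv_arr C (pb_snd C (forward b) Z)),
      pb_fst C c (fob F Z))"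

end

theory Submission
  imports Defs
begin

text \<open>
  The fibration \<open>shape\<close> is a bifibration: cartesian lifts are pullbacks and opcartesian lifts are
  given by \<open>\<Pi>\<close>. Reindexing along the unique map out of the initial \<open>F\<^sub>0\<close>-algebra \<open>(M, \<alpha>)\<close>
  shows that an \<open>F\<close>-algebra over \<open>\<alpha>\<close> is initial as soon as it is initial among the algebras over
  \<open>\<alpha>\<close> and vertical morphisms. As the fibres are opposites of slices, the latter are the coalgebras
  of the polynomial endofunctor \<open>(\<alpha>\<^sup>-\<^sup>1)\<^sup>* \<circ> F\<^sub>M\<close> of \<open>C/M\<close>, which has a terminal coalgebra. Dually,
  pushing forward along the unique map into the terminal \<open>F\<^sub>0\<close>-coalgebra \<open>(N, c)\<close> reduces the
  terminal \<open>F\<close>-coalgebra to the initial algebra of \<open>c\<^sup>* \<circ> F\<^sub>N\<close>; the terminal coalgebra of the same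
  functor gives the third statement.
\<close>

section \<open>Categories and duality\<close>

text \<open>The obstacle is that pullbacks are chosen by \<open>SOME\<close>, so reindexing is
  functorial only up to isomorphism, and associativity in \<open>Cont C\<close> or the universal
  property of a lift would call for a comparison of iterated chosen pullbacks. Two descriptions of
  container morphisms avoid this. In general a backward part is replaced by its operation
  \<open>act\<close> on generalized elements, for which composition is strict. Over an invertible
  forward part it is replaced by a single map between domains (\<open>lin\<close>). The second form
  suffices for comparing algebras with coalgebras in a fibre: by Lambek's lemma the structure maps
  \<alpha> and c in the base are invertible, and the morphisms still to be tested have identity
  forward part. Invertibility also explains why the functor on the fibre is polynomial: up to
  isomorphism, \<open>c\<^sup>*\<close> is postcomposition with the inverse of c, so it is absorbed
  into the last leg of the polynomial diagram.\<close>

lemma in_hom_iff: "f \<in> hom C x y \<longleftrightarrow> f \<in> Arr C \<and> Dom C f = x \<and> Cod C f = y"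
  by (simp add: hom_def)

context category
begin

lemma Comp_arr [simp]:
  assumes "f \<in> Arr C" "g \<in> Arr C" "Cod C f = Dom C g"
  shows "g \<cdot> f \<in> Arr C" "Dom C (g \<cdot> f) = Dom C f" "Cod C (g \<cdot> f) = Cod C g"
  using Comp_in[of f "Dom C f" "Dom C g" g "Cod C g"] assms by (auto simp: in_hom_iff)

lemma Ident_arr [simp]:
  assumes "x \<in> Obj C"
  shows "Ident C x \<in> Arr C" "Dom C (Ident C x) = x" "Cod C (Ident C x) = x"
  using Ident_in[OF assms] by (auto simp: in_hom_iff)

lemma Comp_Ident_left [simp]: "f \<in> Arr C \<Longrightarrow> Cod C f = y \<Longrightarrow> Ident C y \<cdot> f = f"
  by (rule Ident_left[of f "Dom C f"]) (simp add: in_hom_iff)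

lemma Comp_Ident_right [simp]: "f \<in> Arr C \<Longrightarrow> Dom C f = x \<Longrightarrow> f \<cdot> Ident C x = f"
  by (rule Ident_right[of f _ "Cod C f"]) (simp add: in_hom_iff)

lemma assoc [simp]:
  assumes "f \<in> Arr C" "g \<in> Arr C" "h \<in> Arr C" "Cod C f = Dom C g" "Cod C g = Dom C h"
  shows "(h \<cdot> g) \<cdot> f = h \<cdot> (g \<cdot> f)"
  by (rule Comp_assoc[of f "Dom C f" "Dom C g" g "Dom C h" h "Cod C h"])
    (use assms in \<open>auto simp: in_hom_iff\<close>)

lemma Dom_Obj [simp]: "f \<in> Arr C \<Longrightarrow> Dom C f \<in> Obj C"
  and Cod_Obj [simp]: "f \<in> Arr C \<Longrightarrow> Cod C f \<in> Obj C"
  by (simp_all add: Dom_in Cod_in)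

text \<open>As \<open>assoc\<close> normalises composites to the right, an equation
  \<open>g \<cdot> f = h\<close> no longer matches inside \<open>g \<cdot> (f \<cdot> k)\<close>.
  This is its form for rewriting there.\<close>

lemma Comp_eq_assoc:
  assumes "g \<cdot> f = h" "f \<in> Arr C" "g \<in> Arr C" "k \<in> Arr C" "Cod C k = Dom C f" "Cod C f = Dom C g"
  shows "g \<cdot> (f \<cdot> k) = h \<cdot> k"
  using assms by (metis assoc)

lemma inverse_arrD:
  assumes "inverse_arr C f g"
  shows "f \<in> Arr C" "g \<in> Arr C" "Dom C g = Cod C f" "Cod C g = Dom C f"
    "g \<cdot> f = Ident C (Dom C f)" "f \<cdot> g = Ident C (Cod C f)"
  using assms by (auto simp: inverse_arr_def in_hom_iff)

lemma inverse_arr_cancel: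
  assumes "inverse_arr C f g"
  shows "k \<in> Arr C \<Longrightarrow> Cod C k = Dom C f \<Longrightarrow> g \<cdot> (f \<cdot> k) = k"
    "k \<in> Arr C \<Longrightarrow> Cod C k = Cod C f \<Longrightarrow> f \<cdot> (g \<cdot> k) = k"
  by (simp_all add: Comp_eq_assoc[OF inverse_arrD(5)[OF assms]]
      Comp_eq_assoc[OF inverse_arrD(6)[OF assms]] inverse_arrD[OF assms])

lemma inverse_arr_sym: "inverse_arr C f g \<Longrightarrow> inverse_arr C g f"
  by (auto simp: inverse_arr_def in_hom_iff)

lemma inverse_arr_unique:
  assumes f: "inverse_arr C f g" and f': "inverse_arr C f g'"
  shows "g = g'"
  using inverse_arr_cancel(1)[OF f, of g'] inverse_arrD[OF f] inverse_arrD[OF f'] by simp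

lemma inv_arr_eq: "inverse_arr C f g \<Longrightarrow> inv_arr C f = g"
  unfolding inv_arr_def by (blast intro: inverse_arr_unique)

lemma inverse_arr_comp:
  assumes "inverse_arr C f f'" "inverse_arr C g g'" "Cod C f = Dom C g"
  shows "inverse_arr C (g \<cdot> f) (f' \<cdot> g')"
  using inverse_arrD[OF assms(1)] inverse_arrD[OF assms(2)] assms(3)
  by (simp add: inverse_arr_def in_hom_iff inverse_arr_cancel[OF assms(1)]
      inverse_arr_cancel[OF assms(2)])

end

lemma is_functorD:
  assumes "is_functor C D F"
  shows "x \<in> Obj C \<Longrightarrow> fob F x \<in> Obj D"
    "f \<in> Arr C \<Longrightarrow> far F f \<in> Arr D"
    "f \<in> Arr C \<Longrightarrow> Dom D (far F f) = fob F (Dom C f)"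
    "f \<in> Arr C \<Longrightarrow> Cod D (far F f) = fob F (Cod C f)"
    "x \<in> Obj C \<Longrightarrow> far F (Ident C x) = Ident D (fob F x)"
    "f \<in> Arr C \<Longrightarrow> g \<in> Arr C \<Longrightarrow> Cod C f = Dom C g \<Longrightarrow>
      far F (g \<cdot>\<^bsub>C\<^esub> f) = far F g \<cdot>\<^bsub>D\<^esub> far F f"
  using assms by (auto simp: is_functor_def in_hom_iff)

text \<open>Objects and arrows are shared with \<open>C\<close>, so the same functor record serves
  on a category and on its opposite.\<close>

definition dual :: "('o, 'a) cat \<Rightarrow> ('o, 'a) cat" where
  "dual C = \<lparr>Obj = Obj C, Arr = Arr C, Dom = Cod C, Cod = Dom C, Ident = Ident C,
     Comp = \<lambda>g f. f \<cdot>\<^bsub>C\<^esub> g\<rparr>"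

lemma dual_simps [simp]:
  "Obj (dual C) = Obj C" "Arr (dual C) = Arr C" "Dom (dual C) = Cod C" "Cod (dual C) = Dom C"
  "Ident (dual C) = Ident C" "g \<cdot>\<^bsub>dual C\<^esub> f = f \<cdot>\<^bsub>C\<^esub> g"
  by (simp_all add: dual_def)

lemma hom_dual [simp]: "hom (dual C) x y = hom C y x"
  by (auto simp: hom_def)

lemma category_dual:
  assumes "category C"
  shows "category (dual C)"
proof -
  interpret category C by (fact assms)
  show ?thesis by unfold_locales (auto simp: in_hom_iff)
qed

lemma is_functor_dual: "is_functor C D F \<Longrightarrow> is_functor (dual C) (dual D) F"
  by (auto simp: is_functor_def in_hom_iff)

lemma initial_algebra_dual: "initial_algebra (dual C) F x a \<longleftrightarrow> terminal_coalgebra C F x a"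
  unfolding initial_algebra_def terminal_coalgebra_def algebra_def coalgebra_def
  by (simp add: eq_commute)

lemma inverse_arr_dual: "inverse_arr (dual C) f g \<longleftrightarrow> inverse_arr C f g"
  by (auto simp: inverse_arr_def)

lemma initial_algebraD:
  assumes "initial_algebra C F x a"
  shows "algebra C F x a"
    "algebra C F y b \<Longrightarrow> \<exists>!h. h \<in> hom C x y \<and> h \<cdot>\<^bsub>C\<^esub> a = b \<cdot>\<^bsub>C\<^esub> far F h"
  using assms unfolding initial_algebra_def by blast+

lemma terminal_coalgebraD:
  assumes "terminal_coalgebra C F x c"
  shows "coalgebra C F x c"
    "coalgebra C F y d \<Longrightarrow> \<exists>!h. h \<in> hom C y x \<and> c \<cdot>\<^bsub>C\<^esub> h = far F h \<cdot>\<^bsub>C\<^esub> d"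
  using assms unfolding terminal_coalgebra_def by blast+

text \<open>Lambek's lemma. Applying F to a gives an algebra on F x; the induced map c from x to F x
  makes a c an algebra endomorphism of x, hence the identity, and then c a = F(a c) is an identity
  too.\<close>

lemma initial_algebra_inverse:
  assumes "category C" and F: "is_functor C C F" and init: "initial_algebra C F x a"
  shows "\<exists>c. inverse_arr C a c"
proof -
  interpret category C by (fact assms)
  note [simp] = is_functorD[OF F]
  have [simp]: "x \<in> Obj C" "a \<in> Arr C" "Dom C a = fob F x" "Cod C a = x"
    using init by (auto simp: initial_algebra_def algebra_def in_hom_iff)
  have ex: "\<exists>!h. h \<in> hom C x y \<and> h \<cdot>\<^bsub>C\<^esub> a = b \<cdot>\<^bsub>C\<^esub> far F h" if "algebra C F y b" for y b
    using init that by (simp add: initial_algebra_def)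
  have "algebra C F (fob F x) (far F a)"
    by (simp add: algebra_def in_hom_iff)
  from ex[OF this] obtain c where [simp]: "c \<in> Arr C" "Dom C c = x" "Cod C c = fob F x"
    and c: "c \<cdot>\<^bsub>C\<^esub> a = far F a \<cdot>\<^bsub>C\<^esub> far F c"
    by (auto simp: in_hom_iff)
  have "algebra C F x a"
    by (simp add: algebra_def in_hom_iff)
  moreover have "a \<cdot>\<^bsub>C\<^esub> c \<in> hom C x x \<and> (a \<cdot>\<^bsub>C\<^esub> c) \<cdot>\<^bsub>C\<^esub> a = a \<cdot>\<^bsub>C\<^esub> far F (a \<cdot>\<^bsub>C\<^esub> c)"
    by (simp add: in_hom_iff c)
  moreover have "Ident C x \<in> hom C x x \<and> Ident C x \<cdot>\<^bsub>C\<^esub> a = a \<cdot>\<^bsub>C\<^esub> far F (Ident C x)"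
    by (simp add: in_hom_iff)
  ultimately have ac: "a \<cdot>\<^bsub>C\<^esub> c = Ident C x"
    using ex by blast
  have "c \<cdot>\<^bsub>C\<^esub> a = far F (a \<cdot>\<^bsub>C\<^esub> c)"
    by (simp add: c)
  also have "\<dots> = Ident C (fob F x)"
    by (simp add: ac)
  finally show ?thesis
    using ac by (intro exI[of _ c]) (simp add: inverse_arr_def in_hom_iff)
qed

lemma terminal_coalgebra_inverse:
  assumes "category C" "is_functor C C F" "terminal_coalgebra C F x c"
  shows "\<exists>b. inverse_arr C c b"
  using initial_algebra_inverse[OF category_dual is_functor_dual, of C F x c] assms
  by (simp add: initial_algebra_dual inverse_arr_dual)


section \<open>Initial algebras in the total category of a fibration\<close>

text \<open>The strong form of cartesianness: test arrows may lie over any composite of \<phi> with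
  a base arrow \<sigma>. It is applied below with \<sigma> the structure map of an algebra, not only
  with identities.\<close>

definition cartesian_lift ::
  "('o, 'a) cat \<Rightarrow> ('p, 'b) cat \<Rightarrow> ('o, 'a, 'p, 'b) func \<Rightarrow> 'b \<Rightarrow> 'o \<Rightarrow> 'a \<Rightarrow> bool" where
  "cartesian_lift E B p \<phi> y k \<longleftrightarrow> k \<in> Arr E \<and> Cod E k = y \<and> far p k = \<phi> \<and>
     (\<forall>g \<sigma>. g \<in> Arr E \<and> Cod E g = y \<and> \<sigma> \<in> hom B (fob p (Dom E g)) (Dom B \<phi>) \<and>
        far p g = \<phi> \<cdot>\<^bsub>B\<^esub> \<sigma> \<longrightarrow>
        (\<exists>!h. h \<in> hom E (Dom E g) (Dom E k) \<and> far p h = \<sigma> \<and> k \<cdot>\<^bsub>E\<^esub> h = g))"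

text \<open>
  Initiality only has to be tested against algebras with the same image in the base: the
  cartesian lift along the unique algebra map in the base reduces the general case to this one.
\<close>

lemma initial_algebra_total:
  assumes "category E" "category B"
    and F: "is_functor E E F" and F\<^sub>0: "is_functor B B F\<^sub>0" and p: "is_functor E B p"
    and pF: "eq_func E (p \<circ>\<^sub>F F) (F\<^sub>0 \<circ>\<^sub>F p)"
    and lifts: "\<And>\<phi> y. \<phi> \<in> Arr B \<Longrightarrow> y \<in> Obj E \<Longrightarrow> Cod B \<phi> = fob p y \<Longrightarrow>
      \<exists>k. cartesian_lift E B p \<phi> y k"
    and base: "initial_algebra B F\<^sub>0 (fob p x) (far p a)"
    and a: "algebra E F x a"
    and fibre: "\<And>y b. algebra E F y b \<Longrightarrow> fob p y = fob p x \<Longrightarrow> far p b = far p a \<Longrightarrow>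
      \<exists>!h. h \<in> hom E x y \<and> far p h = Ident B (fob p x) \<and> h \<cdot>\<^bsub>E\<^esub> a = b \<cdot>\<^bsub>E\<^esub> far F h"
  shows "initial_algebra E F x a"
  unfolding initial_algebra_def
proof (intro conjI a allI impI)
  fix y b assume b: "algebra E F y b"
  interpret E: category E by fact
  interpret B: category B by fact
  note Fs [simp] = is_functorD[OF F] is_functorD[OF p] is_functorD[OF F\<^sub>0]
  have pF0 [simp]: "fob p (fob F z) = fob F\<^sub>0 (fob p z)" if "z \<in> Obj E" for z
    using pF that by (simp add: eq_func_def comp_func_def)
  have pF1 [simp]: "far p (far F f) = far F\<^sub>0 (far p f)" if "f \<in> Arr E" for f
    using pF that by (simp add: eq_func_def comp_func_def)
  have x [simp]: "x \<in> Obj E" "a \<in> Arr E" "Dom E a = fob F x" "Cod E a = x"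
    using a by (auto simp: algebra_def in_hom_iff)
  have y [simp]: "y \<in> Obj E" "b \<in> Arr E" "Dom E b = fob F y" "Cod E b = y"
    using b by (auto simp: algebra_def in_hom_iff)
  have "algebra B F\<^sub>0 (fob p y) (far p b)"
    by (simp add: algebra_def in_hom_iff)
  with base have ex1: "\<exists>!\<phi>. \<phi> \<in> hom B (fob p x) (fob p y) \<and>
      \<phi> \<cdot>\<^bsub>B\<^esub> far p a = far p b \<cdot>\<^bsub>B\<^esub> far F\<^sub>0 \<phi>"
    by (simp add: initial_algebra_def)
  then obtain \<phi> where \<phi> [simp]: "\<phi> \<in> Arr B" "Dom B \<phi> = fob p x" "Cod B \<phi> = fob p y"
    and \<phi>_alg: "\<phi> \<cdot>\<^bsub>B\<^esub> far p a = far p b \<cdot>\<^bsub>B\<^esub> far F\<^sub>0 \<phi>"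
    by (auto simp: in_hom_iff)
  obtain k where "cartesian_lift E B p \<phi> y k"
    using lifts[of \<phi> y] by auto
  then have k [simp]: "k \<in> Arr E" "Cod E k = y" "far p k = \<phi>"
    and fact: "\<And>g \<sigma>. g \<in> Arr E \<Longrightarrow> Cod E g = y \<Longrightarrow> \<sigma> \<in> hom B (fob p (Dom E g)) (Dom B \<phi>) \<Longrightarrow>
      far p g = \<phi> \<cdot>\<^bsub>B\<^esub> \<sigma> \<Longrightarrow>
      \<exists>!h. h \<in> hom E (Dom E g) (Dom E k) \<and> far p h = \<sigma> \<and> k \<cdot>\<^bsub>E\<^esub> h = g"
    by (auto simp: cartesian_lift_def)
  have pk [simp]: "fob p (Dom E k) = fob p x"
    using Fs(9)[of k] by simp
  \<comment> \<open>The structure of y is transported along k: factoring b after F k over the base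
    structure map gives an algebra b' on \<open>Dom E k\<close> for which k is an algebra
    morphism.\<close>
  have "\<exists>!b'. b' \<in> hom E (fob F (Dom E k)) (Dom E k) \<and> far p b' = far p a \<and>
      k \<cdot>\<^bsub>E\<^esub> b' = b \<cdot>\<^bsub>E\<^esub> far F k"
    using fact[of "b \<cdot>\<^bsub>E\<^esub> far F k" "far p a"] by (simp add: in_hom_iff \<phi>_alg)
  then obtain b' where b' [simp]: "b' \<in> Arr E" "Dom E b' = fob F (Dom E k)"
      "Cod E b' = Dom E k" "far p b' = far p a"
    and kb': "k \<cdot>\<^bsub>E\<^esub> b' = b \<cdot>\<^bsub>E\<^esub> far F k"
    by (auto simp: in_hom_iff)
  have ex1': "\<exists>!h. h \<in> hom E x (Dom E k) \<and> far p h = Ident B (fob p x) \<and>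
      h \<cdot>\<^bsub>E\<^esub> a = b' \<cdot>\<^bsub>E\<^esub> far F h"
    by (rule fibre) (simp_all add: algebra_def in_hom_iff)
  then obtain h where h [simp]: "h \<in> Arr E" "Dom E h = x" "Cod E h = Dom E k"
    and ph: "far p h = Ident B (fob p x)" and h_alg: "h \<cdot>\<^bsub>E\<^esub> a = b' \<cdot>\<^bsub>E\<^esub> far F h"
    by (auto simp: in_hom_iff)
  have lift_alg: "(k \<cdot>\<^bsub>E\<^esub> h') \<cdot>\<^bsub>E\<^esub> a = k \<cdot>\<^bsub>E\<^esub> (h' \<cdot>\<^bsub>E\<^esub> a)"
      "b \<cdot>\<^bsub>E\<^esub> far F (k \<cdot>\<^bsub>E\<^esub> h') = k \<cdot>\<^bsub>E\<^esub> (b' \<cdot>\<^bsub>E\<^esub> far F h')"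
    if "h' \<in> Arr E" "Dom E h' = x" "Cod E h' = Dom E k" for h'
    using that E.Comp_eq_assoc[OF kb', of "far F h'"] by simp_all
  show "\<exists>!h. h \<in> hom E x y \<and> h \<cdot>\<^bsub>E\<^esub> a = b \<cdot>\<^bsub>E\<^esub> far F h"
  proof (rule ex1I[of _ "k \<cdot>\<^bsub>E\<^esub> h"])
    show "k \<cdot>\<^bsub>E\<^esub> h \<in> hom E x y \<and> (k \<cdot>\<^bsub>E\<^esub> h) \<cdot>\<^bsub>E\<^esub> a = b \<cdot>\<^bsub>E\<^esub> far F (k \<cdot>\<^bsub>E\<^esub> h)"
      by (simp only: lift_alg h h_alg) (simp add: in_hom_iff)
  next
    fix g assume "g \<in> hom E x y \<and> g \<cdot>\<^bsub>E\<^esub> a = b \<cdot>\<^bsub>E\<^esub> far F g"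
    then have g [simp]: "g \<in> Arr E" "Dom E g = x" "Cod E g = y"
      and g_alg: "g \<cdot>\<^bsub>E\<^esub> a = b \<cdot>\<^bsub>E\<^esub> far F g"
      by (auto simp: in_hom_iff)
    \<comment> \<open>The image of g in the base is an algebra morphism out of the initial algebra,
      so it equals \<phi> and g factors through k.\<close>
    have "far p g \<in> hom B (fob p x) (fob p y) \<and>
        far p g \<cdot>\<^bsub>B\<^esub> far p a = far p b \<cdot>\<^bsub>B\<^esub> far F\<^sub>0 (far p g)"
      using arg_cong[OF g_alg, of "far p"] by (simp add: in_hom_iff)
    moreover have "\<phi> \<in> hom B (fob p x) (fob p y)"
      by (simp add: in_hom_iff)
    ultimately have pg: "far p g = \<phi>"
      using ex1 \<phi>_alg by blast
    then have "\<exists>!h. h \<in> hom E x (Dom E k) \<and> far p h = Ident B (fob p x) \<and> k \<cdot>\<^bsub>E\<^esub> h = g"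
      using fact[of g "Ident B (fob p x)"] by (simp add: in_hom_iff)
    then obtain h' where h' [simp]: "h' \<in> Arr E" "Dom E h' = x" "Cod E h' = Dom E k"
        "far p h' = Ident B (fob p x)" and kh': "k \<cdot>\<^bsub>E\<^esub> h' = g"
      by (auto simp: in_hom_iff)
    \<comment> \<open>So far h' satisfies the algebra equation only after composition with k. Both
      sides lie over \<open>far p a\<close>, so uniqueness of cartesian factorisations cancels
      k.\<close>
    have eq: "k \<cdot>\<^bsub>E\<^esub> (h' \<cdot>\<^bsub>E\<^esub> a) = k \<cdot>\<^bsub>E\<^esub> (b' \<cdot>\<^bsub>E\<^esub> far F h')"
      using g_alg lift_alg[of h'] by (simp add: kh')
    have "\<exists>!v. v \<in> hom E (fob F x) (Dom E k) \<and> far p v = far p a \<and>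
        k \<cdot>\<^bsub>E\<^esub> v = k \<cdot>\<^bsub>E\<^esub> (h' \<cdot>\<^bsub>E\<^esub> a)"
      using fact[of "k \<cdot>\<^bsub>E\<^esub> (h' \<cdot>\<^bsub>E\<^esub> a)" "far p a"] by (simp add: in_hom_iff)
    moreover have "h' \<cdot>\<^bsub>E\<^esub> a \<in> hom E (fob F x) (Dom E k)" "far p (h' \<cdot>\<^bsub>E\<^esub> a) = far p a"
      "b' \<cdot>\<^bsub>E\<^esub> far F h' \<in> hom E (fob F x) (Dom E k)" "far p (b' \<cdot>\<^bsub>E\<^esub> far F h') = far p a"
      by (simp_all add: in_hom_iff)
    ultimately have "h' \<cdot>\<^bsub>E\<^esub> a = b' \<cdot>\<^bsub>E\<^esub> far F h'"
      using eq by metis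
    moreover have "h' \<in> hom E x (Dom E k)" "h \<in> hom E x (Dom E k)"
      by (simp_all add: in_hom_iff)
    ultimately have "h' = h"
      using ex1' h_alg ph h'(4) by blast
    then show "g = k \<cdot>\<^bsub>E\<^esub> h"
      using kh' by simp
  qed
qed

text \<open>A cartesian lift in the opposite categories is an opcartesian lift, so the hypothesis
  \<open>lifts\<close> asks for direct images.\<close>

lemma terminal_coalgebra_total:
  assumes "category E" "category B"
    and "is_functor E E F" "is_functor B B F\<^sub>0" "is_functor E B p"
    and pF: "eq_func E (p \<circ>\<^sub>F F) (F\<^sub>0 \<circ>\<^sub>F p)"
    and lifts: "\<And>\<phi> y. \<phi> \<in> Arr B \<Longrightarrow> y \<in> Obj E \<Longrightarrow> Dom B \<phi> = fob p y \<Longrightarrow>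
      \<exists>k. cartesian_lift (dual E) (dual B) p \<phi> y k"
    and base: "terminal_coalgebra B F\<^sub>0 (fob p x) (far p c)"
    and c: "coalgebra E F x c"
    and fibre: "\<And>y d. coalgebra E F y d \<Longrightarrow> fob p y = fob p x \<Longrightarrow> far p d = far p c \<Longrightarrow>
      \<exists>!h. h \<in> hom E y x \<and> far p h = Ident B (fob p x) \<and> c \<cdot>\<^bsub>E\<^esub> h = far F h \<cdot>\<^bsub>E\<^esub> d"
  shows "terminal_coalgebra E F x c"
proof -
  have "initial_algebra (dual E) F x c"
  proof (rule initial_algebra_total[where p = p and F\<^sub>0 = F\<^sub>0 and B = "dual B"])
    show "eq_func (dual E) (p \<circ>\<^sub>F F) (F\<^sub>0 \<circ>\<^sub>F p)"
      using pF by (simp add: eq_func_def)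
    show "initial_algebra (dual B) F\<^sub>0 (fob p x) (far p c)"
      using base by (simp add: initial_algebra_dual)
    show "algebra (dual E) F x c"
      using c by (simp add: algebra_def coalgebra_def)
    show "\<exists>!h. h \<in> hom (dual E) x y \<and> far p h = Ident (dual B) (fob p x) \<and>
        h \<cdot>\<^bsub>dual E\<^esub> c = b \<cdot>\<^bsub>dual E\<^esub> far F h"
      if "algebra (dual E) F y b" "fob p y = fob p x" "far p b = far p c" for y b
      using fibre[of y b] that by (simp add: algebra_def coalgebra_def)
    show "\<exists>k. cartesian_lift (dual E) (dual B) p \<phi> y k"
      if "\<phi> \<in> Arr (dual B)" "y \<in> Obj (dual E)" "Cod (dual B) \<phi> = fob p y" for \<phi> y
      using lifts[of \<phi> y] that by simp
  qed (intro category_dual is_functor_dual assms)+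
  then show ?thesis
    by (simp add: initial_algebra_dual)
qed


section \<open>Adjunctions, slices and pullbacks\<close>

text \<open>The transpose of f is R f after the unit: naturality of the counit and one triangle
  identity give existence, naturality of the unit and the other give uniqueness. Direct images of
  containers are built from this pointwise form.\<close>

lemma right_adjoint_couniversal:
  assumes "category C" "category D" and adj: "right_adjoint C D L R" and y: "y \<in> Obj D"
  shows "\<exists>\<epsilon>. \<epsilon> \<in> hom D (fob L (fob R y)) y \<and>
    (\<forall>z\<in>Obj C. \<forall>f\<in>hom D (fob L z) y. \<exists>!h. h \<in> hom C z (fob R y) \<and> \<epsilon> \<cdot>\<^bsub>D\<^esub> far L h = f)"
proof -
  interpret C: category C by fact
  interpret D: category D by fact
  obtain \<eta> \<epsilon> where L: "is_functor C D L" and R: "is_functor D C R"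
    and \<eta>: "nat_trans C C id_func (R \<circ>\<^sub>F L) \<eta>" and \<epsilon>: "nat_trans D D (L \<circ>\<^sub>F R) id_func \<epsilon>"
    and L_triangle: "\<And>x. x \<in> Obj C \<Longrightarrow> \<epsilon> (fob L x) \<cdot>\<^bsub>D\<^esub> far L (\<eta> x) = Ident D (fob L x)"
    and R_triangle: "\<And>y. y \<in> Obj D \<Longrightarrow> far R (\<epsilon> y) \<cdot>\<^bsub>C\<^esub> \<eta> (fob R y) = Ident C (fob R y)"
    using adj unfolding right_adjoint_def by blast
  note [simp] = is_functorD[OF L] is_functorD[OF R]
  have \<eta>_arr [simp]: "\<eta> x \<in> Arr C" "Dom C (\<eta> x) = x" "Cod C (\<eta> x) = fob R (fob L x)"
    if "x \<in> Obj C" for x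
    using \<eta> that by (auto simp: nat_trans_def id_func_def comp_func_def in_hom_iff)
  have \<epsilon>_arr [simp]: "\<epsilon> y \<in> Arr D" "Dom D (\<epsilon> y) = fob L (fob R y)" "Cod D (\<epsilon> y) = y"
    if "y \<in> Obj D" for y
    using \<epsilon> that by (auto simp: nat_trans_def id_func_def comp_func_def in_hom_iff)
  have \<eta>_nat: "\<eta> (Cod C f) \<cdot>\<^bsub>C\<^esub> f = far R (far L f) \<cdot>\<^bsub>C\<^esub> \<eta> (Dom C f)" if "f \<in> Arr C" for f
    using \<eta> that by (simp add: nat_trans_def id_func_def comp_func_def)
  have \<epsilon>_nat: "\<epsilon> (Cod D f) \<cdot>\<^bsub>D\<^esub> far L (far R f) = f \<cdot>\<^bsub>D\<^esub> \<epsilon> (Dom D f)" if "f \<in> Arr D" for f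
    using \<epsilon> that by (simp add: nat_trans_def id_func_def comp_func_def)
  have "\<exists>!h. h \<in> hom C z (fob R y) \<and> \<epsilon> y \<cdot>\<^bsub>D\<^esub> far L h = f"
    if z [simp]: "z \<in> Obj C" and f: "f \<in> hom D (fob L z) y" for z f
  proof (rule ex1I[of _ "far R f \<cdot>\<^bsub>C\<^esub> \<eta> z"])
    have f' [simp]: "f \<in> Arr D" "Dom D f = fob L z" "Cod D f = y"
      using f by (auto simp: in_hom_iff)
    have "\<epsilon> y \<cdot>\<^bsub>D\<^esub> far L (far R f \<cdot>\<^bsub>C\<^esub> \<eta> z) = (\<epsilon> y \<cdot>\<^bsub>D\<^esub> far L (far R f)) \<cdot>\<^bsub>D\<^esub> far L (\<eta> z)"
      by (simp add: y)
    also have "\<dots> = f"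
      using \<epsilon>_nat[of f] by (simp add: L_triangle)
    finally show "far R f \<cdot>\<^bsub>C\<^esub> \<eta> z \<in> hom C z (fob R y) \<and>
        \<epsilon> y \<cdot>\<^bsub>D\<^esub> far L (far R f \<cdot>\<^bsub>C\<^esub> \<eta> z) = f"
      by (simp add: in_hom_iff)
    fix h assume h: "h \<in> hom C z (fob R y) \<and> \<epsilon> y \<cdot>\<^bsub>D\<^esub> far L h = f"
    then have h' [simp]: "h \<in> Arr C" "Dom C h = z" "Cod C h = fob R y"
      by (auto simp: in_hom_iff)
    have "far R f \<cdot>\<^bsub>C\<^esub> \<eta> z = far R (\<epsilon> y \<cdot>\<^bsub>D\<^esub> far L h) \<cdot>\<^bsub>C\<^esub> \<eta> z"
      using h by simp
    also have "\<dots> = far R (\<epsilon> y) \<cdot>\<^bsub>C\<^esub> (\<eta> (fob R y) \<cdot>\<^bsub>C\<^esub> h)"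
      using \<eta>_nat[of h] y by simp
    also have "\<dots> = h"
      using C.Comp_eq_assoc[OF R_triangle[OF y], of h] y by simp
    finally show "h = far R f \<cdot>\<^bsub>C\<^esub> \<eta> z" ..
  qed
  then show ?thesis
    using y by (intro exI[of _ "\<epsilon> y"]) (simp add: in_hom_iff)
qed

section \<open>Slice categories\<close>

lemma slice_simps [simp]:
  "p \<in> Obj (slice C I) \<longleftrightarrow> p \<in> Arr C \<and> Cod C p = I"
  "(p, h, q) \<in> Arr (slice C I) \<longleftrightarrow> p \<in> Arr C \<and> Cod C p = I \<and> q \<in> Arr C \<and> Cod C q = I \<and>
     h \<in> Arr C \<and> Dom C h = Dom C p \<and> Cod C h = Dom C q \<and> q \<cdot>\<^bsub>C\<^esub> h = p"
  "Dom (slice C I) (p, h, q) = p" "Cod (slice C I) (p, h, q) = q"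
  "Ident (slice C I) p = (p, Ident C (Dom C p), p)"
  "(q', k, r) \<cdot>\<^bsub>slice C I\<^esub> (p, h, q) = (p, k \<cdot>\<^bsub>C\<^esub> h, r)"
  by (auto simp: slice_def in_hom_iff)

lemma slice_hom_iff:
  "m \<in> hom (slice C I) p q \<longleftrightarrow> (\<exists>h. m = (p, h, q) \<and> p \<in> Arr C \<and> Cod C p = I \<and> q \<in> Arr C \<and>
     Cod C q = I \<and> h \<in> Arr C \<and> Dom C h = Dom C p \<and> Cod C h = Dom C q \<and> q \<cdot>\<^bsub>C\<^esub> h = p)"
  by (cases m) (auto simp: in_hom_iff)

lemma slice_homE:
  assumes "m \<in> hom (slice C I) p q"
  obtains h where "m = (p, h, q)" "h \<in> Arr C" "Dom C h = Dom C p" "Cod C h = Dom C q"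
    "q \<cdot>\<^bsub>C\<^esub> h = p"
  using assms by (auto simp: slice_hom_iff)

lemma (in category) category_slice: "category (slice C I)"
proof
  fix f g h w x y z
  assume "f \<in> hom (slice C I) w x" "g \<in> hom (slice C I) x y" "h \<in> hom (slice C I) y z"
  then have "\<exists>f' g' h'. f = (w, f', x) \<and> g = (x, g', y) \<and> h = (y, h', z) \<and> f' \<in> Arr C \<and>
      g' \<in> Arr C \<and> h' \<in> Arr C \<and> Cod C f' = Dom C x \<and> Dom C g' = Dom C x \<and>
      Cod C g' = Dom C y \<and> Dom C h' = Dom C y"
    unfolding slice_hom_iff by blast
  then show "(h \<cdot>\<^bsub>slice C I\<^esub> g) \<cdot>\<^bsub>slice C I\<^esub> f = h \<cdot>\<^bsub>slice C I\<^esub> (g \<cdot>\<^bsub>slice C I\<^esub> f)"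
    by (elim exE conjE) (simp only: slice_simps assoc)
next
  fix f g x y z
  assume "f \<in> hom (slice C I) x y" "g \<in> hom (slice C I) y z"
  then obtain f' g' where [simp]: "f = (x, f', y)" "g = (y, g', z)" "f' \<in> Arr C" "g' \<in> Arr C"
      "y \<in> Arr C" "z \<in> Arr C" "Dom C f' = Dom C x" "Cod C f' = Dom C y" "Dom C g' = Dom C y"
      "Cod C g' = Dom C z" "Cod C y = I" "Cod C z = I"
    and f': "y \<cdot> f' = x" and g': "z \<cdot> g' = y"
    unfolding slice_hom_iff by blast
  have "x \<in> Arr C" "Cod C x = I"
    using Comp_arr(1,3)[of f' y] by (simp_all add: f')
  then show "g \<cdot>\<^bsub>slice C I\<^esub> f \<in> hom (slice C I) x z"
    using f' Comp_eq_assoc[OF g', of f'] by (simp add: in_hom_iff)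
next
  fix f assume "f \<in> Arr (slice C I)"
  then show "Dom (slice C I) f \<in> Obj (slice C I)" "Cod (slice C I) f \<in> Obj (slice C I)"
    by (cases f; simp)+
next
  fix x assume "x \<in> Obj (slice C I)"
  then show "Ident (slice C I) x \<in> hom (slice C I) x x"
    by (simp add: in_hom_iff)
next
  fix f x y assume "f \<in> hom (slice C I) x y"
  then obtain h where "f = (x, h, y)" "h \<in> Arr C" "Dom C h = Dom C x" "Cod C h = Dom C y"
    by (rule slice_homE)
  then show "Ident (slice C I) y \<cdot>\<^bsub>slice C I\<^esub> f = f" "f \<cdot>\<^bsub>slice C I\<^esub> Ident (slice C I) x = f"
    by simp_all
qed

text \<open>The choice \<open>pb\<close> made by \<open>SOME\<close> meets its specification only
  where some pullback exists, which is what the locale assumes; finite limits supply it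
  later.\<close>

locale category_with_pullbacks = category +
  assumes pullback_exists:
    "f \<in> Arr C \<Longrightarrow> q \<in> Arr C \<Longrightarrow> Cod C f = Cod C q \<Longrightarrow> \<exists>p r. is_pullback C f q p r"
begin

lemma pb_is_pullback:
  assumes "f \<in> Arr C" "q \<in> Arr C" "Cod C f = Cod C q"
  shows "is_pullback C f q (pb_fst C f q) (pb_snd C f q)"
proof -
  have "\<exists>x. case x of (p, r) \<Rightarrow> is_pullback C f q p r"
    using pullback_exists[OF assms] by auto
  then have "case pb C f q of (p, r) \<Rightarrow> is_pullback C f q p r"
    unfolding pb_def by (rule someI_ex)
  then show ?thesis
    by (simp add: pb_fst_def pb_snd_def split: prod.splits)
qed

lemma pb_arr [simp]:
  assumes "f \<in> Arr C" "q \<in> Arr C" "Cod C f = Cod C q"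
  shows "pb_fst C f q \<in> Arr C" "Dom C (pb_fst C f q) = pb_obj C f q"
    "Cod C (pb_fst C f q) = Dom C f"
    "pb_snd C f q \<in> Arr C" "Dom C (pb_snd C f q) = pb_obj C f q"
    "Cod C (pb_snd C f q) = Dom C q"
  using pb_is_pullback[OF assms] by (simp_all add: is_pullback_def pb_obj_def)

lemma pb_obj_in [simp]:
  assumes "f \<in> Arr C" "q \<in> Arr C" "Cod C f = Cod C q"
  shows "pb_obj C f q \<in> Obj C"
  using Dom_Obj[OF pb_arr(1)[OF assms]] by (simp add: assms)

lemma pb_square:
  assumes "f \<in> Arr C" "q \<in> Arr C" "Cod C f = Cod C q"
  shows "f \<cdot> pb_fst C f q = q \<cdot> pb_snd C f q"
  using pb_is_pullback[OF assms] by (simp add: is_pullback_def)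

lemma pb_pair_ex1:
  assumes "f \<in> Arr C" "q \<in> Arr C" "Cod C f = Cod C q"
    and "u \<in> Arr C" "v \<in> Arr C" "Cod C u = Dom C f" "Cod C v = Dom C q" "Dom C v = Dom C u"
    and "f \<cdot> u = q \<cdot> v"
  shows "\<exists>!h. h \<in> hom C (Dom C u) (pb_obj C f q) \<and> pb_fst C f q \<cdot> h = u \<and> pb_snd C f q \<cdot> h = v"
proof -
  have "\<forall>x u v. u \<in> hom C x (Dom C f) \<and> v \<in> hom C x (Dom C q) \<and> f \<cdot> u = q \<cdot> v \<longrightarrow>
     (\<exists>!h. h \<in> hom C x (pb_obj C f q) \<and> pb_fst C f q \<cdot> h = u \<and> pb_snd C f q \<cdot> h = v)"
    using pb_is_pullback[OF assms(1-3)] unfolding is_pullback_def pb_obj_def by blast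
  then show ?thesis
    using assms(4-9) by (simp add: in_hom_iff)
qed

lemma pb_pair:
  assumes "f \<in> Arr C" "q \<in> Arr C" "Cod C f = Cod C q"
    and "u \<in> Arr C" "v \<in> Arr C" "Cod C u = Dom C f" "Cod C v = Dom C q" "Dom C v = Dom C u"
    and "f \<cdot> u = q \<cdot> v"
  shows "pb_pair C f q u v \<in> Arr C" "Dom C (pb_pair C f q u v) = Dom C u"
    "Cod C (pb_pair C f q u v) = pb_obj C f q"
    "pb_fst C f q \<cdot> pb_pair C f q u v = u" "pb_snd C f q \<cdot> pb_pair C f q u v = v"
  using theI'[OF pb_pair_ex1[OF assms], folded pb_pair_def] by (auto simp: in_hom_iff)

text \<open>Both maps solve the same universal problem, so the projections of a pullback are jointly
  monic.\<close>

lemma pb_ext: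
  assumes "f \<in> Arr C" "q \<in> Arr C" "Cod C f = Cod C q"
    and "h \<in> Arr C" "Cod C h = pb_obj C f q" "h' \<in> Arr C" "Cod C h' = pb_obj C f q"
    and "Dom C h = Dom C h'" "pb_fst C f q \<cdot> h = pb_fst C f q \<cdot> h'"
    "pb_snd C f q \<cdot> h = pb_snd C f q \<cdot> h'"
  shows "h = h'"
proof -
  have "f \<cdot> (pb_fst C f q \<cdot> h) = q \<cdot> (pb_snd C f q \<cdot> h)"
    using assms Comp_eq_assoc[OF pb_square[OF assms(1-3)], of h] by simp
  then have "\<exists>!k. k \<in> hom C (Dom C (pb_fst C f q \<cdot> h)) (pb_obj C f q) \<and>
      pb_fst C f q \<cdot> k = pb_fst C f q \<cdot> h \<and> pb_snd C f q \<cdot> k = pb_snd C f q \<cdot> h"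
    by (intro pb_pair_ex1) (use assms(1-8) in auto)
  moreover have "h \<in> hom C (Dom C (pb_fst C f q \<cdot> h)) (pb_obj C f q)"
    "h' \<in> hom C (Dom C (pb_fst C f q \<cdot> h)) (pb_obj C f q)"
    using assms(1-8) by (simp_all add: in_hom_iff)
  ultimately show ?thesis
    using assms(9,10) by metis
qed

lemma pb_pair_eq:
  assumes "f \<in> Arr C" "q \<in> Arr C" "Cod C f = Cod C q" "h \<in> Arr C" "Cod C h = pb_obj C f q"
    and "pb_fst C f q \<cdot> h = u" "pb_snd C f q \<cdot> h = v"
  shows "pb_pair C f q u v = h"
proof -
  have sq: "f \<cdot> u = q \<cdot> v"
    using assms(1-5) Comp_eq_assoc[OF pb_square[OF assms(1-3)], of h]
    by (simp flip: assms(6,7))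
  have uv: "u \<in> Arr C" "v \<in> Arr C" "Cod C u = Dom C f" "Cod C v = Dom C q"
    "Dom C u = Dom C h" "Dom C v = Dom C h"
    using assms(1-5) by (simp_all flip: assms(6,7))
  then have "Dom C v = Dom C u"
    by simp
  note pair = pb_pair[OF assms(1-3) uv(1-4) this sq]
  show ?thesis
    by (rule pb_ext[OF assms(1-3)]) (simp_all add: pair uv assms(4-7))
qed

lemma pb_pair_comp:
  assumes "f \<in> Arr C" "q \<in> Arr C" "Cod C f = Cod C q"
    and "u \<in> Arr C" "v \<in> Arr C" "Cod C u = Dom C f" "Cod C v = Dom C q" "Dom C v = Dom C u"
    and "f \<cdot> u = q \<cdot> v" and "s \<in> Arr C" "Cod C s = Dom C u"
  shows "pb_pair C f q u v \<cdot> s = pb_pair C f q (u \<cdot> s) (v \<cdot> s)"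
  using assms(1-8,10,11)
  by (intro pb_pair_eq[symmetric])
    (simp_all add: pb_pair[OF assms(1-9)] Comp_eq_assoc[OF pb_pair(4)[OF assms(1-9)]]
      Comp_eq_assoc[OF pb_pair(5)[OF assms(1-9)]])

text \<open>A pullback of an isomorphism is one; the inverse has components g q and the identity.
  The witness matters because \<open>from_vertical\<close> and \<open>induced_coalgebra_map\<close>
  apply the definite description \<open>inv_arr\<close> to this projection.\<close>

lemma pb_snd_inverse:
  assumes "inverse_arr C f g" "q \<in> Arr C" "Cod C q = Cod C f"
  shows "inverse_arr C (pb_snd C f q) (pb_pair C f q (g \<cdot> q) (Ident C (Dom C q)))"
proof -
  note [simp] = inverse_arrD[OF assms(1)] assms(2,3)
  have sq: "f \<cdot> (g \<cdot> q) = q \<cdot> Ident C (Dom C q)"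
    by (simp add: inverse_arr_cancel[OF assms(1)])
  note pair [simp] = pb_pair[of f q "g \<cdot> q" "Ident C (Dom C q)", OF _ _ _ _ _ _ _ _ sq, simplified]
  have "pb_fst C f q = g \<cdot> (f \<cdot> pb_fst C f q)"
    by (simp add: inverse_arr_cancel[OF assms(1)])
  also have "\<dots> = g \<cdot> (q \<cdot> pb_snd C f q)"
    by (simp add: pb_square)
  finally have fst: "g \<cdot> (q \<cdot> pb_snd C f q) = pb_fst C f q" ..
  have "pb_pair C f q (g \<cdot> q) (Ident C (Dom C q)) \<cdot> pb_snd C f q = Ident C (pb_obj C f q)"
    by (rule pb_ext[of f q])
      (simp_all add: fst Comp_eq_assoc[OF pair(4)] Comp_eq_assoc[OF pair(5)])
  then show ?thesis
    by (simp add: inverse_arr_def in_hom_iff)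
qed

text \<open>Here r is \<open>\<Pi>\<^sub>P y\<close> and \<epsilon> the counit, with the triples of
  the slices unpacked: maps from z to r over the codomain of P correspond to maps from
  \<open>P\<^sup>* z\<close> to y over its domain.\<close>

lemma Pi_couniversal:
  assumes G: "is_Pi_func C P G" and P: "P \<in> Arr C" and y: "y \<in> Arr C" "Cod C y = Dom C P"
  obtains r \<epsilon> where "r \<in> Arr C" "Cod C r = Cod C P"
    and "\<epsilon> \<in> Arr C" "Dom C \<epsilon> = pb_obj C P r" "Cod C \<epsilon> = Dom C y" "y \<cdot> \<epsilon> = pb_fst C P r"
    and "\<And>z f. z \<in> Arr C \<Longrightarrow> Cod C z = Cod C P \<Longrightarrow> f \<in> hom C (pb_obj C P z) (Dom C y) \<Longrightarrow>
       y \<cdot> f = pb_fst C P z \<Longrightarrow>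
       \<exists>!h. h \<in> hom C (Dom C z) (Dom C r) \<and> r \<cdot> h = z \<and>
          \<epsilon> \<cdot> pb_pair C P r (pb_fst C P z) (h \<cdot> pb_snd C P z) = f"
proof -
  let ?S = "slice C (Cod C P)" and ?T = "slice C (Dom C P)"
  have adj: "right_adjoint ?S ?T (pb_func C P) G"
    using G by (simp add: is_Pi_func_def)
  obtain r where r_def: "r = fob G y" by simp
  have "is_functor ?T ?S G"
    using adj by (simp add: right_adjoint_def)
  from is_functorD(1)[OF this, of y] have r: "r \<in> Arr C" "Cod C r = Cod C P"
    using y by (simp_all add: r_def)
  from right_adjoint_couniversal[OF category_slice category_slice adj, of y] y
  obtain \<epsilon>' where \<epsilon>': "\<epsilon>' \<in> hom ?T (pb_fst C P r) y"
    and univ: "\<And>z f. z \<in> Obj ?S \<Longrightarrow> f \<in> hom ?T (pb_fst C P z) y \<Longrightarrow>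
      \<exists>!h. h \<in> hom ?S z r \<and> \<epsilon>' \<cdot>\<^bsub>?T\<^esub> far (pb_func C P) h = f"
    by (auto simp: pb_func_def r_def)
  obtain \<epsilon> where \<epsilon>'_eq: "\<epsilon>' = (pb_fst C P r, \<epsilon>, y)" and \<epsilon>: "\<epsilon> \<in> Arr C"
    "Dom C \<epsilon> = Dom C (pb_fst C P r)" "Cod C \<epsilon> = Dom C y" "y \<cdot> \<epsilon> = pb_fst C P r"
    using \<epsilon>' by (elim slice_homE)
  have "\<exists>!h. h \<in> hom C (Dom C z) (Dom C r) \<and> r \<cdot> h = z \<and>
          \<epsilon> \<cdot> pb_pair C P r (pb_fst C P z) (h \<cdot> pb_snd C P z) = f" (is "\<exists>!h. ?Q h")
    if z: "z \<in> Arr C" "Cod C z = Cod C P" and f: "f \<in> hom C (pb_obj C P z) (Dom C y)"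
      "y \<cdot> f = pb_fst C P z" for z f
  proof -
    have "(pb_fst C P z, f, y) \<in> hom ?T (pb_fst C P z) y"
      using f z y P by (simp add: in_hom_iff)
    \<comment> \<open>A slice arrow with given ends is determined by its middle component, so unique
      existence passes between triples and plain maps.\<close>
    moreover have "m \<in> hom ?S z r \<and> \<epsilon>' \<cdot>\<^bsub>?T\<^esub> far (pb_func C P) m = (pb_fst C P z, f, y)
        \<longleftrightarrow> (\<exists>h. m = (z, h, r) \<and> ?Q h)" for m
      unfolding slice_hom_iff using r z by (auto simp: pb_func_def \<epsilon>'_eq in_hom_iff)
    ultimately have "\<exists>!m. \<exists>h. m = (z, h, r) \<and> ?Q h"
      using univ[of z "(pb_fst C P z, f, y)"] z by simp
    then show "\<exists>!h. ?Q h"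
      by blast
  qed
  then show ?thesis
    using that[of r \<epsilon>] r \<epsilon> P by simp
qed


end

section \<open>Containers as a bifibration\<close>

lemma Cont_simps [simp]:
  "P \<in> Obj (Cont C) \<longleftrightarrow> P \<in> Arr C"
  "Dom (Cont C) (P, \<phi>, \<psi>, Q) = P" "Cod (Cont C) (P, \<phi>, \<psi>, Q) = Q"
  "Ident (Cont C) P = (P, Ident C (Cod C P), pb_snd C (Ident C (Cod C P)) P, P)"
  "n \<cdot>\<^bsub>Cont C\<^esub> m = cont_comp C n m"
  by (simp_all add: Cont_def)

lemma shape_simps [simp]: "fob (shape C) P = Cod C P" "far (shape C) m = forward m"
  by (simp_all add: shape_def)

context category_with_pullbacks
begin

lemma Cont_arr_iff:
  "(P, \<phi>, \<psi>, Q) \<in> Arr (Cont C) \<longleftrightarrow> P \<in> Arr C \<and> Q \<in> Arr C \<and>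
     \<phi> \<in> Arr C \<and> Dom C \<phi> = Cod C P \<and> Cod C \<phi> = Cod C Q \<and>
     \<psi> \<in> Arr C \<and> Dom C \<psi> = pb_obj C \<phi> Q \<and> Cod C \<psi> = Dom C P \<and> P \<cdot> \<psi> = pb_fst C \<phi> Q"
  by (auto simp: Cont_def in_hom_iff)

text \<open>Collects the side conditions of \<open>pb_pair\<close>. The pair (u, v) is a generalized
  element, at stage \<open>Dom C u\<close>, of the pullback of f and q.\<close>

definition cone_over :: "'b \<Rightarrow> 'b \<Rightarrow> 'b \<Rightarrow> 'b \<Rightarrow> bool" where
  "cone_over f q u v \<longleftrightarrow> f \<in> Arr C \<and> q \<in> Arr C \<and> Cod C f = Cod C q \<and>
     u \<in> Arr C \<and> v \<in> Arr C \<and> Cod C u = Dom C f \<and> Cod C v = Dom C q \<and> Dom C v = Dom C u \<and>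
     f \<cdot> u = q \<cdot> v"

lemma cone_overD:
  assumes "cone_over f q u v"
  shows "f \<in> Arr C" "q \<in> Arr C" "Cod C f = Cod C q"
    "u \<in> Arr C" "v \<in> Arr C" "Cod C u = Dom C f" "Cod C v = Dom C q" "Dom C v = Dom C u"
    "f \<cdot> u = q \<cdot> v"
  using assms by (auto simp: cone_over_def)

lemma cone_pair:
  assumes "cone_over f q u v"
  shows "pb_pair C f q u v \<in> Arr C" "Dom C (pb_pair C f q u v) = Dom C u"
    "Cod C (pb_pair C f q u v) = pb_obj C f q"
    "pb_fst C f q \<cdot> pb_pair C f q u v = u" "pb_snd C f q \<cdot> pb_pair C f q u v = v"
  using pb_pair cone_overD[OF assms] by metis+

lemma cone_comp:
  assumes "cone_over f q u v" "s \<in> Arr C" "Cod C s = Dom C u"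
  shows "cone_over f q (u \<cdot> s) (v \<cdot> s)"
    "pb_pair C f q u v \<cdot> s = pb_pair C f q (u \<cdot> s) (v \<cdot> s)"
proof -
  note D = cone_overD[OF assms(1)]
  show "cone_over f q (u \<cdot> s) (v \<cdot> s)"
    unfolding cone_over_def by (simp add: D assms(2,3) Comp_eq_assoc[OF D(9)])
  show "pb_pair C f q u v \<cdot> s = pb_pair C f q (u \<cdot> s) (v \<cdot> s)"
    by (rule pb_pair_comp[OF D assms(2,3)])
qed

lemma cone_pb:
  assumes "f \<in> Arr C" "q \<in> Arr C" "Cod C f = Cod C q"
  shows "cone_over f q (pb_fst C f q) (pb_snd C f q)"
    "pb_pair C f q (pb_fst C f q) (pb_snd C f q) = Ident C (pb_obj C f q)"
  using assms by (auto simp: cone_over_def pb_square intro!: pb_pair_eq)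

lemma cone_into_pb:
  assumes "f \<in> Arr C" "q \<in> Arr C" "Cod C f = Cod C q" "h \<in> Arr C" "Cod C h = pb_obj C f q"
  shows "cone_over f q (pb_fst C f q \<cdot> h) (pb_snd C f q \<cdot> h)"
    "pb_pair C f q (pb_fst C f q \<cdot> h) (pb_snd C f q \<cdot> h) = h"
  using assms cone_comp(1)[OF cone_pb(1)] by (auto intro: pb_pair_eq)

text \<open>
  The backward part of a container morphism is treated as an operation on generalized elements:
  it sends \<open>i : X \<rightarrow> I\<close> and \<open>r : X \<rightarrow> B\<close> with \<open>\<phi> i = Q r\<close> to an element of \<open>A\<close> over \<open>i\<close>. By the
  Yoneda lemma every such natural operation is a backward part, and composition of container
  morphisms becomes composition of operations.
\<close>

fun act :: "'b cont_arr \<Rightarrow> 'b \<Rightarrow> 'b \<Rightarrow> 'b" where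
  "act (P, \<phi>, \<psi>, Q) i r = \<psi> \<cdot> pb_pair C \<phi> Q i r"

lemma act_arr:
  assumes m: "(P, \<phi>, \<psi>, Q) \<in> Arr (Cont C)" and ir: "cone_over \<phi> Q i r"
  shows "act (P, \<phi>, \<psi>, Q) i r \<in> Arr C" "Dom C (act (P, \<phi>, \<psi>, Q) i r) = Dom C i"
    "Cod C (act (P, \<phi>, \<psi>, Q) i r) = Dom C P" "P \<cdot> act (P, \<phi>, \<psi>, Q) i r = i"
proof -
  have m': "P \<in> Arr C" "\<psi> \<in> Arr C" "Dom C \<psi> = pb_obj C \<phi> Q" "Cod C \<psi> = Dom C P"
    "P \<cdot> \<psi> = pb_fst C \<phi> Q"
    using m by (auto simp: Cont_arr_iff)
  show "act (P, \<phi>, \<psi>, Q) i r \<in> Arr C" "Dom C (act (P, \<phi>, \<psi>, Q) i r) = Dom C i"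
    "Cod C (act (P, \<phi>, \<psi>, Q) i r) = Dom C P" "P \<cdot> act (P, \<phi>, \<psi>, Q) i r = i"
    by (simp_all add: m'(1-4) cone_pair[OF ir] Comp_eq_assoc[OF m'(5)])
qed

lemma act_comp:
  assumes m: "(P, \<phi>, \<psi>, Q) \<in> Arr (Cont C)" and ir: "cone_over \<phi> Q i r"
    and "s \<in> Arr C" "Cod C s = Dom C i"
  shows "act (P, \<phi>, \<psi>, Q) i r \<cdot> s = act (P, \<phi>, \<psi>, Q) (i \<cdot> s) (r \<cdot> s)"
proof -
  have "\<psi> \<in> Arr C" "Dom C \<psi> = pb_obj C \<phi> Q"
    using m by (auto simp: Cont_arr_iff)
  then show ?thesis
    by (simp add: assms(3,4) cone_pair[OF ir] cone_comp[OF ir])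
qed

lemma act_generic:
  assumes "(P, \<phi>, \<psi>, Q) \<in> Arr (Cont C)"
  shows "act (P, \<phi>, \<psi>, Q) (pb_fst C \<phi> Q) (pb_snd C \<phi> Q) = \<psi>"
  using assms by (simp add: Cont_arr_iff cone_pb)

text \<open>The injective half of the Yoneda correspondence: a backward part is the value of its
  operation on the pair of projections, the generic element.\<close>

lemma cont_ext:
  assumes "(P, \<phi>, \<psi>, Q) \<in> Arr (Cont C)" "(P, \<phi>, \<psi>', Q) \<in> Arr (Cont C)"
    and "\<And>i r. cone_over \<phi> Q i r \<Longrightarrow> act (P, \<phi>, \<psi>, Q) i r = act (P, \<phi>, \<psi>', Q) i r"
  shows "(P, \<phi>, \<psi>, Q) = (P, \<phi>, \<psi>', Q)"
proof -
  have "cone_over \<phi> Q (pb_fst C \<phi> Q) (pb_snd C \<phi> Q)"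
    using assms(1) by (intro cone_pb) (auto simp: Cont_arr_iff)
  then show ?thesis
    using assms(3) act_generic[OF assms(1)] act_generic[OF assms(2)] by metis
qed

text \<open>The surjective half: the operation is evaluated at the generic element, and every cone
  is the restriction of that element along its own pairing, so naturality recovers T.\<close>

lemma cont_arr_of_operation:
  assumes "P \<in> Arr C" "\<phi> \<in> Arr C" "Q \<in> Arr C" "Dom C \<phi> = Cod C P" "Cod C \<phi> = Cod C Q"
    and T: "\<And>i r. cone_over \<phi> Q i r \<Longrightarrow>
      T i r \<in> Arr C \<and> Dom C (T i r) = Dom C i \<and> Cod C (T i r) = Dom C P \<and> P \<cdot> T i r = i"
    and nat: "\<And>i r s. cone_over \<phi> Q i r \<Longrightarrow> s \<in> Arr C \<Longrightarrow> Cod C s = Dom C i \<Longrightarrow>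
      T i r \<cdot> s = T (i \<cdot> s) (r \<cdot> s)"
  shows "(P, \<phi>, T (pb_fst C \<phi> Q) (pb_snd C \<phi> Q), Q) \<in> Arr (Cont C)"
    "cone_over \<phi> Q i r \<Longrightarrow> act (P, \<phi>, T (pb_fst C \<phi> Q) (pb_snd C \<phi> Q), Q) i r = T i r"
proof -
  have g: "cone_over \<phi> Q (pb_fst C \<phi> Q) (pb_snd C \<phi> Q)"
    using assms(1-5) by (intro cone_pb)
  show "(P, \<phi>, T (pb_fst C \<phi> Q) (pb_snd C \<phi> Q), Q) \<in> Arr (Cont C)"
    using T[OF g] assms(1-5) by (simp add: Cont_arr_iff)
  show "act (P, \<phi>, T (pb_fst C \<phi> Q) (pb_snd C \<phi> Q), Q) i r = T i r" if ir: "cone_over \<phi> Q i r"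
    using nat[OF g cone_pair(1)[OF ir]] assms(1-5) by (simp add: cone_pair[OF ir])
qed

text \<open>The backward part in the definition of composition is, after unfolding, the composite
  operation evaluated at the generic element. Its action is therefore the composite of the two
  actions, that of the second morphism being applied first.\<close>

lemma cont_comp:
  assumes m: "(P, \<phi>, \<psi>, Q) \<in> Arr (Cont C)" and n: "(Q, \<phi>', \<psi>', R) \<in> Arr (Cont C)"
  shows "\<exists>\<theta>. cont_comp C (Q, \<phi>', \<psi>', R) (P, \<phi>, \<psi>, Q) = (P, \<phi>' \<cdot> \<phi>, \<theta>, R) \<and>
    (P, \<phi>' \<cdot> \<phi>, \<theta>, R) \<in> Arr (Cont C) \<and>
    (\<forall>i r. cone_over (\<phi>' \<cdot> \<phi>) R i r \<longrightarrow>
      act (P, \<phi>' \<cdot> \<phi>, \<theta>, R) i r = act (P, \<phi>, \<psi>, Q) i (act (Q, \<phi>', \<psi>', R) (\<phi> \<cdot> i) r))"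
proof -
  let ?m = "(P, \<phi>, \<psi>, Q)" and ?n = "(Q, \<phi>', \<psi>', R)"
  let ?T = "\<lambda>i r. act ?m i (act ?n (\<phi> \<cdot> i) r)"
  have ty: "P \<in> Arr C" "Q \<in> Arr C" "R \<in> Arr C" "\<phi> \<in> Arr C" "\<phi>' \<in> Arr C" "Dom C \<phi> = Cod C P"
    "Cod C \<phi> = Cod C Q" "Dom C \<phi>' = Cod C Q" "Cod C \<phi>' = Cod C R"
    using m n by (auto simp: Cont_arr_iff)
  have cones: "cone_over \<phi>' R (\<phi> \<cdot> i) r" "cone_over \<phi> Q i (act ?n (\<phi> \<cdot> i) r)"
    if ir: "cone_over (\<phi>' \<cdot> \<phi>) R i r" for i r
  proof -
    have i: "i \<in> Arr C" "r \<in> Arr C" "Cod C i = Cod C P" "Cod C r = Dom C R" "Dom C r = Dom C i"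
      "\<phi>' \<cdot> (\<phi> \<cdot> i) = R \<cdot> r"
      using ir ty by (auto simp: cone_over_def)
    show c: "cone_over \<phi>' R (\<phi> \<cdot> i) r"
      unfolding cone_over_def by (simp add: ty i)
    show "cone_over \<phi> Q i (act ?n (\<phi> \<cdot> i) r)"
      unfolding cone_over_def by (simp add: ty i act_arr[OF n c] del: act.simps)
  qed
  have T: "?T i r \<in> Arr C \<and> Dom C (?T i r) = Dom C i \<and> Cod C (?T i r) = Dom C P \<and> P \<cdot> ?T i r = i"
    if "cone_over (\<phi>' \<cdot> \<phi>) R i r" for i r
    using act_arr[OF m cones(2)[OF that]] by blast
  have nat: "?T i r \<cdot> s = ?T (i \<cdot> s) (r \<cdot> s)"
    if ir: "cone_over (\<phi>' \<cdot> \<phi>) R i r" and s: "s \<in> Arr C" "Cod C s = Dom C i" for i r s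
  proof -
    have "i \<in> Arr C" "Cod C i = Cod C P"
      using cone_overD[OF cones(2)[OF ir]] ty by auto
    then show ?thesis
      by (simp add: s ty act_comp[OF m cones(2)[OF ir]] act_comp[OF n cones(1)[OF ir]]
          del: act.simps)
  qed
  let ?\<theta> = "?T (pb_fst C (\<phi>' \<cdot> \<phi>) R) (pb_snd C (\<phi>' \<cdot> \<phi>) R)"
  have "cont_comp C ?n ?m = (P, \<phi>' \<cdot> \<phi>, ?\<theta>, R)"
    by (simp add: Let_def)
  moreover have "(P, \<phi>' \<cdot> \<phi>, ?\<theta>, R) \<in> Arr (Cont C)"
    by (rule cont_arr_of_operation(1)[where T = ?T, OF _ _ _ _ _ T nat]) (simp_all add: ty)
  moreover have "act (P, \<phi>' \<cdot> \<phi>, ?\<theta>, R) i r = ?T i r" if "cone_over (\<phi>' \<cdot> \<phi>) R i r" for i r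
    by (rule cont_arr_of_operation(2)[where T = ?T, OF _ _ _ _ _ T nat that]) (simp_all add: ty)
  ultimately show ?thesis
    by blast
qed

lemma cone_over_Comp:
  assumes "cone_over (\<phi>' \<cdot> \<phi>) R i r" "\<phi> \<in> Arr C" "\<phi>' \<in> Arr C" "Cod C \<phi> = Dom C \<phi>'"
  shows "cone_over \<phi>' R (\<phi> \<cdot> i) r"
  using assms by (auto simp: cone_over_def)

text \<open>By \<open>cont_ext\<close> the unit and associativity laws may be checked on operations,
  where they are the laws for composing functions.\<close>

lemma category_Cont: "category (Cont C)"
proof
  fix f assume "f \<in> Arr (Cont C)"
  then show "Dom (Cont C) f \<in> Obj (Cont C)" "Cod (Cont C) f \<in> Obj (Cont C)"
    by (cases f; simp add: Cont_arr_iff)+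
next
  fix P assume "P \<in> Obj (Cont C)"
  then show "Ident (Cont C) P \<in> hom (Cont C) P P"
    by (simp add: in_hom_iff Cont_arr_iff flip: pb_square)
next
  fix f g x y z assume "f \<in> hom (Cont C) x y" "g \<in> hom (Cont C) y z"
  then show "g \<cdot>\<^bsub>Cont C\<^esub> f \<in> hom (Cont C) x z"
    using cont_comp by (cases f; cases g) (fastforce simp: in_hom_iff simp del: cont_comp.simps)
next
  fix f x y assume "f \<in> hom (Cont C) x y"
  then obtain \<phi> \<psi> where f: "f = (x, \<phi>, \<psi>, y)" and f_arr: "(x, \<phi>, \<psi>, y) \<in> Arr (Cont C)"
    by (cases f) (auto simp: in_hom_iff)
  then have ty: "x \<in> Arr C" "y \<in> Arr C" "\<phi> \<in> Arr C" "Dom C \<phi> = Cod C x" "Cod C \<phi> = Cod C y"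
    by (auto simp: Cont_arr_iff)
  have Ident_Cont: "(P, Ident C (Cod C P), pb_snd C (Ident C (Cod C P)) P, P) \<in> Arr (Cont C)"
    if "P \<in> Arr C" for P
    using that by (simp add: Cont_arr_iff flip: pb_square)
  have Ident_act: "act (P, Ident C (Cod C P), pb_snd C (Ident C (Cod C P)) P, P) i r = r"
    if "cone_over (Ident C (Cod C P)) P i r" for P i r
    using cone_pair(5)[OF that] by simp
  from cont_comp[OF f_arr Ident_Cont[OF ty(2)]] obtain \<theta> where
    \<theta>: "cont_comp C (y, Ident C (Cod C y), pb_snd C (Ident C (Cod C y)) y, y) (x, \<phi>, \<psi>, y) =
        (x, \<phi>, \<theta>, y)" "(x, \<phi>, \<theta>, y) \<in> Arr (Cont C)"
      "\<And>i r. cone_over \<phi> y i r \<Longrightarrow> act (x, \<phi>, \<theta>, y) i r = act (x, \<phi>, \<psi>, y) i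
        (act (y, Ident C (Cod C y), pb_snd C (Ident C (Cod C y)) y, y) (\<phi> \<cdot> i) r)"
    using ty by (auto simp del: cont_comp.simps act.simps)
  have "(x, \<phi>, \<theta>, y) = (x, \<phi>, \<psi>, y)"
  proof (rule cont_ext[OF \<theta>(2) f_arr])
    fix i r assume "cone_over \<phi> y i r"
    moreover from this have "cone_over (Ident C (Cod C y)) y (\<phi> \<cdot> i) r"
      using ty by (intro cone_over_Comp) simp_all
    ultimately show "act (x, \<phi>, \<theta>, y) i r = act (x, \<phi>, \<psi>, y) i r"
      by (simp only: \<theta>(3) Ident_act)
  qed
  then show "Ident (Cont C) y \<cdot>\<^bsub>Cont C\<^esub> f = f"
    using \<theta>(1) by (simp add: f del: cont_comp.simps)
  from cont_comp[OF Ident_Cont[OF ty(1)] f_arr] obtain \<theta> where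
    \<theta>: "cont_comp C (x, \<phi>, \<psi>, y) (x, Ident C (Cod C x), pb_snd C (Ident C (Cod C x)) x, x) =
        (x, \<phi>, \<theta>, y)" "(x, \<phi>, \<theta>, y) \<in> Arr (Cont C)"
      "\<And>i r. cone_over \<phi> y i r \<Longrightarrow> act (x, \<phi>, \<theta>, y) i r =
        act (x, Ident C (Cod C x), pb_snd C (Ident C (Cod C x)) x, x) i
          (act (x, \<phi>, \<psi>, y) (Ident C (Cod C x) \<cdot> i) r)"
    using ty by (auto simp del: cont_comp.simps act.simps)
  have "(x, \<phi>, \<theta>, y) = (x, \<phi>, \<psi>, y)"
  proof (rule cont_ext[OF \<theta>(2) f_arr])
    fix i r assume ir: "cone_over \<phi> y i r"
    then have i: "Ident C (Cod C x) \<cdot> i = i" "i \<in> Arr C" "Cod C i = Cod C x"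
      using ty by (auto simp: cone_over_def)
    then have "cone_over (Ident C (Cod C x)) x i (act (x, \<phi>, \<psi>, y) i r)"
      unfolding cone_over_def by (simp add: ty act_arr[OF f_arr ir] del: act.simps)
    then show "act (x, \<phi>, \<theta>, y) i r = act (x, \<phi>, \<psi>, y) i r"
      by (simp only: \<theta>(3)[OF ir] Ident_act i(1))
  qed
  then show "f \<cdot>\<^bsub>Cont C\<^esub> Ident (Cont C) x = f"
    using \<theta>(1) by (simp add: f del: cont_comp.simps)
next
  fix f g h w x y z
  assume "f \<in> hom (Cont C) w x" "g \<in> hom (Cont C) x y" "h \<in> hom (Cont C) y z"
  then obtain \<phi> \<psi> \<phi>' \<psi>' \<phi>'' \<psi>'' where
    fgh: "f = (w, \<phi>, \<psi>, x)" "g = (x, \<phi>', \<psi>', y)" "h = (y, \<phi>'', \<psi>'', z)"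
    and f: "(w, \<phi>, \<psi>, x) \<in> Arr (Cont C)" and g: "(x, \<phi>', \<psi>', y) \<in> Arr (Cont C)"
    and h: "(y, \<phi>'', \<psi>'', z) \<in> Arr (Cont C)"
    by (cases f; cases g; cases h) (auto simp: in_hom_iff)
  have ty: "\<phi> \<in> Arr C" "\<phi>' \<in> Arr C" "\<phi>'' \<in> Arr C" "Cod C \<phi> = Cod C x" "Dom C \<phi>' = Cod C x"
    "Cod C \<phi>' = Cod C y" "Dom C \<phi>'' = Cod C y" "Dom C \<phi> = Cod C w"
    using f g h by (auto simp: Cont_arr_iff)
  obtain \<alpha> where gf: "cont_comp C g f = (w, \<phi>' \<cdot> \<phi>, \<alpha>, y)"
    and gf_arr: "(w, \<phi>' \<cdot> \<phi>, \<alpha>, y) \<in> Arr (Cont C)"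
    and gf_act: "\<And>i r. cone_over (\<phi>' \<cdot> \<phi>) y i r \<Longrightarrow>
      act (w, \<phi>' \<cdot> \<phi>, \<alpha>, y) i r = act f i (act g (\<phi> \<cdot> i) r)"
    using cont_comp[OF f g] unfolding fgh by blast
  obtain \<beta> where hg: "cont_comp C h g = (x, \<phi>'' \<cdot> \<phi>', \<beta>, z)"
    and hg_arr: "(x, \<phi>'' \<cdot> \<phi>', \<beta>, z) \<in> Arr (Cont C)"
    and hg_act: "\<And>i r. cone_over (\<phi>'' \<cdot> \<phi>') z i r \<Longrightarrow>
      act (x, \<phi>'' \<cdot> \<phi>', \<beta>, z) i r = act g i (act h (\<phi>' \<cdot> i) r)"
    using cont_comp[OF g h] unfolding fgh by blast
  \<comment> \<open>\<open>cont_ext\<close> compares morphisms with the same forward part, so those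
    of the two triple composites are identified first.\<close>
  have \<phi>_assoc: "(\<phi>'' \<cdot> \<phi>') \<cdot> \<phi> = \<phi>'' \<cdot> (\<phi>' \<cdot> \<phi>)"
    by (simp add: ty)
  obtain \<gamma> where l: "cont_comp C h (cont_comp C g f) = (w, \<phi>'' \<cdot> (\<phi>' \<cdot> \<phi>), \<gamma>, z)"
    and l_arr: "(w, \<phi>'' \<cdot> (\<phi>' \<cdot> \<phi>), \<gamma>, z) \<in> Arr (Cont C)"
    and l_act: "\<And>i r. cone_over (\<phi>'' \<cdot> (\<phi>' \<cdot> \<phi>)) z i r \<Longrightarrow>
      act (w, \<phi>'' \<cdot> (\<phi>' \<cdot> \<phi>), \<gamma>, z) i r =
      act (w, \<phi>' \<cdot> \<phi>, \<alpha>, y) i (act h ((\<phi>' \<cdot> \<phi>) \<cdot> i) r)"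
    using cont_comp[OF gf_arr h] unfolding gf unfolding fgh by blast
  obtain \<delta> where r: "cont_comp C (cont_comp C h g) f = (w, \<phi>'' \<cdot> (\<phi>' \<cdot> \<phi>), \<delta>, z)"
    and r_arr: "(w, \<phi>'' \<cdot> (\<phi>' \<cdot> \<phi>), \<delta>, z) \<in> Arr (Cont C)"
    and r_act: "\<And>i r. cone_over (\<phi>'' \<cdot> (\<phi>' \<cdot> \<phi>)) z i r \<Longrightarrow>
      act (w, \<phi>'' \<cdot> (\<phi>' \<cdot> \<phi>), \<delta>, z) i r =
      act f i (act (x, \<phi>'' \<cdot> \<phi>', \<beta>, z) (\<phi> \<cdot> i) r)"
    using cont_comp[OF f hg_arr] unfolding hg \<phi>_assoc unfolding fgh by blast
  have "(w, \<phi>'' \<cdot> (\<phi>' \<cdot> \<phi>), \<delta>, z) = (w, \<phi>'' \<cdot> (\<phi>' \<cdot> \<phi>), \<gamma>, z)"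
  proof (rule cont_ext[OF r_arr l_arr])
    fix i r assume ir: "cone_over (\<phi>'' \<cdot> (\<phi>' \<cdot> \<phi>)) z i r"
    then have i: "i \<in> Arr C" "Cod C i = Cod C w"
      using ty by (auto simp: cone_over_def)
    have c1: "cone_over (\<phi>'' \<cdot> \<phi>') z (\<phi> \<cdot> i) r"
      using ir ty by (intro cone_over_Comp) simp_all
    have c2: "cone_over \<phi>'' z ((\<phi>' \<cdot> \<phi>) \<cdot> i) r"
      using ir ty by (intro cone_over_Comp) simp_all
    have "cone_over (\<phi>' \<cdot> \<phi>) y i (act h ((\<phi>' \<cdot> \<phi>) \<cdot> i) r)"
      using act_arr[OF h c2] i ty g f unfolding fgh
      by (simp add: cone_over_def Cont_arr_iff del: act.simps)
    from gf_act[OF this] show "act (w, \<phi>'' \<cdot> (\<phi>' \<cdot> \<phi>), \<delta>, z) i r =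
        act (w, \<phi>'' \<cdot> (\<phi>' \<cdot> \<phi>), \<gamma>, z) i r"
      using i ty by (simp add: r_act[OF ir] l_act[OF ir] hg_act[OF c1] del: act.simps)
  qed
  then show "(h \<cdot>\<^bsub>Cont C\<^esub> g) \<cdot>\<^bsub>Cont C\<^esub> f = h \<cdot>\<^bsub>Cont C\<^esub> (g \<cdot>\<^bsub>Cont C\<^esub> f)"
    using l r by simp
qed

section \<open>The shape functor and its lifts\<close>

lemma is_functor_shape: "is_functor (Cont C) C (shape C)"
  unfolding is_functor_def
proof (intro conjI ballI impI)
  fix f g assume "f \<in> Arr (Cont C)" "g \<in> Arr (Cont C)" "Cod (Cont C) f = Dom (Cont C) g"
  then show "far (shape C) (g \<cdot>\<^bsub>Cont C\<^esub> f) = far (shape C) g \<cdot> far (shape C) f"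
    by (cases f; cases g) (simp add: Let_def)
next
  fix f assume "f \<in> Arr (Cont C)"
  then show "far (shape C) f \<in> hom C (fob (shape C) (Dom (Cont C) f)) (fob (shape C) (Cod (Cont C) f))"
    by (cases f) (simp add: Cont_arr_iff in_hom_iff)
qed simp_all

declare act.simps [simp del] cont_comp.simps [simp del]

text \<open>Recognises a composite by its operation; the lifting lemmas and \<open>lin_comp\<close>
  check their composites in this way.\<close>

lemma cont_comp_eqI:
  assumes m: "(P, \<phi>, \<psi>, Q) \<in> Arr (Cont C)" and n: "(Q, \<phi>', \<psi>', R) \<in> Arr (Cont C)"
    and l: "(P, \<phi>' \<cdot> \<phi>, \<theta>, R) \<in> Arr (Cont C)"
    and act: "\<And>i r. cone_over (\<phi>' \<cdot> \<phi>) R i r \<Longrightarrow>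
      act (P, \<phi>' \<cdot> \<phi>, \<theta>, R) i r = act (P, \<phi>, \<psi>, Q) i (act (Q, \<phi>', \<psi>', R) (\<phi> \<cdot> i) r)"
  shows "cont_comp C (Q, \<phi>', \<psi>', R) (P, \<phi>, \<psi>, Q) = (P, \<phi>' \<cdot> \<phi>, \<theta>, R)"
proof -
  obtain \<theta>' where 1: "cont_comp C (Q, \<phi>', \<psi>', R) (P, \<phi>, \<psi>, Q) = (P, \<phi>' \<cdot> \<phi>, \<theta>', R)"
    and 2: "(P, \<phi>' \<cdot> \<phi>, \<theta>', R) \<in> Arr (Cont C)"
    and 3: "\<And>i r. cone_over (\<phi>' \<cdot> \<phi>) R i r \<Longrightarrow>
      act (P, \<phi>' \<cdot> \<phi>, \<theta>', R) i r = act (P, \<phi>, \<psi>, Q) i (act (Q, \<phi>', \<psi>', R) (\<phi> \<cdot> i) r)"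
    using cont_comp[OF m n] by blast
  have "(P, \<phi>' \<cdot> \<phi>, \<theta>', R) = (P, \<phi>' \<cdot> \<phi>, \<theta>, R)"
    by (rule cont_ext[OF 2 l]) (simp only: 3 act)
  with 1 show ?thesis
    by simp
qed

lemma act_cont_comp:
  assumes "(P, \<phi>, \<psi>, Q) \<in> Arr (Cont C)" "(Q, \<phi>', \<psi>', R) \<in> Arr (Cont C)"
    and "cont_comp C (Q, \<phi>', \<psi>', R) (P, \<phi>, \<psi>, Q) = (P, \<chi>, \<theta>, R)" "cone_over \<chi> R i r"
  shows "act (P, \<chi>, \<theta>, R) i r = act (P, \<phi>, \<psi>, Q) i (act (Q, \<phi>', \<psi>', R) (\<phi> \<cdot> i) r)"
  using cont_comp[OF assms(1,2)] assms(3,4) by auto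

text \<open>The lift is the pullback projection of Y along \<phi>, with identity backward part. A
  morphism g over \<phi> \<sigma> factors because an element of \<open>\<phi>\<^sup>* Y\<close> over
  \<sigma> l is the same as an element of Y over \<phi> \<sigma> l, and on these g already
  operates.\<close>

lemma shape_cartesian_lift:
  assumes \<phi>: "\<phi> \<in> Arr C" and Y: "Y \<in> Arr C" and \<phi>Y: "Cod C \<phi> = Cod C Y"
  shows "\<exists>k. cartesian_lift (Cont C) C (shape C) \<phi> Y k"
proof -
  let ?P = "pb_fst C \<phi> Y"
  \<comment> \<open>This is the identity of \<open>\<phi>\<^sup>* Y\<close>, written as a pairing so
    that the operation of the lift is \<open>pb_pair\<close> itself.\<close>
  let ?\<kappa> = "pb_pair C \<phi> Y (pb_fst C \<phi> Y) (pb_snd C \<phi> Y)"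
  let ?k = "(?P, \<phi>, ?\<kappa>, Y)"
  have k: "?k \<in> Arr (Cont C)"
    and k_act: "\<And>i r. cone_over \<phi> Y i r \<Longrightarrow> act ?k i r = pb_pair C \<phi> Y i r"
    by (rule cont_arr_of_operation[where T = "pb_pair C \<phi> Y"];
        simp add: \<phi> Y \<phi>Y cone_pair cone_comp)+
  have "\<exists>!h. h \<in> hom (Cont C) W ?P \<and> forward h = \<sigma> \<and> cont_comp C ?k h = g"
    if g: "g = (W, \<phi> \<cdot> \<sigma>, \<psi>, Y)" "g \<in> Arr (Cont C)" and \<sigma>: "\<sigma> \<in> hom C (Cod C W) (Dom C \<phi>)"
    for g W \<sigma> \<psi>
  proof -
    have \<sigma>' [simp]: "\<sigma> \<in> Arr C" "Dom C \<sigma> = Cod C W" "Cod C \<sigma> = Dom C \<phi>"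
      using \<sigma> by (auto simp: in_hom_iff)
    have g_arr: "(W, \<phi> \<cdot> \<sigma>, \<psi>, Y) \<in> Arr (Cont C)"
      using g by simp
    have W: "W \<in> Arr C"
      using g_arr by (simp add: Cont_arr_iff)
    let ?T = "\<lambda>l e. act (W, \<phi> \<cdot> \<sigma>, \<psi>, Y) l (pb_snd C \<phi> Y \<cdot> e)"
    let ?h = "(W, \<sigma>, ?T (pb_fst C \<sigma> ?P) (pb_snd C \<sigma> ?P), ?P)"
    have cone: "cone_over (\<phi> \<cdot> \<sigma>) Y l (pb_snd C \<phi> Y \<cdot> e)" if "cone_over \<sigma> ?P l e" for l e
    proof -
      have le: "l \<in> Arr C" "e \<in> Arr C" "Cod C l = Cod C W" "Cod C e = pb_obj C \<phi> Y"
        "Dom C e = Dom C l" "\<sigma> \<cdot> l = ?P \<cdot> e"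
        using cone_overD[OF that] \<phi> Y \<phi>Y by simp_all
      have "\<phi> \<cdot> (\<sigma> \<cdot> l) = Y \<cdot> (pb_snd C \<phi> Y \<cdot> e)"
        using Comp_eq_assoc[OF pb_square[OF \<phi> Y \<phi>Y], of e] by (simp add: le \<phi> Y \<phi>Y)
      then show ?thesis
        by (simp add: cone_over_def le(1-5) \<phi> Y \<phi>Y)
    qed
    have T: "?T l e \<in> Arr C \<and> Dom C (?T l e) = Dom C l \<and> Cod C (?T l e) = Dom C W \<and> W \<cdot> ?T l e = l"
      if "cone_over \<sigma> ?P l e" for l e
      using act_arr[OF g_arr cone[OF that]] by simp
    have nat: "?T l e \<cdot> s = ?T (l \<cdot> s) (e \<cdot> s)"
      if le: "cone_over \<sigma> ?P l e" and s: "s \<in> Arr C" "Cod C s = Dom C l" for l e s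
      using act_comp[OF g_arr cone[OF le] s] cone_overD[OF le] s by (simp add: \<phi> Y \<phi>Y)
    have h: "?h \<in> Arr (Cont C)"
      by (rule cont_arr_of_operation(1)[where T = ?T, OF _ _ _ _ _ T nat])
        (simp_all add: \<phi> Y \<phi>Y W)
    have h_act: "act ?h l e = ?T l e" if "cone_over \<sigma> ?P l e" for l e
      by (rule cont_arr_of_operation(2)[where T = ?T, OF _ _ _ _ _ T nat that])
        (simp_all add: \<phi> Y \<phi>Y W)
    show ?thesis
    proof (rule ex1I[of _ ?h])
      have "cont_comp C ?k ?h = (W, \<phi> \<cdot> \<sigma>, \<psi>, Y)"
      proof (rule cont_comp_eqI[OF h k g_arr])
        fix l r assume lr: "cone_over (\<phi> \<cdot> \<sigma>) Y l r"
        then have l: "l \<in> Arr C" "Cod C l = Cod C W" and c: "cone_over \<phi> Y (\<sigma> \<cdot> l) r"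
          using \<phi> by (auto simp: cone_over_def)
        have c': "cone_over \<sigma> ?P l (pb_pair C \<phi> Y (\<sigma> \<cdot> l) r)"
          unfolding cone_over_def by (simp add: cone_pair[OF c] l \<phi> Y \<phi>Y)
        show "act (W, \<phi> \<cdot> \<sigma>, \<psi>, Y) l r = act ?h l (act ?k (\<sigma> \<cdot> l) r)"
          by (simp only: h_act[OF c'] k_act[OF c] cone_pair(5)[OF c])
      qed
      then show "?h \<in> hom (Cont C) W ?P \<and> forward ?h = \<sigma> \<and> cont_comp C ?k ?h = g"
        using h by (simp add: in_hom_iff g(1))
    next
      fix h' assume h': "h' \<in> hom (Cont C) W ?P \<and> forward h' = \<sigma> \<and> cont_comp C ?k h' = g"
      then obtain \<psi>' where h'_eq: "h' = (W, \<sigma>, \<psi>', ?P)" and h'_arr: "(W, \<sigma>, \<psi>', ?P) \<in> Arr (Cont C)"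
        by (cases h') (auto simp: in_hom_iff)
      have comp: "cont_comp C ?k (W, \<sigma>, \<psi>', ?P) = (W, \<phi> \<cdot> \<sigma>, \<psi>, Y)"
        using h' by (simp add: h'_eq g(1))
      show "h' = ?h"
        unfolding h'_eq
      proof (rule cont_ext[OF h'_arr h])
        fix l e assume le: "cone_over \<sigma> ?P l e"
        have e: "e \<in> Arr C" "Cod C e = pb_obj C \<phi> Y" "?P \<cdot> e = \<sigma> \<cdot> l"
          using cone_overD[OF le] \<phi> Y \<phi>Y by simp_all
        \<comment> \<open>Every e is the pairing of its own components, so the composite with the
          lift determines the operation of h' on e.\<close>
        have c: "cone_over \<phi> Y (\<sigma> \<cdot> l) (pb_snd C \<phi> Y \<cdot> e)"
          and pair: "pb_pair C \<phi> Y (\<sigma> \<cdot> l) (pb_snd C \<phi> Y \<cdot> e) = e"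
          using cone_into_pb[OF \<phi> Y \<phi>Y e(1,2)] by (simp_all only: e(3))
        show "act (W, \<sigma>, \<psi>', ?P) l e = act ?h l e"
          using act_cont_comp[OF h'_arr k comp cone[OF le]]
          by (simp only: h_act[OF le] k_act[OF c] pair)
      qed
    qed
  qed
  then show ?thesis
    using k by (intro exI[of _ ?k]) (auto simp: cartesian_lift_def)
qed

text \<open>The direct image along \<open>\<phi>\<close> is \<open>\<Pi>\<^sub>\<phi>\<close>, because the fibres of containers are opposites of slices.\<close>

lemma shape_opcartesian_lift:
  assumes G: "is_Pi_func C \<phi> G" and \<phi>: "\<phi> \<in> Arr C" and Y: "Y \<in> Arr C" and \<phi>Y: "Dom C \<phi> = Cod C Y"
  shows "\<exists>k. cartesian_lift (dual (Cont C)) (dual C) (shape C) \<phi> Y k"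
proof -
  obtain r \<epsilon> where r: "r \<in> Arr C" "Cod C r = Cod C \<phi>"
    and \<epsilon>: "\<epsilon> \<in> Arr C" "Dom C \<epsilon> = pb_obj C \<phi> r" "Cod C \<epsilon> = Dom C Y" "Y \<cdot> \<epsilon> = pb_fst C \<phi> r"
    and univ: "\<And>z f. z \<in> Arr C \<Longrightarrow> Cod C z = Cod C \<phi> \<Longrightarrow> f \<in> hom C (pb_obj C \<phi> z) (Dom C Y) \<Longrightarrow>
       Y \<cdot> f = pb_fst C \<phi> z \<Longrightarrow>
       \<exists>!h. h \<in> hom C (Dom C z) (Dom C r) \<and> r \<cdot> h = z \<and>
          \<epsilon> \<cdot> pb_pair C \<phi> r (pb_fst C \<phi> z) (h \<cdot> pb_snd C \<phi> z) = f"
    by (rule Pi_couniversal[OF G \<phi> Y \<phi>Y[symmetric]]) (rule that)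
  let ?l = "(Y, \<phi>, \<epsilon>, r)"
  have l: "?l \<in> Arr (Cont C)"
    using r \<epsilon> \<phi> Y \<phi>Y by (simp add: Cont_arr_iff)
  have "\<exists>!h. h \<in> hom (Cont C) r W \<and> forward h = \<sigma> \<and> cont_comp C h ?l = g"
    if g: "g = (Y, \<sigma> \<cdot> \<phi>, \<psi>, W)" "g \<in> Arr (Cont C)" and \<sigma>: "\<sigma> \<in> hom C (Cod C \<phi>) (Cod C W)"
    for g W \<sigma> \<psi>
  proof -
    have \<sigma>' [simp]: "\<sigma> \<in> Arr C" "Dom C \<sigma> = Cod C \<phi>" "Cod C \<sigma> = Cod C W"
      using \<sigma> by (auto simp: in_hom_iff)
    have g_arr: "(Y, \<sigma> \<cdot> \<phi>, \<psi>, W) \<in> Arr (Cont C)"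
      using g by simp
    have W [simp]: "W \<in> Arr C"
      using g_arr by (simp add: Cont_arr_iff)
    \<comment> \<open>A container morphism from r to W over \<sigma> is a map from
      \<open>z = \<sigma>\<^sup>* W\<close> to r over the codomain of \<phi>; so z is the object on
      which the couniversal property of r is tested.\<close>
    define z where "z = pb_fst C \<sigma> W"
    have z: "z \<in> Arr C" "Dom C z = pb_obj C \<sigma> W" "Cod C z = Cod C \<phi>"
      by (simp_all add: z_def)
    \<comment> \<open>With j and e the projections of the iterated pullback
      \<open>\<phi>\<^sup>* \<sigma>\<^sup>* W\<close> and d the component in W, the pair (j, d)
      stands in for the generic element over \<sigma> \<phi>, whose own chosen pullback may be a
      different object.\<close>
    define j where "j = pb_fst C \<phi> z"
    define e where "e = pb_snd C \<phi> z"
    define d where "d = pb_snd C \<sigma> W \<cdot> e"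
    have j: "j \<in> Arr C" "Dom C j = pb_obj C \<phi> z" "Cod C j = Cod C Y"
      and e: "e \<in> Arr C" "Dom C e = pb_obj C \<phi> z" "Cod C e = pb_obj C \<sigma> W"
      by (simp_all add: j_def e_def \<phi> z \<phi>Y)
    have je: "z \<cdot> e = \<phi> \<cdot> j"
      unfolding j_def e_def by (rule pb_square[symmetric]) (simp_all add: z \<phi>)
    have c\<sigma>: "cone_over \<sigma> W (\<phi> \<cdot> j) d" and pair\<sigma>: "pb_pair C \<sigma> W (\<phi> \<cdot> j) d = e"
      using cone_into_pb[of \<sigma> W e] by (simp_all add: e flip: z_def je d_def)
    have cg: "cone_over (\<sigma> \<cdot> \<phi>) W j d"
      using cone_overD[OF c\<sigma>] by (simp add: cone_over_def \<phi> \<phi>Y j)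
    \<comment> \<open>The backward part of g moved to the iterated pullback: a map from
      \<open>\<phi>\<^sup>* z\<close> to Y over the domain of \<phi>, whose transpose is the
      required factor.\<close>
    define f where "f = act g j d"
    have f: "f \<in> Arr C" "Dom C f = pb_obj C \<phi> z" "Cod C f = Dom C Y" "Y \<cdot> f = j"
      using act_arr[OF g_arr cg] by (simp_all add: f_def g(1) j)
    have ex1: "\<exists>!h. h \<in> hom C (Dom C z) (Dom C r) \<and> r \<cdot> h = z \<and>
          \<epsilon> \<cdot> pb_pair C \<phi> r j (h \<cdot> e) = f"
      unfolding j_def e_def by (rule univ) (simp_all add: in_hom_iff z f flip: j_def)
    have h_arr: "(r, \<sigma>, h, W) \<in> Arr (Cont C) \<longleftrightarrow> h \<in> hom C (Dom C z) (Dom C r) \<and> r \<cdot> h = z" for h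
      by (auto simp: Cont_arr_iff r z in_hom_iff simp flip: z_def)
    have crh: "cone_over \<phi> r j (h \<cdot> e)" if "(r, \<sigma>, h, W) \<in> Arr (Cont C)" for h
    proof -
      have h: "h \<in> Arr C" "Dom C h = Dom C z" "Cod C h = Dom C r" "r \<cdot> h = z"
        using that by (simp_all add: h_arr in_hom_iff)
      show ?thesis
        by (simp add: cone_over_def \<phi> \<phi>Y r j e z h(1-3) Comp_eq_assoc[OF h(4)] je)
    qed
    have comp: "cont_comp C (r, \<sigma>, h, W) ?l = g \<longleftrightarrow> \<epsilon> \<cdot> pb_pair C \<phi> r j (h \<cdot> e) = f"
      if h: "(r, \<sigma>, h, W) \<in> Arr (Cont C)" for h
    proof
      assume "cont_comp C (r, \<sigma>, h, W) ?l = g"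
      from act_cont_comp[OF l h this[unfolded g(1)] cg]
      show "\<epsilon> \<cdot> pb_pair C \<phi> r j (h \<cdot> e) = f"
        by (simp add: f_def g(1) act.simps pair\<sigma>)
    next
      assume eq: "\<epsilon> \<cdot> pb_pair C \<phi> r j (h \<cdot> e) = f"
      have h': "h \<in> Arr C" "Dom C h = pb_obj C \<sigma> W"
        using h by (simp_all add: h_arr in_hom_iff z)
      have "cont_comp C (r, \<sigma>, h, W) ?l = (Y, \<sigma> \<cdot> \<phi>, \<psi>, W)"
      proof (rule cont_comp_eqI[OF l h g_arr])
        fix j' d' assume c: "cone_over (\<sigma> \<cdot> \<phi>) W j' d'"
        have j': "j' \<in> Arr C" "Cod C j' = Dom C \<phi>" "Dom C d' = Dom C j'"
          using cone_overD[OF c] \<phi> by simp_all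
        have c': "cone_over \<sigma> W (\<phi> \<cdot> j') d'"
          using c \<phi> by (rule cone_over_Comp) simp_all
        let ?e = "pb_pair C \<sigma> W (\<phi> \<cdot> j') d'"
        have cz: "cone_over \<phi> z j' ?e"
          unfolding cone_over_def z_def by (simp add: cone_pair[OF c'] j' \<phi>)
        \<comment> \<open>Every element (j', d') over \<sigma> \<phi> is the restriction of (j, d)
          along s, so the equation at (j, d) implies the equation everywhere.\<close>
        define s where "s = pb_pair C \<phi> z j' ?e"
        have s: "s \<in> Arr C" "Cod C s = pb_obj C \<phi> z" "j \<cdot> s = j'" "e \<cdot> s = ?e"
          using cone_pair[OF cz] by (simp_all add: s_def j_def e_def)
        have d's: "d \<cdot> s = d'"
          by (simp add: d_def e s(1,2) s(4) cone_pair(5)[OF c'])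
        have "act (Y, \<sigma> \<cdot> \<phi>, \<psi>, W) j' d' = f \<cdot> s"
          using act_comp[OF g_arr cg, of s] by (simp add: f_def g(1) s d's j)
        also have "\<dots> = \<epsilon> \<cdot> (pb_pair C \<phi> r j (h \<cdot> e) \<cdot> s)"
          unfolding eq[symmetric] by (rule assoc) (simp_all add: cone_pair[OF crh[OF h]] \<epsilon> s j)
        also have "pb_pair C \<phi> r j (h \<cdot> e) \<cdot> s = pb_pair C \<phi> r (j \<cdot> s) ((h \<cdot> e) \<cdot> s)"
          by (rule cone_comp(2)[OF crh[OF h]]) (simp_all add: s j)
        also have "(h \<cdot> e) \<cdot> s = h \<cdot> ?e"
          by (simp add: e s(1,2) s(4) h')
        finally show "act (Y, \<sigma> \<cdot> \<phi>, \<psi>, W) j' d' = act ?l j' (act (r, \<sigma>, h, W) (\<phi> \<cdot> j') d')"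
          by (simp add: act.simps s(3))
      qed
      then show "cont_comp C (r, \<sigma>, h, W) ?l = g"
        by (simp add: g(1))
    qed
    have "m \<in> hom (Cont C) r W \<and> forward m = \<sigma> \<and> cont_comp C m ?l = g \<longleftrightarrow>
        (\<exists>h. m = (r, \<sigma>, h, W) \<and> h \<in> hom C (Dom C z) (Dom C r) \<and> r \<cdot> h = z \<and>
          \<epsilon> \<cdot> pb_pair C \<phi> r j (h \<cdot> e) = f)" for m
      using comp h_arr by (cases m) (auto simp: in_hom_iff)
    then show ?thesis
      using ex1 by (simp only:) blast
  qed
  then show ?thesis
    using l by (intro exI[of _ ?l]) (auto simp: cartesian_lift_def)
qed


text \<open>
  Over an invertible \<open>\<phi>\<close> the projection \<open>\<phi>\<^sup>*(B) \<rightarrow> B\<close> is invertible, so a container morphism over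
  \<open>\<phi>\<close> is the same as a map \<open>k : B \<rightarrow> A\<close> with \<open>\<phi> P k = Q\<close>.
\<close>

definition lin :: "'b \<Rightarrow> 'b \<Rightarrow> 'b \<Rightarrow> 'b \<Rightarrow> 'b cont_arr" where
  "lin P \<phi> k Q = (P, \<phi>, k \<cdot> pb_snd C \<phi> Q, Q)"

definition lin_map :: "'b \<Rightarrow> 'b \<Rightarrow> 'b \<Rightarrow> 'b \<Rightarrow> bool" where
  "lin_map P \<phi> k Q \<longleftrightarrow> P \<in> Arr C \<and> Q \<in> Arr C \<and> (\<exists>\<gamma>. inverse_arr C \<phi> \<gamma>) \<and>
     Dom C \<phi> = Cod C P \<and> Cod C \<phi> = Cod C Q \<and>
     k \<in> Arr C \<and> Dom C k = Dom C Q \<and> Cod C k = Dom C P \<and> \<phi> \<cdot> (P \<cdot> k) = Q"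

lemma lin_simps [simp]:
  "Dom (Cont C) (lin P \<phi> k Q) = P" "Cod (Cont C) (lin P \<phi> k Q) = Q"
  "forward (lin P \<phi> k Q) = \<phi>" "backward (lin P \<phi> k Q) = k \<cdot> pb_snd C \<phi> Q"
  by (simp_all add: lin_def)

lemma lin_mapD:
  assumes "lin_map P \<phi> k Q"
  shows "P \<in> Arr C" "Q \<in> Arr C" "\<phi> \<in> Arr C" "Dom C \<phi> = Cod C P" "Cod C \<phi> = Cod C Q"
    "k \<in> Arr C" "Dom C k = Dom C Q" "Cod C k = Dom C P" "\<phi> \<cdot> (P \<cdot> k) = Q"
  using assms by (auto simp: lin_map_def dest: inverse_arrD)

text \<open>From \<phi> P k r = Q r = \<phi> i and the invertibility of \<phi> it follows that k r
  lies over i; so composing with k is an operation on elements.\<close>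

lemma lin_arr_act:
  assumes k: "lin_map P \<phi> k Q"
  shows "lin P \<phi> k Q \<in> Arr (Cont C)" "cone_over \<phi> Q i r \<Longrightarrow> act (lin P \<phi> k Q) i r = k \<cdot> r"
proof -
  note D = lin_mapD[OF k]
  obtain \<gamma> where \<gamma>: "inverse_arr C \<phi> \<gamma>"
    using k by (auto simp: lin_map_def)
  have T: "k \<cdot> r \<in> Arr C \<and> Dom C (k \<cdot> r) = Dom C i \<and> Cod C (k \<cdot> r) = Dom C P \<and> P \<cdot> (k \<cdot> r) = i"
    if ir: "cone_over \<phi> Q i r" for i r
  proof -
    note E = cone_overD[OF ir]
    have "P \<cdot> (k \<cdot> r) = \<gamma> \<cdot> (\<phi> \<cdot> (P \<cdot> (k \<cdot> r)))"
      by (subst inverse_arr_cancel(1)[OF \<gamma>]) (simp_all add: D(1-8) E(4-8))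
    also have "\<phi> \<cdot> (P \<cdot> (k \<cdot> r)) = Q \<cdot> r"
      using Comp_eq_assoc[OF D(9), of r] by (simp add: D(1-8) E(4-8))
    also have "\<gamma> \<cdot> (Q \<cdot> r) = i"
      unfolding E(9)[symmetric]
      by (rule inverse_arr_cancel(1)[OF \<gamma>]) (simp_all add: E(4-8))
    finally show ?thesis
      by (simp add: D(1-8) E(4-8))
  qed
  have nat: "k \<cdot> r \<cdot> s = k \<cdot> (r \<cdot> s)"
    if "cone_over \<phi> Q i r" "s \<in> Arr C" "Cod C s = Dom C i" for i r s
    using that(2,3) cone_overD[OF that(1)] D(6-8) by simp
  show "lin P \<phi> k Q \<in> Arr (Cont C)"
    unfolding lin_def
    by (rule cont_arr_of_operation(1)[where T = "\<lambda>i r. k \<cdot> r", OF _ _ _ _ _ T nat]) (fact D)+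
  show "act (lin P \<phi> k Q) i r = k \<cdot> r" if "cone_over \<phi> Q i r"
    unfolding lin_def
    by (rule cont_arr_of_operation(2)[where T = "\<lambda>i r. k \<cdot> r", OF _ _ _ _ _ T nat that])
      (fact D)+
qed

text \<open>The map k is \<psi> after the inverse of the projection onto the domain of Q. It is also
  the middle component returned by \<open>from_vertical\<close>, which links
  \<open>fibre_func\<close> to the \<open>lin\<close> form.\<close>

lemma lin_exhaust:
  assumes m: "(P, \<phi>, \<psi>, Q) \<in> Arr (Cont C)" and \<gamma>: "inverse_arr C \<phi> \<gamma>"
  obtains k where "lin_map P \<phi> k Q" "(P, \<phi>, \<psi>, Q) = lin P \<phi> k Q" "\<psi> = k \<cdot> pb_snd C \<phi> Q"
    "from_vertical C (P, \<phi>, \<psi>, Q) = (Q, k, P)"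
proof -
  have m': "P \<in> Arr C" "Q \<in> Arr C" "\<phi> \<in> Arr C" "Dom C \<phi> = Cod C P" "Cod C \<phi> = Cod C Q"
    "\<psi> \<in> Arr C" "Dom C \<psi> = pb_obj C \<phi> Q" "Cod C \<psi> = Dom C P" "P \<cdot> \<psi> = pb_fst C \<phi> Q"
    using m by (auto simp: Cont_arr_iff)
  define s where "s = inv_arr C (pb_snd C \<phi> Q)"
  have s: "inverse_arr C (pb_snd C \<phi> Q) s"
    using pb_snd_inverse[OF \<gamma> m'(2)] m'(5) by (simp add: s_def inv_arr_eq)
  have s': "s \<in> Arr C" "Dom C s = Dom C Q" "Cod C s = pb_obj C \<phi> Q"
    using inverse_arrD(2-4)[OF s] m' by simp_all
  define k where "k = \<psi> \<cdot> s"
  have "\<phi> \<cdot> (P \<cdot> k) = \<phi> \<cdot> (pb_fst C \<phi> Q \<cdot> s)"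
    using Comp_eq_assoc[OF m'(9), of s] by (simp add: k_def m'(1-8) s')
  also have "\<dots> = Q \<cdot> (pb_snd C \<phi> Q \<cdot> s)"
    using Comp_eq_assoc[OF pb_square[OF m'(3,2,5)], of s] by (simp add: m'(1-8) s')
  also have "\<dots> = Q"
    using inverse_arrD(6)[OF s] by (simp add: m'(1-8))
  finally have "lin_map P \<phi> k Q"
    using \<gamma> by (auto simp: lin_map_def k_def m' s')
  moreover have "\<psi> = k \<cdot> pb_snd C \<phi> Q"
    using inverse_arrD(5)[OF s] by (simp add: k_def m'(1-8) s')
  moreover have "from_vertical C (P, \<phi>, \<psi>, Q) = (Q, k, P)"
    by (simp add: k_def s_def)
  ultimately show ?thesis
    using that[of k] by (simp add: lin_def)
qed

lemma Cont_hom_lin: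
  assumes "inverse_arr C \<phi> \<gamma>"
  shows "m \<in> hom (Cont C) P Q \<and> forward m = \<phi> \<longleftrightarrow> (\<exists>k. m = lin P \<phi> k Q \<and> lin_map P \<phi> k Q)"
proof
  assume m: "m \<in> hom (Cont C) P Q \<and> forward m = \<phi>"
  then obtain \<psi> where m_eq: "m = (P, \<phi>, \<psi>, Q)" and "(P, \<phi>, \<psi>, Q) \<in> Arr (Cont C)"
    by (cases m) (auto simp: in_hom_iff)
  then show "\<exists>k. m = lin P \<phi> k Q \<and> lin_map P \<phi> k Q"
    using lin_exhaust[OF _ assms] by metis
qed (auto simp: in_hom_iff lin_arr_act)

lemma lin_eq_iff:
  assumes "lin_map P \<phi> k Q" "lin_map P \<phi> k' Q"
  shows "lin P \<phi> k Q = lin P \<phi> k' Q \<longleftrightarrow> k = k'"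
proof
  note D = lin_mapD[OF assms(1)] and D' = lin_mapD[OF assms(2)]
  obtain \<gamma> where \<gamma>: "inverse_arr C \<phi> \<gamma>"
    using assms(1) by (auto simp: lin_map_def)
  obtain s where s: "inverse_arr C (pb_snd C \<phi> Q) s"
    using pb_snd_inverse[OF \<gamma> D(2)] D(5) by auto
  have s': "s \<in> Arr C" "Dom C s = Dom C Q" "Cod C s = pb_obj C \<phi> Q"
    "pb_snd C \<phi> Q \<cdot> s = Ident C (Dom C Q)"
    using inverse_arrD[OF s] D by simp_all
  assume "lin P \<phi> k Q = lin P \<phi> k' Q"
  then have "(k \<cdot> pb_snd C \<phi> Q) \<cdot> s = (k' \<cdot> pb_snd C \<phi> Q) \<cdot> s"
    by (simp add: lin_def)
  then show "k = k'"
    by (simp add: s' D(1-8) D'(6-8))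
qed simp

text \<open>Backward maps compose in the reverse order, and as plain maps: the comparison of
  \<open>(\<phi>' \<cdot> \<phi>)\<^sup>*\<close> with the iterated pullback has
  disappeared.\<close>

lemma lin_comp:
  assumes k: "lin_map P \<phi> k Q" and k': "lin_map Q \<phi>' k' R"
  shows "lin_map P (\<phi>' \<cdot> \<phi>) (k \<cdot> k') R"
    "cont_comp C (lin Q \<phi>' k' R) (lin P \<phi> k Q) = lin P (\<phi>' \<cdot> \<phi>) (k \<cdot> k') R"
proof -
  note D = lin_mapD[OF k] and D' = lin_mapD[OF k']
  have "\<phi> \<cdot> (P \<cdot> (k \<cdot> k')) = Q \<cdot> k'"
    using Comp_eq_assoc[OF D(9), of k'] by (simp add: D(1-8) D'(6-8))
  then have "(\<phi>' \<cdot> \<phi>) \<cdot> (P \<cdot> (k \<cdot> k')) = R"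
    by (simp add: D(1-8) D')
  moreover have "\<exists>\<gamma>. inverse_arr C (\<phi>' \<cdot> \<phi>) \<gamma>"
    using inverse_arr_comp k k' D(5) D'(4) unfolding lin_map_def by metis
  ultimately show kk': "lin_map P (\<phi>' \<cdot> \<phi>) (k \<cdot> k') R"
    unfolding lin_map_def by (simp add: D(1-8) D'(1-8) del: assoc)
  have "cont_comp C (Q, \<phi>', k' \<cdot> pb_snd C \<phi>' R, R) (P, \<phi>, k \<cdot> pb_snd C \<phi> Q, Q) =
      (P, \<phi>' \<cdot> \<phi>, (k \<cdot> k') \<cdot> pb_snd C (\<phi>' \<cdot> \<phi>) R, R)"
  proof (rule cont_comp_eqI[OF lin_arr_act(1)[OF k, unfolded lin_def]
        lin_arr_act(1)[OF k', unfolded lin_def] lin_arr_act(1)[OF kk', unfolded lin_def]])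
    fix i r assume c: "cone_over (\<phi>' \<cdot> \<phi>) R i r"
    have c': "cone_over \<phi>' R (\<phi> \<cdot> i) r"
      by (rule cone_over_Comp[OF c]) (simp_all add: D(1-8) D'(1-8))
    have r: "r \<in> Arr C" "Cod C r = Dom C R" "Dom C r = Dom C i" "i \<in> Arr C" "Cod C i = Cod C P"
      "\<phi>' \<cdot> (\<phi> \<cdot> i) = R \<cdot> r"
      using cone_overD[OF c] by (simp_all add: D(1-8) D'(1-8))
    have "Q \<cdot> act (lin Q \<phi>' k' R) (\<phi> \<cdot> i) r = \<phi> \<cdot> i"
      using act_arr(4) lin_arr_act(1)[OF k'] c' unfolding lin_def by blast
    then have "Q \<cdot> (k' \<cdot> r) = \<phi> \<cdot> i"
      by (simp add: lin_arr_act(2)[OF k' c'])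
    then have "cone_over \<phi> Q i (k' \<cdot> r)"
      by (simp add: cone_over_def D(1-8) D'(1-8) r)
    from lin_arr_act(2)[OF k this] lin_arr_act(2)[OF k' c'] lin_arr_act(2)[OF kk' c]
    show "act (P, \<phi>' \<cdot> \<phi>, (k \<cdot> k') \<cdot> pb_snd C (\<phi>' \<cdot> \<phi>) R, R) i r =
        act (P, \<phi>, k \<cdot> pb_snd C \<phi> Q, Q) i (act (Q, \<phi>', k' \<cdot> pb_snd C \<phi>' R, R) (\<phi> \<cdot> i) r)"
      unfolding lin_def by (simp add: D(1-8) D'(1-8) r)
  qed
  then show "cont_comp C (lin Q \<phi>' k' R) (lin P \<phi> k Q) = lin P (\<phi>' \<cdot> \<phi>) (k \<cdot> k') R"
    by (simp add: lin_def)
qed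

text \<open>Identifies the fibre over I with the opposite of the slice: source and target trade
  places.\<close>

lemma lin_map_Ident_iff:
  assumes "I \<in> Obj C"
  shows "lin_map p (Ident C I) h q \<longleftrightarrow> (q, h, p) \<in> Arr (slice C I)"
proof
  assume l: "lin_map p (Ident C I) h q"
  note D = lin_mapD[OF l]
  have I: "Cod C p = I" "Cod C q = I"
    using D(4,5) assms by simp_all
  have "p \<cdot> h = q"
    using D(9) by (simp add: D(1,6,8) I(1))
  then show "(q, h, p) \<in> Arr (slice C I)"
    using D(1,2,6,7,8) I by (simp only: slice_simps)
next
  assume "(q, h, p) \<in> Arr (slice C I)"
  then have h: "q \<in> Arr C" "Cod C q = I" "p \<in> Arr C" "Cod C p = I" "h \<in> Arr C"
    "Dom C h = Dom C q" "Cod C h = Dom C p" "p \<cdot> h = q"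
    by (simp_all only: slice_simps)
  have "inverse_arr C (Ident C I) (Ident C I)"
    using assms by (simp add: inverse_arr_def in_hom_iff)
  then show "lin_map p (Ident C I) h q"
    unfolding lin_map_def using assms by (auto simp: h)
qed

end

section \<open>Algebras over an isomorphism and coalgebras in a fibre\<close>

locale fibred_endofunc = category_with_pullbacks C
  for C :: "('o, 'a) cat" (structure) +
  fixes F :: "('a, 'a cont_arr, 'a, 'a cont_arr) func"
    and F\<^sub>0 :: "('o, 'a, 'o, 'a) func"
  assumes F: "is_functor (Cont C) (Cont C) F"
    and F\<^sub>0: "is_functor C C F\<^sub>0"
    and shape_F: "eq_func (Cont C) (shape C \<circ>\<^sub>F F) (F\<^sub>0 \<circ>\<^sub>F shape C)"
begin

lemma fob_F [simp]:
  assumes "P \<in> Arr C"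
  shows "fob F P \<in> Arr C" "Cod C (fob F P) = fob F\<^sub>0 (Cod C P)"
  using is_functorD(1)[OF F, of P] shape_F assms by (simp_all add: eq_func_def comp_func_def)

lemma far_F:
  assumes "m \<in> hom (Cont C) P Q"
  shows "far F m \<in> hom (Cont C) (fob F P) (fob F Q)" "forward (far F m) = far F\<^sub>0 (forward m)"
  using is_functorD(2-4)[OF F, of m] shape_F assms
  by (auto simp: eq_func_def comp_func_def in_hom_iff)

definition fibre_map :: "'o \<Rightarrow> 'a \<Rightarrow> 'a \<Rightarrow> 'a \<Rightarrow> 'a" where
  "fibre_map I q h p = fst (snd (far (fibre_func C F I) (q, h, p)))"

text \<open>\<open>to_vertical\<close> produces a morphism already in \<open>lin\<close> form, and
  \<open>from_vertical\<close> reads off its map. So F on vertical morphisms and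
  \<open>fibre_func\<close> on slice arrows share one underlying map, with no comparison isomorphism
  left.\<close>

lemma fibre_func_far:
  assumes I: "I \<in> Obj C" and h: "(q, h, p) \<in> Arr (slice C I)"
  shows "far F (lin p (Ident C I) h q) =
      lin (fob F p) (Ident C (fob F\<^sub>0 I)) (fibre_map I q h p) (fob F q)"
    "lin_map (fob F p) (Ident C (fob F\<^sub>0 I)) (fibre_map I q h p) (fob F q)"
    "far (fibre_func C F I) (q, h, p) = (fob F q, fibre_map I q h p, fob F p)"
proof -
  let ?l = "lin p (Ident C I) h q"
  have "?l \<in> hom (Cont C) p q"
    using h lin_arr_act(1) lin_map_Ident_iff[OF I] by (simp add: in_hom_iff)
  from far_F[OF this] have Fl: "far F ?l \<in> hom (Cont C) (fob F p) (fob F q)"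
    "forward (far F ?l) = Ident C (fob F\<^sub>0 I)"
    using is_functorD(5)[OF F\<^sub>0 I] by simp_all
  then obtain \<psi> where \<psi>: "far F ?l = (fob F p, Ident C (fob F\<^sub>0 I), \<psi>, fob F q)"
    "(fob F p, Ident C (fob F\<^sub>0 I), \<psi>, fob F q) \<in> Arr (Cont C)"
    by (cases "far F ?l") (auto simp: in_hom_iff)
  have "inverse_arr C (Ident C (fob F\<^sub>0 I)) (Ident C (fob F\<^sub>0 I))"
    using is_functorD(1)[OF F\<^sub>0 I] by (simp add: inverse_arr_def in_hom_iff)
  from lin_exhaust[OF \<psi>(2) this] obtain w where
    w: "lin_map (fob F p) (Ident C (fob F\<^sub>0 I)) w (fob F q)"
    "far F ?l = lin (fob F p) (Ident C (fob F\<^sub>0 I)) w (fob F q)"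
    "from_vertical C (far F ?l) = (fob F q, w, fob F p)"
    unfolding \<psi>(1) by metis
  have "to_vertical C I (q, h, p) = ?l"
    by (simp add: lin_def)
  then have far: "far (fibre_func C F I) (q, h, p) = (fob F q, w, fob F p)"
    using w(3) by (simp add: fibre_func_def del: to_vertical.simps)
  then have "fibre_map I q h p = w"
    by (simp add: fibre_map_def)
  with w far show "far F (lin p (Ident C I) h q) =
      lin (fob F p) (Ident C (fob F\<^sub>0 I)) (fibre_map I q h p) (fob F q)"
    "lin_map (fob F p) (Ident C (fob F\<^sub>0 I)) (fibre_map I q h p) (fob F q)"
    "far (fibre_func C F I) (q, h, p) = (fob F q, fibre_map I q h p, fob F p)"
    by simp_all
qed

lemma fibre_map_arr:
  assumes I: "I \<in> Obj C" and h: "(q, h, p) \<in> Arr (slice C I)"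
  shows "fibre_map I q h p \<in> Arr C" "Dom C (fibre_map I q h p) = Dom C (fob F q)"
    "Cod C (fibre_map I q h p) = Dom C (fob F p)" "fob F p \<cdot> fibre_map I q h p = fob F q"
proof -
  note D = lin_mapD[OF fibre_func_far(2)[OF assms]]
  show "fibre_map I q h p \<in> Arr C" "Dom C (fibre_map I q h p) = Dom C (fob F q)"
    "Cod C (fibre_map I q h p) = Dom C (fob F p)"
    by (fact D)+
  have "Cod C p = I" "p \<in> Arr C"
    using h by simp_all
  then show "fob F p \<cdot> fibre_map I q h p = fob F q"
    using D(9) by (simp add: D(1,6,8))
qed

lemma fob_pb_fibre [simp]: "fob (pb_func C c \<circ>\<^sub>F fibre_func C F I) p = pb_fst C c (fob F p)"
  by (simp add: comp_func_def pb_func_def fibre_func_def)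

lemma far_pb_fibre:
  assumes "I \<in> Obj C" "(q, h, p) \<in> Arr (slice C I)"
  shows "far (pb_func C c \<circ>\<^sub>F fibre_func C F I) (q, h, p) =
    (pb_fst C c (fob F q), pb_pair C c (fob F p) (pb_fst C c (fob F q))
      (fibre_map I q h p \<cdot> pb_snd C c (fob F q)), pb_fst C c (fob F p))"
  using fibre_func_far(3)[OF assms] by (simp add: comp_func_def pb_func_def)

text \<open>Justifies the pairing that occurs in the arrow part of the composite functor on the
  slice.\<close>

lemma cone_fibre_map:
  assumes I: "I \<in> Obj C" and c: "c \<in> Arr C" "Cod C c = fob F\<^sub>0 I"
    and h: "(q, h, p) \<in> Arr (slice C I)"
  shows "cone_over c (fob F p) (pb_fst C c (fob F q)) (fibre_map I q h p \<cdot> pb_snd C c (fob F q))"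
proof -
  note w = fibre_map_arr[OF I h]
  have [simp]: "p \<in> Arr C" "q \<in> Arr C" "Cod C p = I" "Cod C q = I"
    using h by simp_all
  show ?thesis
    unfolding cone_over_def
    by (simp add: c w(1-3) Comp_eq_assoc[OF w(4)] pb_square)
qed

lemma Cont_hom_vertical:
  assumes "I \<in> Obj C"
  shows "m \<in> hom (Cont C) p q \<and> forward m = Ident C I \<longleftrightarrow>
    (\<exists>h. m = lin p (Ident C I) h q \<and> (q, h, p) \<in> Arr (slice C I))"
proof -
  have "inverse_arr C (Ident C I) (Ident C I)"
    using assms by (simp add: inverse_arr_def in_hom_iff)
  from Cont_hom_lin[OF this] show ?thesis
    by (simp only: lin_map_Ident_iff[OF assms])
qed

text \<open>An algebra on y over \<beta> amounts to a map k' between the domains of y and F y with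
  (F y) k' = c y, that is, to a map from y to \<open>c\<^sup>*(F y)\<close> over I. A vertical
  algebra morphism from x to y is a slice map h from y to x with k h = F(h) k', the condition on
  coalgebra morphisms; so terminality turns into initiality. Besides initial algebras this serves
  the fixed point of the third claim.\<close>

lemma terminal_fibre_coalgebra:
  assumes \<beta>: "inverse_arr C \<beta> c" and I: "Cod C \<beta> = I" "Dom C \<beta> = fob F\<^sub>0 I"
    and "terminal": "terminal_coalgebra (slice C I) (pb_func C c \<circ>\<^sub>F fibre_func C F I) x m"
  obtains b where "algebra (Cont C) F x b" "forward b = \<beta>" "induced_coalgebra_map C F x b c = m"
    "\<And>y b'. algebra (Cont C) F y b' \<Longrightarrow> Cod C y = I \<Longrightarrow> forward b' = \<beta> \<Longrightarrow>
      \<exists>!h. h \<in> hom (Cont C) x y \<and> forward h = Ident C I \<and>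
        h \<cdot>\<^bsub>Cont C\<^esub> b = b' \<cdot>\<^bsub>Cont C\<^esub> far F h"
proof -
  let ?S = "slice C I" and ?K = "pb_func C c \<circ>\<^sub>F fibre_func C F I"
  have x: "x \<in> Arr C" "Cod C x = I" and m: "m \<in> hom ?S x (pb_fst C c (fob F x))"
    using "terminal" by (simp_all add: terminal_coalgebra_def coalgebra_def)
  have univ: "\<exists>!h. h \<in> hom ?S y x \<and> m \<cdot>\<^bsub>?S\<^esub> h = far ?K h \<cdot>\<^bsub>?S\<^esub> d"
    if "y \<in> Arr C" "Cod C y = I" "d \<in> hom ?S y (pb_fst C c (fob F y))" for y d
    by (rule terminal_coalgebraD(2)[OF "terminal"]) (use that in \<open>simp add: coalgebra_def\<close>)
  have \<beta>' [simp]: "\<beta> \<in> Arr C" "c \<in> Arr C" "Dom C c = I" "Cod C c = fob F\<^sub>0 I"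
    "Dom C \<beta> = fob F\<^sub>0 I" "Cod C \<beta> = I"
    and \<beta>c: "\<beta> \<cdot> c = Ident C I"
    using inverse_arrD[OF \<beta>] I by simp_all
  have I_Obj [simp]: "I \<in> Obj C" "fob F\<^sub>0 I \<in> Obj C"
    using Cod_Obj[of \<beta>] Dom_Obj[of \<beta>] by simp_all
  obtain \<kappa> where m_eq: "m = (x, \<kappa>, pb_fst C c (fob F x))" and \<kappa>: "\<kappa> \<in> Arr C"
    "Dom C \<kappa> = Dom C x" "Cod C \<kappa> = Dom C (pb_fst C c (fob F x))" "pb_fst C c (fob F x) \<cdot> \<kappa> = x"
    using m by (rule slice_homE)
  have \<kappa>_Cod: "Cod C \<kappa> = pb_obj C c (fob F x)"
    using \<kappa>(3) x by simp
  \<comment> \<open>The structure map of the coalgebra has components x and k in the pullback; k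
    becomes the backward map of the algebra.\<close>
  define k where "k = pb_snd C c (fob F x) \<cdot> \<kappa>"
  have k: "k \<in> Arr C" "Dom C k = Dom C x" "Cod C k = Dom C (fob F x)"
    by (simp_all add: k_def \<kappa>(1,2) \<kappa>_Cod x)
  have "fob F x \<cdot> k = c \<cdot> (pb_fst C c (fob F x) \<cdot> \<kappa>)"
    using Comp_eq_assoc[OF pb_square[of c "fob F x"], of \<kappa>] by (simp add: k_def x \<kappa>(1) \<kappa>_Cod)
  then have Fk: "fob F x \<cdot> k = c \<cdot> x"
    by (simp only: \<kappa>(4))
  have lin_k: "lin_map (fob F x) \<beta> k x"
    using \<beta> by (auto simp: lin_map_def x k Fk Comp_eq_assoc[OF \<beta>c])
  define b where "b = lin (fob F x) \<beta> k x"
  have b: "algebra (Cont C) F x b"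
    using lin_arr_act(1)[OF lin_k] x by (simp add: algebra_def in_hom_iff b_def)
  \<comment> \<open>Pairing x with k returns \<kappa>, so the coalgebra induced by b is m itself and
    not merely isomorphic to it.\<close>
  have pair_k: "pb_pair C c (fob F x) x k = \<kappa>"
    by (rule pb_pair_eq) (simp_all add: x \<kappa>(1,4) \<kappa>_Cod k_def)
  have induced: "induced_coalgebra_map C F x b c = m"
  proof -
    obtain s where s: "inverse_arr C (pb_snd C \<beta> x) s"
      using pb_snd_inverse[OF \<beta> x(1)] x(2) by auto
    have s': "s \<in> Arr C" "Cod C s = pb_obj C \<beta> x" "pb_snd C \<beta> x \<cdot> s = Ident C (Dom C x)"
      using inverse_arrD[OF s] x by simp_all
    have "(k \<cdot> pb_snd C \<beta> x) \<cdot> s = k"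
      by (simp add: s' k x)
    then show ?thesis
      by (simp only: induced_coalgebra_map_def b_def lin_simps inv_arr_eq[OF s] pair_k m_eq)
  qed
  have "\<exists>!g. g \<in> hom (Cont C) x y \<and> forward g = Ident C I \<and>
      g \<cdot>\<^bsub>Cont C\<^esub> b = b' \<cdot>\<^bsub>Cont C\<^esub> far F g"
    if b': "algebra (Cont C) F y b'" "forward b' = \<beta>" and y: "Cod C y = I" for y b'
  proof -
    have y': "y \<in> Arr C"
      using b' by (simp add: algebra_def)
    obtain k' where b'_eq: "b' = lin (fob F y) \<beta> k' y" and lin_k': "lin_map (fob F y) \<beta> k' y"
      using b' Cont_hom_lin[OF \<beta>, of b' "fob F y" y] by (auto simp: algebra_def)
    note D = lin_mapD[OF lin_k']
    have "c \<cdot> (\<beta> \<cdot> (fob F y \<cdot> k')) = fob F y \<cdot> k'"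
      by (rule inverse_arr_cancel(1)[OF \<beta>]) (simp_all add: D(6-8) y y')
    then have Fk': "fob F y \<cdot> k' = c \<cdot> y"
      by (simp only: D(9))
    define \<kappa>' where "\<kappa>' = pb_pair C c (fob F y) y k'"
    have cone': "cone_over c (fob F y) y k'"
      by (simp add: cone_over_def y y' D(6-8) Fk')
    note \<kappa>' = cone_pair[OF cone', folded \<kappa>'_def]
    let ?d = "(y, \<kappa>', pb_fst C c (fob F y))"
    have d: "?d \<in> hom ?S y (pb_fst C c (fob F y))"
      using \<kappa>' by (simp add: in_hom_iff y y')
    \<comment> \<open>The common form of the two commutation conditions: in the slice after
      projecting to the domain of F x, and for containers after passing to
      \<open>lin\<close>.\<close>
    define R where "R h \<longleftrightarrow> (y, h, x) \<in> Arr ?S \<and> k \<cdot> h = fibre_map I y h x \<cdot> k'" for h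
    have slice_eq: "m \<cdot>\<^bsub>?S\<^esub> (y, h, x) = far ?K (y, h, x) \<cdot>\<^bsub>?S\<^esub> ?d \<longleftrightarrow> R h"
      and cont_eq: "lin x (Ident C I) h y \<cdot>\<^bsub>Cont C\<^esub> b =
        b' \<cdot>\<^bsub>Cont C\<^esub> far F (lin x (Ident C I) h y) \<longleftrightarrow> R h"
      if h: "(y, h, x) \<in> Arr ?S" for h
    proof -
      have h': "h \<in> Arr C" "Dom C h = Dom C y" "Cod C h = Dom C x" "x \<cdot> h = y"
        using h by simp_all
      let ?w = "fibre_map I y h x"
      note w = fibre_map_arr[OF I_Obj(1) h]
      have cone_w: "cone_over c (fob F x) y (?w \<cdot> k')"
        using w D(6-8) by (simp add: cone_over_def x y y' Comp_eq_assoc[OF w(4)] Fk')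
      have "pb_pair C c (fob F x) (pb_fst C c (fob F y)) (?w \<cdot> pb_snd C c (fob F y)) \<cdot> \<kappa>' =
          pb_pair C c (fob F x) (pb_fst C c (fob F y) \<cdot> \<kappa>') ((?w \<cdot> pb_snd C c (fob F y)) \<cdot> \<kappa>')"
        by (rule cone_comp(2)[OF cone_fibre_map[OF _ _ _ h]]) (simp_all add: y y' \<kappa>'(1-3))
      also have "(?w \<cdot> pb_snd C c (fob F y)) \<cdot> \<kappa>' = ?w \<cdot> k'"
        by (simp add: y y' w(1-3) \<kappa>'(1-3,5))
      finally have K: "far ?K (y, h, x) \<cdot>\<^bsub>?S\<^esub> ?d =
          (y, pb_pair C c (fob F x) y (?w \<cdot> k'), pb_fst C c (fob F x))"
        by (simp add: far_pb_fibre[OF I_Obj(1) h] \<kappa>'(4))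
      have "pb_snd C c (fob F x) \<cdot> (\<kappa> \<cdot> h) = k \<cdot> h"
        by (simp add: k_def x \<kappa>(1,2) \<kappa>_Cod h'(1,3))
      moreover have "pb_fst C c (fob F x) \<cdot> (\<kappa> \<cdot> h) = y"
        using Comp_eq_assoc[OF \<kappa>(4), of h] by (simp add: x \<kappa>(1,2) \<kappa>_Cod h')
      moreover have "\<kappa> \<cdot> h \<in> Arr C" "Cod C (\<kappa> \<cdot> h) = pb_obj C c (fob F x)"
        by (simp_all add: \<kappa>(1,2) \<kappa>_Cod h'(1,3))
      ultimately have "\<kappa> \<cdot> h = pb_pair C c (fob F x) y (?w \<cdot> k') \<longleftrightarrow> k \<cdot> h = ?w \<cdot> k'"
        using cone_pair(5)[OF cone_w] pb_pair_eq[of c "fob F x" "\<kappa> \<cdot> h" y "?w \<cdot> k'"]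
        by (auto simp: x)
      then show "m \<cdot>\<^bsub>?S\<^esub> (y, h, x) = far ?K (y, h, x) \<cdot>\<^bsub>?S\<^esub> ?d \<longleftrightarrow> R h"
        using h by (simp only: K m_eq R_def slice_simps) simp
      have lin_h: "lin_map x (Ident C I) h y"
        using h by (simp only: lin_map_Ident_iff[OF I_Obj(1)])
      note c1 = lin_comp[OF lin_k lin_h]
      note c2 = lin_comp[OF fibre_func_far(2)[OF I_Obj(1) h] lin_k']
      have ids: "Ident C I \<cdot> \<beta> = \<beta>" "\<beta> \<cdot> Ident C (fob F\<^sub>0 I) = \<beta>"
        by simp_all
      show "lin x (Ident C I) h y \<cdot>\<^bsub>Cont C\<^esub> b =
          b' \<cdot>\<^bsub>Cont C\<^esub> far F (lin x (Ident C I) h y) \<longleftrightarrow> R h"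
        using lin_eq_iff[OF c1(1)[unfolded ids] c2(1)[unfolded ids]] h
        by (simp only: Cont_simps b_def b'_eq fibre_func_far(1)[OF I_Obj(1) h]
            c1(2)[unfolded ids] c2(2)[unfolded ids] R_def simp_thms)
    qed
    have "h \<in> hom ?S y x \<and> m \<cdot>\<^bsub>?S\<^esub> h = far ?K h \<cdot>\<^bsub>?S\<^esub> ?d \<longleftrightarrow>
        (\<exists>h'. h = (y, h', x) \<and> R h')" for h
    proof -
      have "h \<in> hom ?S y x \<longleftrightarrow> (\<exists>h'. h = (y, h', x) \<and> (y, h', x) \<in> Arr ?S)"
        by (cases h) (auto simp only: in_hom_iff slice_simps)
      then show ?thesis
        using slice_eq R_def by blast
    qed
    then have "\<exists>!h. \<exists>h'. h = (y, h', x) \<and> R h'"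
      using univ[OF y' y d] by simp
    then have "\<exists>!h. R h"
      by blast
    moreover have "g \<in> hom (Cont C) x y \<and> forward g = Ident C I \<and>
        g \<cdot>\<^bsub>Cont C\<^esub> b = b' \<cdot>\<^bsub>Cont C\<^esub> far F g \<longleftrightarrow>
        (\<exists>h. g = lin x (Ident C I) h y \<and> R h)" for g
      using Cont_hom_vertical[OF I_Obj(1), of g x y] cont_eq R_def by blast
    ultimately show ?thesis
      by (simp only:) blast
  qed
  then show ?thesis
    using that[OF b] induced by (simp add: b_def)
qed

text \<open>The backward part of a coalgebra on y over c is a map from \<open>c\<^sup>*(F y)\<close>
  to y over I, hence already an algebra in the slice. Invertibility of c enters, through
  \<open>lin\<close>, when morphisms are compared; these reverse direction, so initiality turns into
  terminality.\<close>

lemma initial_fibre_algebra: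
  assumes c: "inverse_arr C c \<beta>" and I: "Dom C c = I" "Cod C c = fob F\<^sub>0 I"
    and init: "initial_algebra (slice C I) (pb_func C c \<circ>\<^sub>F fibre_func C F I) x m"
  obtains d where "coalgebra (Cont C) F x d" "forward d = c"
    "\<And>y d'. coalgebra (Cont C) F y d' \<Longrightarrow> Cod C y = I \<Longrightarrow> forward d' = c \<Longrightarrow>
      \<exists>!h. h \<in> hom (Cont C) y x \<and> forward h = Ident C I \<and>
        d \<cdot>\<^bsub>Cont C\<^esub> h = far F h \<cdot>\<^bsub>Cont C\<^esub> d'"
proof -
  let ?S = "slice C I" and ?K = "pb_func C c \<circ>\<^sub>F fibre_func C F I"
  have x: "x \<in> Arr C" "Cod C x = I" and m: "m \<in> hom ?S (pb_fst C c (fob F x)) x"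
    using init by (simp_all add: initial_algebra_def algebra_def)
  have univ: "\<exists>!h. h \<in> hom ?S x y \<and> h \<cdot>\<^bsub>?S\<^esub> m = b \<cdot>\<^bsub>?S\<^esub> far ?K h"
    if "y \<in> Arr C" "Cod C y = I" "b \<in> hom ?S (pb_fst C c (fob F y)) y" for y b
    by (rule initial_algebraD(2)[OF init]) (use that in \<open>simp add: algebra_def\<close>)
  have c' [simp]: "c \<in> Arr C" "Dom C c = I" "Cod C c = fob F\<^sub>0 I"
    using inverse_arrD[OF c] I by simp_all
  have I_Obj [simp]: "I \<in> Obj C" "fob F\<^sub>0 I \<in> Obj C"
    using Dom_Obj[of c] Cod_Obj[of c] by simp_all
  have Cont_slice: "(y, c, \<alpha>, fob F y) \<in> Arr (Cont C) \<longleftrightarrow>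
      (pb_fst C c (fob F y), \<alpha>, y) \<in> Arr ?S"
    if "y \<in> Arr C" "Cod C y = I" for y \<alpha>
    using that by (auto simp: Cont_arr_iff)
  obtain \<alpha> where m_eq: "m = (pb_fst C c (fob F x), \<alpha>, x)"
    using m by (rule slice_homE)
  have d_arr: "(x, c, \<alpha>, fob F x) \<in> Arr (Cont C)"
    using m by (simp only: Cont_slice[OF x]) (simp only: m_eq in_hom_iff)
  obtain k where lin_k: "lin_map x c k (fob F x)"
    and d_lin: "(x, c, \<alpha>, fob F x) = lin x c k (fob F x)" and \<alpha>: "\<alpha> = k \<cdot> pb_snd C c (fob F x)"
    using lin_exhaust[OF d_arr c] by metis
  define d where "d = (x, c, \<alpha>, fob F x)"
  have d: "coalgebra (Cont C) F x d"
    using d_arr x by (simp add: coalgebra_def in_hom_iff d_def)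
  have "\<exists>!g. g \<in> hom (Cont C) y x \<and> forward g = Ident C I \<and>
      d \<cdot>\<^bsub>Cont C\<^esub> g = far F g \<cdot>\<^bsub>Cont C\<^esub> d'"
    if d': "coalgebra (Cont C) F y d'" "forward d' = c" and y: "Cod C y = I" for y d'
  proof -
    have y': "y \<in> Arr C"
      using d' by (simp add: coalgebra_def)
    obtain \<alpha>' where d'_eq: "d' = (y, c, \<alpha>', fob F y)"
      and d'_arr: "(y, c, \<alpha>', fob F y) \<in> Arr (Cont C)"
      using d' by (cases d') (auto simp: coalgebra_def in_hom_iff)
    obtain k' where lin_k': "lin_map y c k' (fob F y)"
      and d'_lin: "d' = lin y c k' (fob F y)" and \<alpha>': "\<alpha>' = k' \<cdot> pb_snd C c (fob F y)"
      using lin_exhaust[OF d'_arr c] unfolding d'_eq by metis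
    note D = lin_mapD[OF lin_k] and D' = lin_mapD[OF lin_k']
    let ?b = "(pb_fst C c (fob F y), \<alpha>', y)"
    have b: "?b \<in> hom ?S (pb_fst C c (fob F y)) y"
      using d'_arr by (simp only: Cont_slice[OF y' y] in_hom_iff) (simp only: slice_simps simp_thms)
    \<comment> \<open>The factor \<open>pb_snd\<close> stays on both sides, since both commutation
      conditions produce the equation in this form.\<close>
    define R where "R h \<longleftrightarrow> (x, h, y) \<in> Arr ?S \<and>
      (h \<cdot> k) \<cdot> pb_snd C c (fob F x) = (k' \<cdot> fibre_map I x h y) \<cdot> pb_snd C c (fob F x)" for h
    have slice_eq: "(x, h, y) \<cdot>\<^bsub>?S\<^esub> m = ?b \<cdot>\<^bsub>?S\<^esub> far ?K (x, h, y) \<longleftrightarrow> R h"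
      and cont_eq: "d \<cdot>\<^bsub>Cont C\<^esub> lin y (Ident C I) h x =
        far F (lin y (Ident C I) h x) \<cdot>\<^bsub>Cont C\<^esub> d' \<longleftrightarrow> R h"
      if h: "(x, h, y) \<in> Arr ?S" for h
    proof -
      have h': "h \<in> Arr C" "Dom C h = Dom C x" "Cod C h = Dom C y" "y \<cdot> h = x"
        using h by simp_all
      let ?w = "fibre_map I x h y"
      note w = fibre_map_arr[OF I_Obj(1) h]
      note P = cone_pair[OF cone_fibre_map[OF I_Obj(1) c'(1,3) h]]
      have "\<alpha>' \<cdot> pb_pair C c (fob F y) (pb_fst C c (fob F x)) (?w \<cdot> pb_snd C c (fob F x)) =
          k' \<cdot> (?w \<cdot> pb_snd C c (fob F x))"
        by (simp add: \<alpha>' D'(6-8) y y' P(1-3,5))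
      also have "\<dots> = (k' \<cdot> ?w) \<cdot> pb_snd C c (fob F x)"
        by (simp add: D'(6-8) w(1-3) x)
      finally have 1: "?b \<cdot>\<^bsub>?S\<^esub> far ?K (x, h, y) =
          (pb_fst C c (fob F x), (k' \<cdot> ?w) \<cdot> pb_snd C c (fob F x), y)"
        by (simp only: far_pb_fibre[OF I_Obj(1) h] slice_simps)
      have "h \<cdot> \<alpha> = (h \<cdot> k) \<cdot> pb_snd C c (fob F x)"
        by (simp add: \<alpha> h'(1-3) D(6-8) x)
      then show "(x, h, y) \<cdot>\<^bsub>?S\<^esub> m = ?b \<cdot>\<^bsub>?S\<^esub> far ?K (x, h, y) \<longleftrightarrow> R h"
        using h by (simp only: 1) (simp only: m_eq slice_simps R_def prod.inject simp_thms)
      have lin_h: "lin_map y (Ident C I) h x"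
        using h by (simp only: lin_map_Ident_iff[OF I_Obj(1)])
      note c1 = lin_comp[OF lin_h lin_k]
      note c2 = lin_comp[OF lin_k' fibre_func_far(2)[OF I_Obj(1) h]]
      have ids: "c \<cdot> Ident C I = c" "Ident C (fob F\<^sub>0 I) \<cdot> c = c"
        by simp_all
      show "d \<cdot>\<^bsub>Cont C\<^esub> lin y (Ident C I) h x =
          far F (lin y (Ident C I) h x) \<cdot>\<^bsub>Cont C\<^esub> d' \<longleftrightarrow> R h"
        using h by (simp only: Cont_simps d_def d_lin d'_lin fibre_func_far(1)[OF I_Obj(1) h]
            c1(2)[unfolded ids] c2(2)[unfolded ids]) (simp only: lin_def R_def prod.inject simp_thms)
    qed
    have "h \<in> hom ?S x y \<and> h \<cdot>\<^bsub>?S\<^esub> m = ?b \<cdot>\<^bsub>?S\<^esub> far ?K h \<longleftrightarrow>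
        (\<exists>h'. h = (x, h', y) \<and> R h')" for h
    proof -
      have "h \<in> hom ?S x y \<longleftrightarrow> (\<exists>h'. h = (x, h', y) \<and> (x, h', y) \<in> Arr ?S)"
        by (cases h) (auto simp only: in_hom_iff slice_simps)
      then show ?thesis
        using slice_eq R_def by blast
    qed
    then have "\<exists>!h. \<exists>h'. h = (x, h', y) \<and> R h'"
      using univ[OF y' y b] by simp
    then have "\<exists>!h. R h"
      by blast
    moreover have "g \<in> hom (Cont C) y x \<and> forward g = Ident C I \<and>
        d \<cdot>\<^bsub>Cont C\<^esub> g = far F g \<cdot>\<^bsub>Cont C\<^esub> d' \<longleftrightarrow>
        (\<exists>h. g = lin y (Ident C I) h x \<and> R h)" for g
      using Cont_hom_vertical[OF I_Obj(1), of g y x] cont_eq R_def by blast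
    ultimately show ?thesis
      by (simp only:) blast
  qed
  then show ?thesis
    using that[OF d] by (simp add: d_def)
qed

end


section \<open>Polynomial functors\<close>

lemma is_functor_comp_func:
  assumes F: "is_functor C D F" and G: "is_functor D E G"
  shows "is_functor C E (G \<circ>\<^sub>F F)"
  unfolding is_functor_def comp_func_def
  by (simp add: is_functorD[OF F] is_functorD[OF G] in_hom_iff)

lemma (in category) slice_inverse:
  assumes "inverse_arr (slice C I) (p, h, q) m" "(p, h, q) \<in> Arr (slice C I)"
  obtains h' where "inverse_arr C h h'"
proof -
  have "m \<in> hom (slice C I) q p"
    using assms by (simp add: inverse_arr_def)
  then obtain h' where m: "m = (q, h', p)" "h' \<in> Arr C" "Dom C h' = Dom C q" "Cod C h' = Dom C p"
    by (rule slice_homE)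
  then have "inverse_arr C h h'"
    using assms by (simp add: inverse_arr_def in_hom_iff)
  then show ?thesis
    by (rule that)
qed

lemma (in category) slice_iso:
  assumes h: "(p, h, q) \<in> Arr (slice C I)" and h': "inverse_arr C h h'"
  shows "iso_arr (slice C I) (p, h, q)"
proof -
  have hs: "p \<in> Arr C" "Cod C p = I" "q \<in> Arr C" "Cod C q = I"
    "h \<in> Arr C" "Dom C h = Dom C p" "Cod C h = Dom C q" "q \<cdot> h = p"
    using h by simp_all
  note D = inverse_arrD[OF h']
  have "p \<cdot> h' = q \<cdot> (h \<cdot> h')"
    using Comp_eq_assoc[OF hs(8), of h'] by (simp add: D(2-4) hs(1-7))
  also have "\<dots> = q"
    by (simp add: D(6) hs(3,7))
  finally have "inverse_arr (slice C I) (p, h, q) (q, h', p)"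
    using D(5,6) by (simp add: inverse_arr_def in_hom_iff D(2-4) hs)
  then show ?thesis
    unfolding iso_arr_def by blast
qed

text \<open>Pulling back along an isomorphism \<open>c\<close> is the same as postcomposing with its inverse \<open>\<beta>\<close>.\<close>

lemma (in category_with_pullbacks) polynomial_pb_iso:
  assumes lcc: "locally_cartesian_closed C"
    and G: "polynomial_func C T U G" and \<beta>: "inverse_arr C \<beta> c" and U: "Dom C \<beta> = U"
  shows "polynomial_func C T (Cod C \<beta>) (pb_func C c \<circ>\<^sub>F G)"
proof -
  define V where "V = Cod C \<beta>"
  let ?T = "slice C T" and ?U = "slice C U" and ?V = "slice C V"
  note \<beta>D = inverse_arrD[OF \<beta>]
  have c: "c \<in> Arr C" "Dom C c = V" "Cod C c = U"
    using \<beta>D U by (simp_all add: V_def)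
  \<comment> \<open>Functoriality of pullback is part of the adjunctions given by local cartesian
    closure and is read off from them.\<close>
  have pb_functor: "is_functor (slice C (Cod C f)) (slice C (Dom C f)) (pb_func C f)"
    if "f \<in> Arr C" for f
    using lcc that
    unfolding locally_cartesian_closed_def is_Pi_func_def right_adjoint_def by blast
  have G_functor: "is_functor ?T ?U G"
    using G by (simp add: polynomial_func_def)
  obtain t P u \<Pi> where diag: "t \<in> Arr C" "P \<in> Arr C" "u \<in> Arr C"
    "Cod C t = T" "Dom C t = Dom C P" "Cod C P = Dom C u" "Cod C u = U"
    and \<Pi>: "is_Pi_func C P \<Pi>"
    and iso: "nat_isomorphic ?T ?U G (Sigma_func C u \<circ>\<^sub>F \<Pi> \<circ>\<^sub>F pb_func C t)"
    using G unfolding polynomial_func_def by blast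
  obtain \<eta> where \<eta>: "nat_trans ?T ?U G (Sigma_func C u \<circ>\<^sub>F \<Pi> \<circ>\<^sub>F pb_func C t) \<eta>"
    and \<eta>_iso: "\<And>x. x \<in> Obj ?T \<Longrightarrow> iso_arr ?U (\<eta> x)"
    using iso unfolding nat_isomorphic_def by blast
  define S where "S = \<Pi> \<circ>\<^sub>F pb_func C t"
  have "is_functor (slice C (Dom C P)) (slice C (Cod C P)) \<Pi>"
    using \<Pi> unfolding is_Pi_func_def right_adjoint_def by blast
  then have S: "is_functor ?T (slice C (Dom C u)) S"
    using is_functor_comp_func[OF pb_functor[OF diag(1)]] diag(4-6) by (simp add: S_def)
  have S_fob: "fob S x \<in> Arr C" "Cod C (fob S x) = Dom C u"
    and G_fob: "fob G x \<in> Arr C" "Cod C (fob G x) = U" if "x \<in> Obj ?T" for x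
    using is_functorD(1)[OF S that] is_functorD(1)[OF G_functor that] by simp_all
  have fob_Sigma: "fob (Sigma_func C v \<circ>\<^sub>F S) x = v \<cdot> fob S x" for v x
    by (simp add: comp_func_def Sigma_func_def)
  have \<eta>_hom: "\<eta> x \<in> hom ?U (fob G x) (u \<cdot> fob S x)"
    and \<eta>_nat: "f \<in> Arr ?T \<Longrightarrow> \<eta> (Cod ?T f) \<cdot>\<^bsub>?U\<^esub> far G f =
      far (Sigma_func C u \<circ>\<^sub>F S) f \<cdot>\<^bsub>?U\<^esub> \<eta> (Dom ?T f)"
    if "x \<in> Obj ?T" for x f
    using \<eta> that unfolding nat_trans_def S_def[symmetric] fob_Sigma by blast+
  define e where "e x = fst (snd (\<eta> x))" for x
  have \<eta>_eq: "\<eta> x = (fob G x, e x, u \<cdot> fob S x)"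
    and e: "e x \<in> Arr C" "Dom C (e x) = Dom C (fob G x)" "Cod C (e x) = Dom C (fob S x)"
      "(u \<cdot> fob S x) \<cdot> e x = fob G x" if x: "x \<in> Obj ?T" for x
  proof -
    obtain h where h: "\<eta> x = (fob G x, h, u \<cdot> fob S x)" "h \<in> Arr C" "Dom C h = Dom C (fob G x)"
      "Cod C h = Dom C (u \<cdot> fob S x)" "(u \<cdot> fob S x) \<cdot> h = fob G x"
      using \<eta>_hom[OF x] by (rule slice_homE)
    then have "e x = h"
      by (simp add: e_def)
    then show "\<eta> x = (fob G x, e x, u \<cdot> fob S x)" "e x \<in> Arr C"
      "Dom C (e x) = Dom C (fob G x)" "Cod C (e x) = Dom C (fob S x)"
      "(u \<cdot> fob S x) \<cdot> e x = fob G x"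
      using h S_fob[OF x] diag(3) by simp_all
  qed
  have e_iso: "\<exists>h. inverse_arr C (e x) h" if x: "x \<in> Obj ?T" for x
  proof -
    have "\<eta> x \<in> Arr ?U"
      using \<eta>_hom[OF x] by (simp add: in_hom_iff)
    then show ?thesis
      using \<eta>_iso[OF x] slice_inverse unfolding iso_arr_def \<eta>_eq[OF x] by metis
  qed
  \<comment> \<open>Only the last leg of the polynomial diagram changes, from u to \<beta> u; t, P
    and \<Pi> are kept.\<close>
  let ?u = "\<beta> \<cdot> u"
  \<comment> \<open>The projection onto the domain of G x is invertible because c is, and e x is
    invertible as a component of the given isomorphism. The composite is a map over the new base
    because \<beta> c is an identity.\<close>
  define \<theta> where
    "\<theta> x = (pb_fst C c (fob G x), e x \<cdot> pb_snd C c (fob G x), ?u \<cdot> fob S x)" for x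
  have \<theta>_arr: "\<theta> x \<in> Arr ?V" if x: "x \<in> Obj ?T" for x
  proof -
    note [simp] = S_fob[OF x] G_fob[OF x] e(1-3)[OF x] c diag(3,7) \<beta>D(1) U
    have "(?u \<cdot> fob S x) \<cdot> (e x \<cdot> pb_snd C c (fob G x)) =
        \<beta> \<cdot> (((u \<cdot> fob S x) \<cdot> e x) \<cdot> pb_snd C c (fob G x))"
      by simp
    also have "\<dots> = \<beta> \<cdot> (c \<cdot> pb_fst C c (fob G x))"
      by (simp only: e(4)[OF x]) (simp add: pb_square)
    also have "\<dots> = pb_fst C c (fob G x)"
      by (rule inverse_arr_cancel(2)[OF \<beta>]) (simp_all add: V_def)
    finally show ?thesis
      by (simp add: \<theta>_def V_def[symmetric])
  qed
  have "nat_trans ?T ?V (pb_func C c \<circ>\<^sub>F G) (Sigma_func C ?u \<circ>\<^sub>F S) \<theta>"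
    unfolding nat_trans_def
  proof (intro conjI ballI)
    fix x assume "x \<in> Obj ?T"
    then show "\<theta> x \<in> hom ?V (fob (pb_func C c \<circ>\<^sub>F G) x) (fob (Sigma_func C ?u \<circ>\<^sub>F S) x)"
      using \<theta>_arr by (simp add: in_hom_iff \<theta>_def comp_func_def pb_func_def Sigma_func_def)
  next
    fix f assume f: "f \<in> Arr ?T"
    obtain x f' y where f_eq: "f = (x, f', y)"
      by (cases f)
    have xy: "x \<in> Obj ?T" "y \<in> Obj ?T"
      using f by (simp_all add: f_eq)
    note ty = G_fob[OF xy(1)] G_fob[OF xy(2)] e(1-3)[OF xy(1)] e(1-3)[OF xy(2)] c
    have "far G f \<in> hom ?U (fob G x) (fob G y)"
      using is_functorD(2-4)[OF G_functor f] by (simp add: in_hom_iff f_eq)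
    then obtain g where Gf: "far G f = (fob G x, g, fob G y)" and g: "g \<in> Arr C"
      "Dom C g = Dom C (fob G x)" "Cod C g = Dom C (fob G y)" "fob G y \<cdot> g = fob G x"
      by (rule slice_homE)
    have "far S f \<in> hom (slice C (Dom C u)) (fob S x) (fob S y)"
      using is_functorD(2-4)[OF S f] by (simp add: in_hom_iff f_eq)
    then obtain s where Sf: "far S f = (fob S x, s, fob S y)" and s: "s \<in> Arr C"
      "Dom C s = Dom C (fob S x)" "Cod C s = Dom C (fob S y)" "fob S y \<cdot> s = fob S x"
      by (rule slice_homE)
    have far_Sigma: "far (Sigma_func C v \<circ>\<^sub>F S) f = (v \<cdot> fob S x, s, v \<cdot> fob S y)" for v
      by (simp add: comp_func_def Sigma_func_def Sf)
    have nat: "e y \<cdot> g = s \<cdot> e x"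
      using \<eta>_nat[OF xy(1) f] unfolding far_Sigma Gf
      by (simp add: f_eq \<eta>_eq[OF xy(1)] \<eta>_eq[OF xy(2)])
    have cone: "cone_over c (fob G y) (pb_fst C c (fob G x)) (g \<cdot> pb_snd C c (fob G x))"
      by (simp add: cone_over_def ty g(1-3) Comp_eq_assoc[OF g(4)] pb_square)
    have "(e y \<cdot> pb_snd C c (fob G y)) \<cdot>
        pb_pair C c (fob G y) (pb_fst C c (fob G x)) (g \<cdot> pb_snd C c (fob G x)) =
        e y \<cdot> (g \<cdot> pb_snd C c (fob G x))"
      by (simp add: ty cone_pair[OF cone])
    also have "\<dots> = s \<cdot> (e x \<cdot> pb_snd C c (fob G x))"
      using Comp_eq_assoc[OF nat, of "pb_snd C c (fob G x)"]
      by (simp add: ty g(1-3) s(1-3))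
    finally show "\<theta> (Cod ?T f) \<cdot>\<^bsub>?V\<^esub> far (pb_func C c \<circ>\<^sub>F G) f =
        far (Sigma_func C ?u \<circ>\<^sub>F S) f \<cdot>\<^bsub>?V\<^esub> \<theta> (Dom ?T f)"
      unfolding far_Sigma by (simp add: \<theta>_def comp_func_def pb_func_def Gf) (simp add: f_eq)
  qed
  moreover have "iso_arr ?V (\<theta> x)" if x: "x \<in> Obj ?T" for x
  proof -
    obtain h where h: "inverse_arr C (e x) h"
      using e_iso[OF x] by blast
    obtain s where s: "inverse_arr C (pb_snd C c (fob G x)) s"
      using pb_snd_inverse[OF inverse_arr_sym[OF \<beta>] G_fob(1)[OF x]] G_fob(2)[OF x] c(3) by auto
    have "Cod C (pb_snd C c (fob G x)) = Dom C (e x)"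
      using e(2)[OF x] G_fob[OF x] c by simp
    from slice_iso[OF _ inverse_arr_comp[OF s h this]] \<theta>_arr[OF x] show ?thesis
      unfolding \<theta>_def by blast
  qed
  ultimately have "nat_isomorphic ?T ?V (pb_func C c \<circ>\<^sub>F G) (Sigma_func C ?u \<circ>\<^sub>F \<Pi> \<circ>\<^sub>F pb_func C t)"
    unfolding nat_isomorphic_def S_def by blast
  moreover have "is_functor ?T ?V (pb_func C c \<circ>\<^sub>F G)"
    using is_functor_comp_func[OF G_functor] pb_functor[OF c(1)] c by simp
  moreover have "?u \<in> Arr C" "Cod C P = Dom C ?u" "Cod C ?u = V"
    using diag \<beta>D(1) U by (simp_all add: V_def)
  ultimately show ?thesis
    using diag(1,2,4,5) \<Pi> unfolding polynomial_func_def V_def[symmetric] by blast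
qed


section \<open>The base category\<close>

text \<open>Over a terminal object every triangle commutes, so slice arrows are just arrows between
  the domains.\<close>

lemma (in category) terminal_slice_hom:
  assumes "is_terminal C t" "p \<in> Arr C" "Cod C p = t" "q \<in> Arr C" "Cod C q = t"
  shows "m \<in> hom (slice C t) p q \<longleftrightarrow> (\<exists>h. m = (p, h, q) \<and> h \<in> hom C (Dom C p) (Dom C q))"
proof -
  have "q \<cdot> h = p" if "h \<in> hom C (Dom C p) (Dom C q)" for h
  proof -
    have "\<exists>!f. f \<in> hom C (Dom C p) t"
      using assms by (simp add: is_terminal_def)
    moreover have "q \<cdot> h \<in> hom C (Dom C p) t" "p \<in> hom C (Dom C p) t"
      using that assms by (simp_all add: in_hom_iff)
    ultimately show ?thesis
      by blast
  qed
  then show ?thesis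
    using assms(2-5) by (cases m) (auto simp add: in_hom_iff)
qed

lemma (in category) to_terminal_arr:
  assumes "is_terminal C t" "x \<in> Obj C"
  shows "to_terminal C t x \<in> Arr C" "Dom C (to_terminal C t x) = x" "Cod C (to_terminal C t x) = t"
proof -
  have "\<exists>!f. f \<in> hom C x t"
    using assms by (simp add: is_terminal_def)
  from theI'[OF this] show "to_terminal C t x \<in> Arr C" "Dom C (to_terminal C t x) = x"
    "Cod C (to_terminal C t x) = t"
    by (simp_all add: to_terminal_def in_hom_iff)
qed

lemma slice_terminal_conj:
  "fob (slice_terminal C t \<circ>\<^sub>F G \<circ>\<^sub>F slice_dom C) p = to_terminal C t (fob G (Dom C p))"
  "far (slice_terminal C t \<circ>\<^sub>F G \<circ>\<^sub>F slice_dom C) (p, h, q) =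
    (to_terminal C t (Dom C (far G h)), far G h, to_terminal C t (Cod C (far G h)))"
  by (simp_all add: comp_func_def slice_terminal_def slice_dom_def)

text \<open>Polynomiality of the base functor is stated on the slice over a terminal object, so the
  initial algebra given by W-types lives there; taking middle components carries it to C.\<close>

lemma (in category) initial_algebra_from_slice:
  assumes t: "is_terminal C t" and G: "is_functor C C G"
    and init: "initial_algebra (slice C t) (slice_terminal C t \<circ>\<^sub>F G \<circ>\<^sub>F slice_dom C) x m"
  shows "initial_algebra C G (Dom C x) (fst (snd m))"
proof -
  let ?S = "slice C t" and ?G = "slice_terminal C t \<circ>\<^sub>F G \<circ>\<^sub>F slice_dom C"
  note GD = is_functorD[OF G] and tt = to_terminal_arr[OF t]
  have x: "x \<in> Arr C" "Cod C x = t"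
    and m: "m \<in> hom ?S (to_terminal C t (fob G (Dom C x))) x"
    using initial_algebraD(1)[OF init] by (simp_all add: algebra_def slice_terminal_conj)
  obtain a where m_eq: "m = (to_terminal C t (fob G (Dom C x)), a, x)"
    and a: "a \<in> hom C (fob G (Dom C x)) (Dom C x)"
    using m x GD(1) tt terminal_slice_hom[OF t] by (metis Dom_Obj)
  have "\<exists>!h. h \<in> hom C (Dom C x) y \<and> h \<cdot> a = b \<cdot> far G h" if b: "algebra C G y b" for y b
  proof -
    let ?y = "to_terminal C t y" and ?b = "(to_terminal C t (fob G y), b, to_terminal C t y)"
    have y: "y \<in> Obj C" "b \<in> hom C (fob G y) y"
      using b by (simp_all add: algebra_def)
    have "algebra ?S ?G ?y ?b"
      using y by (simp add: algebra_def slice_terminal_conj tt GD terminal_slice_hom[OF t])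
    from initial_algebraD(2)[OF init this]
    have "\<exists>!f. f \<in> hom ?S x ?y \<and> f \<cdot>\<^bsub>?S\<^esub> m = ?b \<cdot>\<^bsub>?S\<^esub> far ?G f" .
    moreover have "f \<in> hom ?S x ?y \<and> f \<cdot>\<^bsub>?S\<^esub> m = ?b \<cdot>\<^bsub>?S\<^esub> far ?G f \<longleftrightarrow>
        (\<exists>h. f = (x, h, ?y) \<and> h \<in> hom C (Dom C x) y \<and> h \<cdot> a = b \<cdot> far G h)" for f
    proof -
      have "(x, h, ?y) \<cdot>\<^bsub>?S\<^esub> m = ?b \<cdot>\<^bsub>?S\<^esub> far ?G (x, h, ?y) \<longleftrightarrow> h \<cdot> a = b \<cdot> far G h"
        if "h \<in> hom C (Dom C x) y" for h
        using that by (simp add: m_eq slice_terminal_conj GD in_hom_iff)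
      moreover have "f \<in> hom ?S x ?y \<longleftrightarrow> (\<exists>h. f = (x, h, ?y) \<and> h \<in> hom C (Dom C x) y)"
        using y by (simp add: terminal_slice_hom[OF t] x tt)
      ultimately show ?thesis
        by blast
    qed
    ultimately have "\<exists>!f. \<exists>h. f = (x, h, ?y) \<and> h \<in> hom C (Dom C x) y \<and> h \<cdot> a = b \<cdot> far G h"
      by simp
    then show ?thesis
      by blast
  qed
  then show ?thesis
    using a x by (simp add: initial_algebra_def algebra_def m_eq)
qed

text \<open>The slice construction is not self-dual, so the argument is repeated with the arrows
  between coalgebras reversed.\<close>

lemma (in category) terminal_coalgebra_from_slice:
  assumes t: "is_terminal C t" and G: "is_functor C C G"
    and "terminal": "terminal_coalgebra (slice C t) (slice_terminal C t \<circ>\<^sub>F G \<circ>\<^sub>F slice_dom C) x m"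
  shows "terminal_coalgebra C G (Dom C x) (fst (snd m))"
proof -
  let ?S = "slice C t" and ?G = "slice_terminal C t \<circ>\<^sub>F G \<circ>\<^sub>F slice_dom C"
  note GD = is_functorD[OF G] and tt = to_terminal_arr[OF t]
  have x: "x \<in> Arr C" "Cod C x = t"
    and m: "m \<in> hom ?S x (to_terminal C t (fob G (Dom C x)))"
    using terminal_coalgebraD(1)[OF "terminal"] by (simp_all add: coalgebra_def slice_terminal_conj)
  obtain c where m_eq: "m = (x, c, to_terminal C t (fob G (Dom C x)))"
    and c: "c \<in> hom C (Dom C x) (fob G (Dom C x))"
    using m x GD(1) tt terminal_slice_hom[OF t] by (metis Dom_Obj)
  have "\<exists>!h. h \<in> hom C y (Dom C x) \<and> c \<cdot> h = far G h \<cdot> d" if d: "coalgebra C G y d" for y d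
  proof -
    let ?y = "to_terminal C t y" and ?d = "(to_terminal C t y, d, to_terminal C t (fob G y))"
    have y: "y \<in> Obj C" "d \<in> hom C y (fob G y)"
      using d by (simp_all add: coalgebra_def)
    have "coalgebra ?S ?G ?y ?d"
      using y by (simp add: coalgebra_def slice_terminal_conj tt GD terminal_slice_hom[OF t])
    from terminal_coalgebraD(2)[OF "terminal" this]
    have "\<exists>!f. f \<in> hom ?S ?y x \<and> m \<cdot>\<^bsub>?S\<^esub> f = far ?G f \<cdot>\<^bsub>?S\<^esub> ?d" .
    moreover have "f \<in> hom ?S ?y x \<and> m \<cdot>\<^bsub>?S\<^esub> f = far ?G f \<cdot>\<^bsub>?S\<^esub> ?d \<longleftrightarrow>
        (\<exists>h. f = (?y, h, x) \<and> h \<in> hom C y (Dom C x) \<and> c \<cdot> h = far G h \<cdot> d)" for f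
    proof -
      have "m \<cdot>\<^bsub>?S\<^esub> (?y, h, x) = far ?G (?y, h, x) \<cdot>\<^bsub>?S\<^esub> ?d \<longleftrightarrow> c \<cdot> h = far G h \<cdot> d"
        if "h \<in> hom C y (Dom C x)" for h
        using that by (simp add: m_eq slice_terminal_conj GD in_hom_iff)
      moreover have "f \<in> hom ?S ?y x \<longleftrightarrow> (\<exists>h. f = (?y, h, x) \<and> h \<in> hom C y (Dom C x))"
        using y by (simp add: terminal_slice_hom[OF t] x tt)
      ultimately show ?thesis
        by blast
    qed
    ultimately have "\<exists>!f. \<exists>h. f = (?y, h, x) \<and> h \<in> hom C y (Dom C x) \<and> c \<cdot> h = far G h \<cdot> d"
      by simp
    then show ?thesis
      by blast
  qed
  then show ?thesis
    using c x by (simp add: terminal_coalgebra_def coalgebra_def m_eq)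
qed

text \<open>The cospan \<open>0 \<rightarrow> 2 \<leftarrow> 1\<close>, where \<open>3\<close> and \<open>4\<close> are its two arrows and \<open>0\<close>, \<open>1\<close>, \<open>2\<close> also name the identities.\<close>

definition cospan :: "(nat, nat) cat" where
  "cospan = \<lparr>Obj = {0, 1, 2}, Arr = {0, 1, 2, 3, 4},
     Dom = \<lambda>u. if u = 3 then 0 else if u = 4 then 1 else u,
     Cod = \<lambda>u. if u = 3 \<or> u = 4 then 2 else u,
     Ident = \<lambda>x. x,
     Comp = \<lambda>g f. if g = 3 \<or> g = 4 then g else f\<rparr>"

lemma category_cospan: "category cospan"
  by unfold_locales (auto simp: cospan_def hom_def split: if_splits)

text \<open>A cone over the cospan is determined by its legs at 0 and 1, the leg at 2 being forced
  to be f after the first; so a limit of the diagram is a pullback.\<close>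

lemma (in category) category_with_pullbacks:
  assumes "has_finite_limits C"
  shows "category_with_pullbacks C"
proof
  fix f q assume fq: "f \<in> Arr C" "q \<in> Arr C" "Cod C f = Cod C q"
  define D :: "(nat, nat, 'o, 'a) func" where
    "D = \<lparr>fob = \<lambda>x. if x = 0 then Dom C f else if x = 1 then Dom C q else Cod C q,
      far = \<lambda>u. if u = 3 then f else if u = 4 then q else
        Ident C (if u = 0 then Dom C f else if u = 1 then Dom C q else Cod C q)\<rparr>"
  have "is_functor cospan C D"
    using fq by (auto simp: is_functor_def cospan_def D_def in_hom_iff)
  moreover have "finite (Obj cospan)" "finite (Arr cospan)"
    by (simp_all add: cospan_def)
  ultimately obtain l \<pi> where lim: "is_limit cospan C D l \<pi>"
    using assms category_cospan unfolding has_finite_limits_def by blast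
  have cone: "is_cone cospan C D x \<kappa> \<longleftrightarrow> \<kappa> 0 \<in> hom C x (Dom C f) \<and> \<kappa> 1 \<in> hom C x (Dom C q) \<and>
      \<kappa> 2 = f \<cdot> \<kappa> 0 \<and> f \<cdot> \<kappa> 0 = q \<cdot> \<kappa> 1" for x \<kappa>
    using fq by (auto simp: is_cone_def cospan_def D_def in_hom_iff)
  have \<pi>: "\<pi> 0 \<in> hom C l (Dom C f)" "\<pi> 1 \<in> hom C l (Dom C q)" "\<pi> 2 = f \<cdot> \<pi> 0"
    "f \<cdot> \<pi> 0 = q \<cdot> \<pi> 1"
    using lim cone by (auto simp: is_limit_def)
  have "\<exists>!h. h \<in> hom C x (Dom C (\<pi> 0)) \<and> \<pi> 0 \<cdot> h = u \<and> \<pi> 1 \<cdot> h = v"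
    if u: "u \<in> hom C x (Dom C f)" and v: "v \<in> hom C x (Dom C q)" and uv: "f \<cdot> u = q \<cdot> v" for x u v
  proof -
    define \<kappa> where "\<kappa> j = (if j = 0 then u else if j = 1 then v else f \<cdot> u)" for j :: nat
    have "is_cone cospan C D x \<kappa>"
      using u v uv by (simp add: cone \<kappa>_def)
    then have "\<exists>!h. h \<in> hom C x l \<and> (\<forall>j\<in>Obj cospan. \<pi> j \<cdot> h = \<kappa> j)"
      using lim by (simp add: is_limit_def)
    moreover have "h \<in> hom C x l \<and> (\<forall>j\<in>Obj cospan. \<pi> j \<cdot> h = \<kappa> j) \<longleftrightarrow>
        h \<in> hom C x (Dom C (\<pi> 0)) \<and> \<pi> 0 \<cdot> h = u \<and> \<pi> 1 \<cdot> h = v" for h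
      using \<pi>(1-3) fq by (auto simp: cospan_def \<kappa>_def in_hom_iff)
    ultimately show ?thesis
      by simp
  qed
  then have "is_pullback C f q (\<pi> 0) (\<pi> 1)"
    using fq \<pi> by (simp add: is_pullback_def in_hom_iff)
  then show "\<exists>p r. is_pullback C f q p r"
    by blast
qed

section \<open>The three fixed points of a fibred polynomial functor\<close>

theorem theorem3p7:
  fixes C :: "('o, 'a) cat"
    and F :: "('a, 'a cont_arr, 'a, 'a cont_arr) func"
    and F\<^sub>0 :: "('o, 'a, 'o, 'a) func"
  assumes "category C"
    and "lextensive C"
    and "locally_cartesian_closed C"
    and "has_dependent_W_types C"
    and "has_dependent_M_types C"
    and "fibred_polynomial_func C F F\<^sub>0"
  shows "(\<exists>\<mu> a. initial_algebra (Cont C) F \<mu> a) \<and>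
         (\<exists>\<nu> c. terminal_coalgebra (Cont C) F \<nu> c) \<and>
         (\<exists>\<zeta> b c. algebra (Cont C) F \<zeta> b \<and>
            inverse_arr C (forward b) c \<and>
            terminal_coalgebra C F\<^sub>0 (Cod C \<zeta>) c \<and>
            terminal_coalgebra (slice C (Cod C \<zeta>))
              (pb_func C c \<circ>\<^sub>F fibre_func C F (Cod C \<zeta>))
              \<zeta> (induced_coalgebra_map C F \<zeta> b c))"
proof -
  interpret category C
    by fact
  have "category_with_pullbacks C"
    using assms(2) by (intro category_with_pullbacks) (simp add: lextensive_def)
  then interpret category_with_pullbacks C .
  have F: "is_functor (Cont C) (Cont C) F" and F\<^sub>0: "is_functor C C F\<^sub>0"
    and shape_F: "eq_func (Cont C) (shape C \<circ>\<^sub>F F) (F\<^sub>0 \<circ>\<^sub>F shape C)"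
    and F\<^sub>0_poly: "polynomial_endofunc C F\<^sub>0"
    and F_poly: "\<And>I. I \<in> Obj C \<Longrightarrow> polynomial_func C I (fob F\<^sub>0 I) (fibre_func C F I)"
    using assms(6) by (auto simp: fibred_polynomial_func_def)
  interpret fibred_endofunc C F F\<^sub>0
    by unfold_locales (fact F F\<^sub>0 shape_F)+
  \<comment> \<open>Stated for an arbitrary inverse pair, because it is used over the initial
    algebra M as well as over the terminal coalgebra N.\<close>
  have K_poly: "polynomial_func C I I (pb_func C c \<circ>\<^sub>F fibre_func C F I)"
    if "inverse_arr C \<beta> c" "Dom C \<beta> = fob F\<^sub>0 I" "Cod C \<beta> = I" "I \<in> Obj C" for I \<beta> c
    using polynomial_pb_iso[OF assms(3) F_poly[OF that(4)] that(1,2)] that(3) by simp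
  obtain t where t: "is_terminal C t" and t_poly:
      "polynomial_func C t t (slice_terminal C t \<circ>\<^sub>F F\<^sub>0 \<circ>\<^sub>F slice_dom C)"
    using F\<^sub>0_poly by (auto simp: polynomial_endofunc_def)
  have t_Obj: "t \<in> Obj C"
    using t by (simp add: is_terminal_def)
  obtain M \<alpha> where M: "initial_algebra C F\<^sub>0 M \<alpha>"
    using assms(4) t_poly t_Obj initial_algebra_from_slice[OF t F\<^sub>0]
    unfolding has_dependent_W_types_def by blast
  obtain N c where N: "terminal_coalgebra C F\<^sub>0 N c"
    using assms(5) t_poly t_Obj terminal_coalgebra_from_slice[OF t F\<^sub>0]
    unfolding has_dependent_M_types_def by blast
  have \<alpha>: "Dom C \<alpha> = fob F\<^sub>0 M" "Cod C \<alpha> = M" "M \<in> Obj C"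
    using initial_algebraD(1)[OF M] by (auto simp: algebra_def in_hom_iff)
  have c: "Dom C c = N" "Cod C c = fob F\<^sub>0 N" "N \<in> Obj C"
    using terminal_coalgebraD(1)[OF N] by (auto simp: coalgebra_def in_hom_iff)
  obtain \<gamma> where \<gamma>: "inverse_arr C \<alpha> \<gamma>"
    using initial_algebra_inverse[OF assms(1) F\<^sub>0 M] by blast
  obtain \<beta> where \<beta>: "inverse_arr C c \<beta>"
    using terminal_coalgebra_inverse[OF assms(1) F\<^sub>0 N] by blast
  note \<beta>' = inverse_arr_sym[OF \<beta>]
  have \<beta>_ty: "Dom C \<beta> = fob F\<^sub>0 N" "Cod C \<beta> = N"
    using inverse_arrD[OF \<beta>] c by simp_all
  have "\<exists>\<mu> a. initial_algebra (Cont C) F \<mu> a"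
  proof -
    obtain x m where x: "terminal_coalgebra (slice C M) (pb_func C \<gamma> \<circ>\<^sub>F fibre_func C F M) x m"
      using assms(5) K_poly[OF \<gamma> \<alpha>] \<alpha>(3) unfolding has_dependent_M_types_def by blast
    have x_Cod: "Cod C x = M"
      using terminal_coalgebraD(1)[OF x] by (simp add: coalgebra_def)
    obtain a where a: "algebra (Cont C) F x a" "forward a = \<alpha>"
        "induced_coalgebra_map C F x a \<gamma> = m"
      and fibre: "\<And>y b'. algebra (Cont C) F y b' \<Longrightarrow> Cod C y = M \<Longrightarrow> forward b' = \<alpha> \<Longrightarrow>
        \<exists>!h. h \<in> hom (Cont C) x y \<and> forward h = Ident C M \<and>
          h \<cdot>\<^bsub>Cont C\<^esub> a = b' \<cdot>\<^bsub>Cont C\<^esub> far F h"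
      by (rule terminal_fibre_coalgebra[OF \<gamma> \<alpha>(2,1) x]) (rule that)
    have "initial_algebra (Cont C) F x a"
    proof (rule initial_algebra_total[OF category_Cont assms(1) F F\<^sub>0 is_functor_shape shape_F])
      show "\<exists>k. cartesian_lift (Cont C) C (shape C) \<phi> y k"
        if "\<phi> \<in> Arr C" "y \<in> Obj (Cont C)" "Cod C \<phi> = fob (shape C) y" for \<phi> y
        using shape_cartesian_lift that by simp
    qed (use M a fibre x_Cod in simp_all)
    then show ?thesis
      by blast
  qed
  moreover have "\<exists>\<nu> c. terminal_coalgebra (Cont C) F \<nu> c"
  proof -
    obtain x m where x: "initial_algebra (slice C N) (pb_func C c \<circ>\<^sub>F fibre_func C F N) x m"
      using assms(4) K_poly[OF \<beta>' \<beta>_ty] c(3) unfolding has_dependent_W_types_def by blast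
    have x_Cod: "Cod C x = N"
      using initial_algebraD(1)[OF x] by (simp add: algebra_def)
    obtain d where d: "coalgebra (Cont C) F x d" "forward d = c"
      and fibre: "\<And>y d'. coalgebra (Cont C) F y d' \<Longrightarrow> Cod C y = N \<Longrightarrow> forward d' = c \<Longrightarrow>
        \<exists>!h. h \<in> hom (Cont C) y x \<and> forward h = Ident C N \<and>
          d \<cdot>\<^bsub>Cont C\<^esub> h = far F h \<cdot>\<^bsub>Cont C\<^esub> d'"
      by (rule initial_fibre_algebra[OF \<beta> c(1,2) x]) (rule that)
    have "terminal_coalgebra (Cont C) F x d"
    proof (rule terminal_coalgebra_total[OF category_Cont assms(1) F F\<^sub>0 is_functor_shape shape_F])
      show "\<exists>k. cartesian_lift (dual (Cont C)) (dual C) (shape C) \<phi> y k"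
        if \<phi>: "\<phi> \<in> Arr C" and y: "y \<in> Obj (Cont C)" "Dom C \<phi> = fob (shape C) y" for \<phi> y
      proof -
        obtain G where "is_Pi_func C \<phi> G"
          using assms(3) \<phi> unfolding locally_cartesian_closed_def by blast
        from shape_opcartesian_lift[OF this \<phi>] y show ?thesis
          by simp
      qed
    qed (use N d fibre x_Cod in simp_all)
    then show ?thesis
      by blast
  qed
  moreover have "\<exists>\<zeta> b c. algebra (Cont C) F \<zeta> b \<and> inverse_arr C (forward b) c \<and>
      terminal_coalgebra C F\<^sub>0 (Cod C \<zeta>) c \<and>
      terminal_coalgebra (slice C (Cod C \<zeta>)) (pb_func C c \<circ>\<^sub>F fibre_func C F (Cod C \<zeta>))
        \<zeta> (induced_coalgebra_map C F \<zeta> b c)"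
  proof -
    obtain x m where x: "terminal_coalgebra (slice C N) (pb_func C c \<circ>\<^sub>F fibre_func C F N) x m"
      using assms(5) K_poly[OF \<beta>' \<beta>_ty] c(3) unfolding has_dependent_M_types_def by blast
    have "Cod C x = N"
      using terminal_coalgebraD(1)[OF x] by (simp add: coalgebra_def)
    \<comment> \<open>The coalgebra induced by b is exactly m, so its terminality is that of
      m.\<close>
    moreover obtain b where "algebra (Cont C) F x b" "forward b = \<beta>"
      "induced_coalgebra_map C F x b c = m"
      by (rule terminal_fibre_coalgebra[OF \<beta>' \<beta>_ty(2,1) x])
    ultimately show ?thesis
      using x N \<beta>' by metis
  qed
  ultimately show ?thesis
    by blast
qed

end
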